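(* Let $p$, $q$ and $r$ be distinct prime numbers with $p \equiv q \equiv 3 \pmod{4}$ and $r \equiv 1 \pmod{8}$. Assume that $\left(\frac{p}{r}\right) = 1$ and $\left(\frac{q}{r}\right) = -1$, where $\left(\frac{\cdot}{r}\right)$ denotes the Legendre symbol. Then for the bi-quadratic field $F = \mathbb{Q}(\sqrt{p}, \sqrt{qr})$ we have $Po(F) \simeq \mathbb{Z}/2\mathbb{Z}$. In particular, $F$ is not a Pólya field.
   Context: Let $K$ be a number field with ring of integers $\mathcal{O}_K$ and ideal class group $Cl_K$. Define $Int(\mathcal{O}_K) = \{f(X) \in K[X] : f(\mathcal{O}_K) \subseteq \mathcal{O}_K\}$, regarded as an $\mathcal{O}_K$-module. A basis $\{f_j\}_{j \geq 0}$ of the $\mathcal{O}_K$-module $Int(\mathcal{O}_K)$ is called regular if $\deg(f_j) = j$ for all $j \geq 0$. The field $K$ is called a Pólya field if the $\mathcal{O}_K$-module $Int(\mathcal{O}_K)$ admits a regular basis. For each integer $n \geq 1$, let $\mathfrak{J}_n(K) = \{\text{leading coefficients of elements of } Int(\mathcal{O}_K) \text{ of degree } n\} \cup \{0\}$; this is a fractional ideal of $K$. The Pólya group $Po(K)$ is the subgroup of $Cl_K$ generated by the ideal classes $[\mathfrak{J}_n(K)]$, $n \geq 1$. *)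

theory Defs
  imports
    "HOL-Algebra.Algebraic_Closure_Type"
    "HOL-Algebra.Generated_Fields"
    "HOL-Algebra.Ideal_Product"
    "HOL-Algebra.Elementary_Groups"
    "HOL-Computational_Algebra.Polynomial"
    "HOL-Number_Theory.Residues"
begin

text \<open>
  A number field is given by its underlying set \<open>K\<close> of complex numbers; the definitions are
  intended for subfields \<open>K\<close> of the complex numbers of finite degree over the rationals.
\<close>

abbreviation complex_field :: "complex ring" where
  "complex_field \<equiv> ring_of_type_algebra"

text \<open>In characteristic zero, the field generated by a set \<open>S\<close> is \<open>\<rat>(S)\<close>.\<close>

definition rat_adjoin :: "complex set \<Rightarrow> complex set" where
  "rat_adjoin S = generate_field complex_field S"

definition ring_of_integers :: "complex set \<Rightarrow> complex set" where
  "ring_of_integers K = {x \<in> K. algebraic_int x}"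


subsection \<open>Integer-valued polynomials\<close>

definition int_valued_polys :: "complex set \<Rightarrow> complex poly set" where
  "int_valued_polys K =
     {f. (\<forall>i. coeff f i \<in> K) \<and> (\<forall>x \<in> ring_of_integers K. poly f x \<in> ring_of_integers K)}"

text \<open>
  A basis over \<open>R\<close> of an \<open>R\<close>-module \<open>M\<close> of polynomials, indexed by the natural numbers:
  every element of \<open>M\<close> is a finite \<open>R\<close>-linear combination of the \<open>f j\<close>, with unique coefficients.
\<close>

definition module_basis :: "complex set \<Rightarrow> complex poly set \<Rightarrow> (nat \<Rightarrow> complex poly) \<Rightarrow> bool" where
  "module_basis R M f \<longleftrightarrow>
     (\<forall>j. f j \<in> M) \<and>
     (\<forall>g \<in> M. \<exists>!c. (\<forall>j. c j \<in> R) \<and> finite {j. c j \<noteq> 0} \<and>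
                   g = (\<Sum>j | c j \<noteq> 0. smult (c j) (f j)))"

definition regular_basis :: "complex set \<Rightarrow> (nat \<Rightarrow> complex poly) \<Rightarrow> bool" where
  "regular_basis K f \<longleftrightarrow>
     module_basis (ring_of_integers K) (int_valued_polys K) f \<and> (\<forall>j. degree (f j) = j)"

definition polya_field :: "complex set \<Rightarrow> bool" where
  "polya_field K \<longleftrightarrow> (\<exists>f. regular_basis K f)"


subsection \<open>The ideal class group\<close>

text \<open>
  Nonzero fractional ideals. Closure under additive inverses follows from closure under
  multiplication by \<open>-1\<close>, which lies in the ring of integers.
\<close>

definition fractional_ideal :: "complex set \<Rightarrow> complex set \<Rightarrow> bool" where
  "fractional_ideal K I \<longleftrightarrow>
     I \<subseteq> K \<and> 0 \<in> I \<and> I \<noteq> {0} \<and>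
     (\<forall>x \<in> I. \<forall>y \<in> I. x + y \<in> I) \<and>
     (\<forall>a \<in> ring_of_integers K. \<forall>x \<in> I. a * x \<in> I) \<and>
     (\<exists>d \<in> ring_of_integers K. d \<noteq> 0 \<and> (\<forall>x \<in> I. d * x \<in> ring_of_integers K))"

text \<open>
  \<open>ideal_prod complex_field I J\<close> is the set of nonempty finite sums of products \<open>x * y\<close> with
  \<open>x \<in> I\<close> and \<open>y \<in> J\<close>; it uses only the addition and multiplication of the complex numbers,
  so it is also the product of fractional ideals.
\<close>

definition fractional_ideal_group :: "complex set \<Rightarrow> complex set monoid" where
  "fractional_ideal_group K =
     \<lparr>carrier = {I. fractional_ideal K I},
      monoid.mult = ideal_prod complex_field,
      one = ring_of_integers K\<rparr>"

definition principal_ideals :: "complex set \<Rightarrow> complex set set" where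
  "principal_ideals K = {(\<lambda>a. x * a) ` ring_of_integers K | x. x \<in> K \<and> x \<noteq> 0}"

definition class_group :: "complex set \<Rightarrow> complex set set monoid" where
  "class_group K = fractional_ideal_group K Mod principal_ideals K"

definition ideal_class :: "complex set \<Rightarrow> complex set \<Rightarrow> complex set set" where
  "ideal_class K I = principal_ideals K #>\<^bsub>fractional_ideal_group K\<^esub> I"


subsection \<open>The Polya group\<close>

definition char_ideal :: "complex set \<Rightarrow> nat \<Rightarrow> complex set" where
  "char_ideal K n = {lead_coeff f | f. f \<in> int_valued_polys K \<and> degree f = n} \<union> {0}"

definition polya_group :: "complex set \<Rightarrow> complex set set monoid" where
  "polya_group K =
     (class_group K)\<lparr>carrier :=
        generate (class_group K) {ideal_class K (char_ideal K n) | n. n \<ge> 1}\<rparr>"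

end

theory Submission
  imports
    Defs
    "HOL-Analysis.Kronecker_Approximation_Theorem"
    "Jordan_Normal_Form.Char_Poly"
    "HOL-Computational_Algebra.Nth_Powers"
    "HOL-Number_Theory.Euler_Criterion"
begin

text \<open>
  Write \<open>u = \<surd>p\<close>, \<open>v = \<surd>(qr)\<close> and \<open>J\<^sub>n\<close> for the characteristic ideals. Every \<open>J\<^sub>n\<close> is stable
  under the Galois group of \<open>F\<close>, and a stable ideal is, up to a rational factor, a product of the
  radicals of the ramified primes 2, \<open>p\<close>, \<open>q\<close>, \<open>r\<close>. The radicals above \<open>p\<close> and \<open>qr\<close> are generated
  by \<open>u\<close> and \<open>v\<close>, the one above 2 by a solution of \<open>A\<^sup>2 - p B\<^sup>2 = \<plusminus>2\<close>, so only the class of the radical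
  \<open>\<PP>\<close> of \<open>r\<close> remains, and its square is principal.

  Comparing \<open>J\<^bsub>r\<^esub>\<close> with \<open>J\<^bsub>r-1\<^esub>\<close> shows \<open>J\<^bsub>r-1\<^esub> = \<PP> J\<^bsub>r\<^esub>\<close>; were both principal, some \<open>z \<in> F\<close> would satisfy
  \<open>z\<^sup>2 = r * unit\<close>. Taking the relative norm of \<open>z v / r\<close> to \<open>\<rat>(u)\<close> and reducing modulo a prime
  above \<open>r\<close>, where all units of \<open>\<int>[u]\<close> are squares, would make \<open>q\<close> a square modulo \<open>r\<close>.
\<close>

subsection \<open>Algebraic integers form a ring\<close>

text \<open>The hypotheses enter as follows. Since \<open>p\<close> is a square modulo
  \<open>r\<close>, the primes of \<open>F\<close> above \<open>r\<close> have residue field of size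
  \<open>r\<close>, which is why the characteristic ideals change by \<open>\<PP>\<close> at index
  \<open>r\<close>. As \<open>r \<equiv> 1\<close> modulo 8, both \<open>- 1\<close> and 2 are
  squares modulo \<open>r\<close>; together with \<open>p\<close> this covers every square class
  that a unit of \<open>\<int>[u]\<close> can produce. As \<open>p \<equiv> 3\<close> modulo 4,
  these units have norm 1, and 2 is a norm up to sign. As \<open>pqr \<equiv> 1\<close> modulo 4,
  the ramification index of 2 in \<open>F\<close> is 2, so an element of norm
  \<open>\<plusminus>2\<close> gives the whole radical above 2. Two devices take the place of ideal
  factorization and of an integral basis. Stable integral ideals are treated by induction on the
  positive generator of \<open>I \<inter> \<int>\<close>, dividing by elements with known
  conjugates. Integrality of a quotient \<open>x / l\<close> is checked separately at
  \<open>l\<close> and away from \<open>l\<close>: an element is integral if two coprime integer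
  multiples of it are, so coordinates need to be known only up to denominators prime to
  \<open>l\<close>.\<close>

lemma algebraic_int_if_int_eigenvalue:
  fixes A :: "nat \<Rightarrow> nat \<Rightarrow> int" and w :: "nat \<Rightarrow> 'a::field_char_0"
  assumes eig: "\<And>i. i < n \<Longrightarrow> x * w i = (\<Sum>j<n. of_int (A i j) * w j)"
    and nz: "k < n" "w k \<noteq> 0"
  shows "algebraic_int x"
proof -
  define M where "M = Matrix.mat n n (\<lambda>(i, j). A i j)"
  define N :: "'a mat" where "N = map_mat of_int M"
  define v where "v = Matrix.vec n w"
  have M: "M \<in> carrier_mat n n" and N: "N \<in> carrier_mat n n"
    by (auto simp: M_def N_def)
  have "N *\<^sub>v v = x \<cdot>\<^sub>v v"
    by (rule eq_vecI)
      (auto simp: N_def M_def v_def scalar_prod_def eig lessThan_atLeast0 intro!: sum.cong)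
  moreover have "v \<noteq> 0\<^sub>v n"
    using nz by (auto simp: v_def Matrix.vec_eq_iff)
  ultimately have "eigenvalue N x"
    unfolding eigenvalue_def eigenvector_def using N by (metis carrier_matD(1) v_def vec_carrier)
  \<comment> \<open>\<open>N\<close> has integer entries, so its characteristic polynomial is monic
    over the integers, and the eigenvalue \<open>x\<close> is a root.\<close>
  then have "poly (char_poly N) x = 0"
    using eigenvalue_root_char_poly[OF N] by simp
  moreover have "char_poly N = map_poly of_int (char_poly M)"
    unfolding N_def by (rule of_int_hom.char_poly_hom[OF M])
  moreover have "lead_coeff (char_poly M) = 1"
    using degree_monic_char_poly[OF M] by auto
  ultimately show ?thesis
    unfolding algebraic_int_altdef_ipoly by auto
qed

lemma algebraic_int_power_reduction:
  fixes x :: "'a::field_char_0"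
  assumes "algebraic_int x"
  obtains n c where "n > 0"
    "\<And>i. i < n \<Longrightarrow> x * x ^ i = (\<Sum>j<n. of_int (c i j :: int) * x ^ j)"
proof -
  from assms obtain P where P: "poly (map_poly of_int P) x = 0" "lead_coeff P = 1"
    unfolding algebraic_int_altdef_ipoly by auto
  define n where "n = degree P"
  have "n > 0"
  proof (rule ccontr)
    assume "\<not> n > 0"
    then obtain a where "P = [:a:]"
      unfolding n_def by (auto elim: degree_eq_zeroE)
    with P show False by (auto simp: map_poly_pCons)
  qed
  \<comment> \<open>Companion matrix of \<open>P\<close>: multiplication by \<open>x\<close> shifts
    the powers, and the last row rewrites \<open>x ^ n\<close> by the monic relation.\<close>
  define c where "c i j = (if Suc i < n then (if j = Suc i then 1 else 0) else - coeff P j)" for i j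
  have deg: "degree (map_poly of_int P :: 'a poly) = n"
    by (simp add: n_def degree_map_poly)
  have "(\<Sum>j<n. of_int (coeff P j) * x ^ j) + x ^ n = 0"
  proof -
    have "(\<Sum>j\<le>n. of_int (coeff P j) * x ^ j) = 0"
      using P(1) by (simp add: poly_altdef deg coeff_map_poly n_def)
    moreover have "{..n} = insert n {..<n}" by auto
    ultimately show ?thesis using P(2) by (simp add: n_def add.commute)
  qed
  then have top: "x ^ n = - (\<Sum>j<n. of_int (coeff P j) * x ^ j)"
    by (simp add: eq_neg_iff_add_eq_0 add.commute)
  have "x * x ^ i = (\<Sum>j<n. of_int (c i j) * x ^ j)" if "i < n" for i
  proof (cases "Suc i < n")
    case True
    then have "(\<Sum>j<n. of_int (c i j) * x ^ j) = (\<Sum>j<n. if j = Suc i then x ^ j else 0)"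
      by (intro sum.cong) (auto simp: c_def)
    with True show ?thesis by simp
  next
    case False
    with that have "n = Suc i" by simp
    with top show ?thesis by (simp add: c_def sum_negf)
  qed
  with \<open>n > 0\<close> show thesis by (rule that)
qed

lemma mult_add_less: "i < m \<Longrightarrow> j < n \<Longrightarrow> i * n + j < m * n" for i j m n :: nat
proof -
  assume "i < m" "j < n"
  then have "i * n + j < Suc i * n" by simp
  also have "\<dots> \<le> m * n" using \<open>i < m\<close> by (intro mult_le_mono1) simp
  finally show ?thesis .
qed

text \<open>Pairs \<open>(i, j)\<close> are coded as \<open>i * n + j\<close>, because the
  eigenvalue criterion takes a singly indexed family.\<close>

lemma sum_nat_prod_index:
  fixes m n :: nat and f :: "nat \<Rightarrow> nat \<Rightarrow> 'a::comm_monoid_add"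
  shows "(\<Sum>l<m*n. f (l div n) (l mod n)) = (\<Sum>i<m. \<Sum>j<n. f i j)"
proof (cases "n = 0")
  case False
  have "(\<Sum>l<m*n. f (l div n) (l mod n)) = (\<Sum>(i,j)\<in>{..<m}\<times>{..<n}. f i j)"
    by (rule sum.reindex_bij_witness[where i = "\<lambda>(i,j). i * n + j" and j = "\<lambda>l. (l div n, l mod n)"])
      (use False in \<open>auto simp: less_mult_imp_div_less intro!: mult_add_less\<close>)
  then show ?thesis by (simp add: sum.cartesian_product)
qed auto

text \<open>Both \<open>x + y\<close> and \<open>x * y\<close> act by an integer matrix on the monomials \<open>x^i * y^j\<close>
  with \<open>i < m\<close> and \<open>j < n\<close>.\<close>

lemma algebraic_int_add_mult:
  fixes x y :: "'a::field_char_0"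
  assumes "algebraic_int x" "algebraic_int y"
  shows "algebraic_int (x + y)" "algebraic_int (x * y)"
proof -
  obtain m c where m: "m > 0"
    and c: "\<And>i. i < m \<Longrightarrow> x * x ^ i = (\<Sum>k<m. of_int (c i k) * x ^ k)"
    using algebraic_int_power_reduction[OF assms(1)] by metis
  obtain n d where n: "n > 0"
    and d: "\<And>j. j < n \<Longrightarrow> y * y ^ j = (\<Sum>k<n. of_int (d j k) * y ^ k)"
    using algebraic_int_power_reduction[OF assms(2)] by metis
  define w where "w l = x ^ (l div n) * y ^ (l mod n)" for l
  have nz: "0 < m * n" "w 0 \<noteq> 0"
    using m n by (auto simp: w_def)
  have bound: "l div n < m" "l mod n < n" if "l < m * n" for l
    using that n by (auto simp: less_mult_imp_div_less)
  \<comment> \<open>\<open>A\<close> is the Kronecker sum and \<open>B\<close> the Kronecker product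
    of the two companion matrices.\<close>
  define A where "A l k = c (l div n) (k div n) * (if k mod n = l mod n then 1 else 0)
    + (if k div n = l div n then 1 else 0) * d (l mod n) (k mod n)" for l k
  define B where "B l k = c (l div n) (k div n) * d (l mod n) (k mod n)" for l k
  have "(x + y) * w l = (\<Sum>k<m*n. of_int (A l k) * w k)" if "l < m * n" for l
  proof -
    define i j where "i = l div n" and "j = l mod n"
    have ij: "i < m" "j < n" using bound[OF that] by (auto simp: i_def j_def)
    have "(\<Sum>k<m*n. of_int (A l k) * w k) =
        (\<Sum>i'<m. \<Sum>j'<n. of_int (c i i' * (if j' = j then 1 else 0)
           + (if i' = i then 1 else 0) * d j j') * (x ^ i' * y ^ j'))"
      unfolding A_def w_def i_def[symmetric] j_def[symmetric] by (rule sum_nat_prod_index)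
    also have "\<dots> = (\<Sum>i'<m. \<Sum>j'<n. (if j' = j then of_int (c i i') * x ^ i' * y ^ j' else 0)) +
        (\<Sum>i'<m. \<Sum>j'<n. (if i' = i then of_int (d j j') * x ^ i' * y ^ j' else 0))"
      unfolding sum.distrib[symmetric] by (intro sum.cong) (auto simp: algebra_simps)
    also have "(\<Sum>i'<m. \<Sum>j'<n. (if j' = j then of_int (c i i') * x ^ i' * y ^ j' else 0))
        = x * x ^ i * y ^ j"
      unfolding c[OF ij(1)] sum_distrib_right using ij by (intro sum.cong) auto
    also have "(\<Sum>i'<m. \<Sum>j'<n. (if i' = i then of_int (d j j') * x ^ i' * y ^ j' else 0))
        = x ^ i * (y * y ^ j)"
      unfolding d[OF ij(2)] sum_distrib_left
      by (subst sum.swap) (use ij in \<open>auto intro!: sum.cong\<close>)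
    finally show ?thesis by (simp add: w_def i_def j_def algebra_simps)
  qed
  then show "algebraic_int (x + y)"
    by (rule algebraic_int_if_int_eigenvalue) (use nz in auto)
  have "(x * y) * w l = (\<Sum>k<m*n. of_int (B l k) * w k)" if "l < m * n" for l
  proof -
    define i j where "i = l div n" and "j = l mod n"
    have ij: "i < m" "j < n" using bound[OF that] by (auto simp: i_def j_def)
    have "(\<Sum>k<m*n. of_int (B l k) * w k) =
        (\<Sum>i'<m. \<Sum>j'<n. of_int (c i i' * d j j') * (x ^ i' * y ^ j'))"
      unfolding B_def w_def i_def[symmetric] j_def[symmetric] by (rule sum_nat_prod_index)
    also have "\<dots> = (x * x ^ i) * (y * y ^ j)"
      unfolding c[OF ij(1)] d[OF ij(2)] sum_product by (intro sum.cong) (auto simp: algebra_simps)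
    finally show ?thesis by (simp add: w_def i_def j_def algebra_simps)
  qed
  then show "algebraic_int (x * y)"
    by (rule algebraic_int_if_int_eigenvalue) (use nz in auto)
qed

lemmas algebraic_int_add = algebraic_int_add_mult(1)
lemmas algebraic_int_mult = algebraic_int_add_mult(2)

lemma algebraic_int_diff:
  fixes x y :: "'a::field_char_0"
  shows "algebraic_int x \<Longrightarrow> algebraic_int y \<Longrightarrow> algebraic_int (x - y)"
  using algebraic_int_add[of x "- y"] by simp

text \<open>\<open>x\<close> is a root of the monic polynomial \<open>X^2 - x^2\<close> with
  integral coefficients. Divisibility by ramified primes is later tested on squares in this
  way.\<close>

lemma algebraic_int_square_iff:
  fixes x :: "'a::field_char_0"
  shows "algebraic_int (x ^ 2) \<longleftrightarrow> algebraic_int x"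
proof
  assume "algebraic_int (x ^ 2)"
  then show "algebraic_int x"
    by (rule algebraic_int_root[where p = "[:0, 0, 1:]"])
      (auto simp: power2_eq_square coeff_pCons split: nat.splits)
qed (simp add: power2_eq_square algebraic_int_mult)

text \<open>By Bezout. Applied to \<open>x / l\<close> with multipliers \<open>l\<close> and some
  number prime to \<open>l\<close>, it plays the part of localising at \<open>l\<close>.\<close>

lemma algebraic_int_coprime_multiples:
  fixes x :: "'a::field_char_0" and m n :: int
  assumes "Rings.coprime m n" "algebraic_int (of_int m * x)" "algebraic_int (of_int n * x)"
  shows "algebraic_int x"
proof -
  obtain a b where ab: "a * m + b * n = 1"
    using bezout_int[of m n] assms(1) by (auto simp: coprime_iff_gcd_eq_1)
  have "of_int a * (of_int m * x) + of_int b * (of_int n * x) = of_int (a * m + b * n) * x"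
    by (simp add: algebra_simps)
  then have "x = of_int a * (of_int m * x) + of_int b * (of_int n * x)"
    unfolding ab by simp
  with assms(2,3) show ?thesis
    by (metis algebraic_int_add algebraic_int_mult algebraic_int_of_int)
qed

subsection \<open>Fractional ideals and ideal classes\<close>

abbreviation iprod :: "complex set \<Rightarrow> complex set \<Rightarrow> complex set" where
  "iprod \<equiv> ideal_prod complex_field"

abbreviation scaled :: "complex \<Rightarrow> complex set \<Rightarrow> complex set" where
  "scaled x I \<equiv> (\<lambda>a. x * a) ` I"

lemma iprod_mult: "i \<in> I \<Longrightarrow> j \<in> J \<Longrightarrow> i * j \<in> iprod I J"
  using ideal_prod.prod[of i I j J complex_field] by (simp add: ring_of_type_algebra_def)

lemma iprod_add: "x \<in> iprod I J \<Longrightarrow> y \<in> iprod I J \<Longrightarrow> x + y \<in> iprod I J"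
  using ideal_prod.sum[of x complex_field I J y] by (simp add: ring_of_type_algebra_def)

lemma iprod_induct [consumes 1, case_names mult add]:
  assumes "x \<in> iprod I J"
    and "\<And>i j. i \<in> I \<Longrightarrow> j \<in> J \<Longrightarrow> P (i * j)"
    and "\<And>x y. x \<in> iprod I J \<Longrightarrow> y \<in> iprod I J \<Longrightarrow> P x \<Longrightarrow> P y \<Longrightarrow> P (x + y)"
  shows "P x"
  using assms(1) by (induction rule: ideal_prod.induct)
    (use assms(2,3) in \<open>simp_all add: ring_of_type_algebra_def\<close>)

lemma iprod_subsetI:
  assumes "\<And>i j. i \<in> I \<Longrightarrow> j \<in> J \<Longrightarrow> i * j \<in> S"
    and "\<And>x y. x \<in> S \<Longrightarrow> y \<in> S \<Longrightarrow> x + y \<in> S"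
  shows "iprod I J \<subseteq> S"
proof
  fix x assume "x \<in> iprod I J"
  then show "x \<in> S" by (induction rule: iprod_induct) (use assms in auto)
qed

lemma iprod_commute: "iprod I J = iprod J I"
proof -
  have "iprod I J \<subseteq> iprod J I" for I J
  proof (rule iprod_subsetI)
    fix i j assume "i \<in> I" "j \<in> J"
    then show "i * j \<in> iprod J I" using iprod_mult[of j J i I] by (simp add: mult.commute)
  qed (rule iprod_add)
  then show ?thesis by blast
qed

lemma iprod_assoc: "iprod (iprod I J) L = iprod I (iprod J L)"
proof -
  have *: "iprod (iprod I J) L \<subseteq> iprod I (iprod J L)" for I J L
  proof (rule iprod_subsetI)
    fix x l assume "x \<in> iprod I J" "l \<in> L"
    then show "x * l \<in> iprod I (iprod J L)"
      by (induction rule: iprod_induct)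
        (auto simp: mult.assoc distrib_right intro: iprod_mult iprod_add)
  qed (rule iprod_add)
  \<comment> \<open>The reverse inclusion is the same one for \<open>L\<close>, \<open>J\<close>,
    \<open>I\<close>, read through commutativity.\<close>
  show ?thesis
    using *[of I J L] *[of L J I] by (simp add: iprod_commute subset_antisym)
qed

lemma scaled_iprod: "iprod (scaled x I) J = scaled x (iprod I J)"
proof
  show "iprod (scaled x I) J \<subseteq> scaled x (iprod I J)"
  proof (rule iprod_subsetI)
    fix i j assume "i \<in> scaled x I" "j \<in> J"
    then show "i * j \<in> scaled x (iprod I J)"
      by (auto simp: mult.assoc intro!: imageI iprod_mult)
  next
    fix a b assume "a \<in> scaled x (iprod I J)" "b \<in> scaled x (iprod I J)"
    then show "a + b \<in> scaled x (iprod I J)"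
      by (auto simp: distrib_left[symmetric] intro!: imageI iprod_add)
  qed
  have "x * a \<in> iprod (scaled x I) J" if "a \<in> iprod I J" for a
    using that
  proof (induction rule: iprod_induct)
    case (mult i j)
    then show ?case using iprod_mult[of "x * i" "scaled x I" j J] by (auto simp: mult.assoc)
  qed (auto simp: distrib_left intro: iprod_add)
  then show "scaled x (iprod I J) \<subseteq> iprod (scaled x I) J" by auto
qed

lemma iprod_scaled: "iprod I (scaled x J) = scaled x (iprod I J)"
  using scaled_iprod[of x J I] by (simp only: iprod_commute[of I])

lemma scaled_scaled: "scaled x (scaled y I) = scaled (x * y) I"
  by (auto simp: image_image mult.assoc)

lemma scaled_inverse: "x \<noteq> 0 \<Longrightarrow> scaled (inverse x) (scaled x I) = I"
  by (simp add: scaled_scaled)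

text \<open>The last assumption says that every element of \<open>K\<close> is algebraic.\<close>

locale algebraic_subfield =
  fixes K :: "complex set"
  assumes K_1 [simp]: "1 \<in> K"
    and K_add: "x \<in> K \<Longrightarrow> y \<in> K \<Longrightarrow> x + y \<in> K"
    and K_uminus: "x \<in> K \<Longrightarrow> - x \<in> K"
    and K_mult: "x \<in> K \<Longrightarrow> y \<in> K \<Longrightarrow> x * y \<in> K"
    and K_inverse: "x \<in> K \<Longrightarrow> inverse x \<in> K"
    and K_denominator: "x \<in> K \<Longrightarrow> \<exists>n>0. algebraic_int (of_nat n * x)"
begin

abbreviation \<O> :: "complex set" where "\<O> \<equiv> ring_of_integers K"

lemma K_0 [simp]: "0 \<in> K"
  using K_add[of 1 "- 1"] K_uminus[of 1] by simp

lemma K_diff: "x \<in> K \<Longrightarrow> y \<in> K \<Longrightarrow> x - y \<in> K"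
  using K_add[of x "- y"] K_uminus[of y] by simp

lemma K_divide: "x \<in> K \<Longrightarrow> y \<in> K \<Longrightarrow> x / y \<in> K"
  using K_mult[of x "inverse y"] K_inverse[of y] by (simp add: field_simps)

lemma K_of_nat [simp]: "of_nat n \<in> K"
  by (induction n) (auto intro: K_add)

lemma K_of_int [simp]: "of_int n \<in> K"
  by (cases n) (auto intro: K_uminus simp del: of_nat_Suc)

lemma K_numeral [simp]: "numeral n \<in> K"
  using K_of_nat[of "numeral n"] by simp

lemma K_power: "x \<in> K \<Longrightarrow> x ^ n \<in> K"
  by (induction n) (auto intro: K_mult)

lemma K_sum: "(\<And>i. i \<in> A \<Longrightarrow> f i \<in> K) \<Longrightarrow> sum f A \<in> K"
  by (induction A rule: infinite_finite_induct) (auto intro: K_add)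

lemma K_poly: "(\<And>i. coeff f i \<in> K) \<Longrightarrow> x \<in> K \<Longrightarrow> poly f x \<in> K"
  by (auto simp: poly_altdef intro!: K_sum K_mult K_power)

lemma O_iff: "x \<in> \<O> \<longleftrightarrow> x \<in> K \<and> algebraic_int x"
  by (simp add: ring_of_integers_def)

lemma O_in_K: "x \<in> \<O> \<Longrightarrow> x \<in> K"
  by (simp add: O_iff)

lemma O_add: "x \<in> \<O> \<Longrightarrow> y \<in> \<O> \<Longrightarrow> x + y \<in> \<O>"
  by (simp add: O_iff K_add algebraic_int_add)

lemma O_mult: "x \<in> \<O> \<Longrightarrow> y \<in> \<O> \<Longrightarrow> x * y \<in> \<O>"
  by (simp add: O_iff K_mult algebraic_int_mult)

lemma O_uminus: "x \<in> \<O> \<Longrightarrow> - x \<in> \<O>"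
  by (simp add: O_iff K_uminus)

lemma O_diff: "x \<in> \<O> \<Longrightarrow> y \<in> \<O> \<Longrightarrow> x - y \<in> \<O>"
  by (simp add: O_iff K_diff algebraic_int_diff)

lemma O_of_int [simp]: "of_int n \<in> \<O>" and O_of_nat [simp]: "of_nat m \<in> \<O>"
  and O_0 [simp]: "0 \<in> \<O>" and O_1 [simp]: "1 \<in> \<O>" and O_numeral [simp]: "numeral k \<in> \<O>"
  by (simp_all add: O_iff)

lemma O_power: "x \<in> \<O> \<Longrightarrow> x ^ n \<in> \<O>"
  by (induction n) (auto intro: O_mult)

lemma O_prod: "(\<And>i. i \<in> A \<Longrightarrow> f i \<in> \<O>) \<Longrightarrow> prod f A \<in> \<O>"
  by (induction A rule: infinite_finite_induct) (auto intro: O_mult)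

lemma O_sum: "(\<And>i. i \<in> A \<Longrightarrow> f i \<in> \<O>) \<Longrightarrow> sum f A \<in> \<O>"
  by (induction A rule: infinite_finite_induct) (auto intro: O_add)

lemma O_square_iff: "x \<in> K \<Longrightarrow> x ^ 2 \<in> \<O> \<longleftrightarrow> x \<in> \<O>"
  by (auto simp: O_iff algebraic_int_square_iff K_power)

lemma O_coprime_multiples:
  assumes "of_int m * x \<in> \<O>" "of_int n * x \<in> \<O>" "Rings.coprime m n" "x \<in> K"
  shows "x \<in> \<O>"
  using assms algebraic_int_coprime_multiples[of m n x] by (auto simp: O_iff)

section \<open>Fractional ideals of a subfield\<close>

abbreviation ideal_of_K :: "complex set \<Rightarrow> bool" where "ideal_of_K \<equiv> fractional_ideal K"

lemma fractional_idealD: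
  assumes "ideal_of_K I"
  shows "x \<in> I \<Longrightarrow> x \<in> K" "0 \<in> I" "\<exists>x\<in>I. x \<noteq> 0"
    "x \<in> I \<Longrightarrow> y \<in> I \<Longrightarrow> x + y \<in> I"
    "a \<in> \<O> \<Longrightarrow> x \<in> I \<Longrightarrow> a * x \<in> I"
    "x \<in> I \<Longrightarrow> - x \<in> I"
    "x \<in> I \<Longrightarrow> y \<in> I \<Longrightarrow> x - y \<in> I"
    "\<exists>n>0. \<forall>x\<in>I. of_nat n * x \<in> \<O>"
proof -
  show 1: "x \<in> I \<Longrightarrow> x \<in> K" "0 \<in> I" "\<exists>x\<in>I. x \<noteq> 0"
    and a: "x \<in> I \<Longrightarrow> y \<in> I \<Longrightarrow> x + y \<in> I"
    and m: "a \<in> \<O> \<Longrightarrow> x \<in> I \<Longrightarrow> a * x \<in> I" for x y a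
    using assms unfolding fractional_ideal_def by auto
  show u: "x \<in> I \<Longrightarrow> - x \<in> I" for x
    using m[of "- 1" x] O_uminus[OF O_1] by simp
  show "x \<in> I \<Longrightarrow> y \<in> I \<Longrightarrow> x - y \<in> I"
    using a[of x "- y"] u[of y] by simp
  obtain d where d: "d \<in> \<O>" "d \<noteq> 0" "\<And>x. x \<in> I \<Longrightarrow> d * x \<in> \<O>"
    using assms unfolding fractional_ideal_def by blast
  \<comment> \<open>The denominator \<open>d\<close> is replaced by a natural number:
    \<open>n * x\<close> is \<open>n / d\<close> times \<open>d * x\<close>.\<close>
  obtain n where n: "n > 0" "algebraic_int (of_nat n * inverse d)"
    using K_denominator[of "inverse d"] d(1) by (auto simp: O_iff K_inverse)
  have "of_nat n * x \<in> \<O>" if "x \<in> I" for x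
  proof -
    have "of_nat n * inverse d \<in> \<O>"
      using n d(1) by (auto simp: O_iff intro!: K_mult K_inverse)
    from O_mult[OF this d(3)[OF that]] d(2) show ?thesis by (simp add: field_simps)
  qed
  with n(1) show "\<exists>n>0. \<forall>x\<in>I. of_nat n * x \<in> \<O>" by blast
qed

lemma fractional_idealI:
  assumes "I \<subseteq> K" "0 \<in> I" "\<exists>x\<in>I. x \<noteq> 0"
    "\<And>x y. x \<in> I \<Longrightarrow> y \<in> I \<Longrightarrow> x + y \<in> I" "\<And>a x. a \<in> \<O> \<Longrightarrow> x \<in> I \<Longrightarrow> a * x \<in> I"
    "n > 0" "\<And>x. x \<in> I \<Longrightarrow> of_nat n * x \<in> \<O>"
  shows "ideal_of_K I"
  unfolding fractional_ideal_def using assms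
  by (auto intro!: bexI[of _ "of_nat n"])

lemma fractional_ideal_O: "ideal_of_K \<O>"
  by (rule fractional_idealI[where n = 1]) (auto simp: O_in_K O_add O_mult intro: bexI[of _ 1])

lemma fractional_ideal_scaled:
  assumes "ideal_of_K I" "x \<in> K" "x \<noteq> 0"
  shows "ideal_of_K (scaled x I)"
proof -
  note I = fractional_idealD[OF assms(1)]
  obtain n where n: "n > 0" "\<And>y. y \<in> I \<Longrightarrow> of_nat n * y \<in> \<O>" using I(8) by auto
  obtain m where m: "m > 0" "algebraic_int (of_nat m * x)" using K_denominator assms by auto
  show ?thesis
  proof (rule fractional_idealI[where n = "m * n"])
    show "\<exists>y\<in>scaled x I. y \<noteq> 0" using I(3) assms(3) by auto
    show "0 \<in> scaled x I" using I(2) by force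
    show "a + b \<in> scaled x I" if "a \<in> scaled x I" "b \<in> scaled x I" for a b
      using that I(4) by (auto simp: distrib_left[symmetric] intro!: imageI)
    show "a * b \<in> scaled x I" if "a \<in> \<O>" "b \<in> scaled x I" for a b
      using that I(5) by (auto simp: mult.left_commute[of _ x] intro!: imageI)
    show "of_nat (m * n) * b \<in> \<O>" if "b \<in> scaled x I" for b
    proof -
      from that obtain y where y: "b = x * y" "y \<in> I" by auto
      have "of_nat m * x \<in> \<O>" using m assms by (simp add: O_iff K_mult)
      from O_mult[OF this n(2)[OF y(2)]] show ?thesis by (simp add: y mult_ac)
    qed
  qed (use I(1) assms K_mult n m in auto)
qed

lemma fractional_ideal_iprod:
  assumes "ideal_of_K I" "ideal_of_K J"
  shows "ideal_of_K (iprod I J)"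
proof -
  note I = fractional_idealD[OF assms(1)] and J = fractional_idealD[OF assms(2)]
  obtain n where n: "n > 0" "\<And>y. y \<in> I \<Longrightarrow> of_nat n * y \<in> \<O>" using I(8) by auto
  obtain m where m: "m > 0" "\<And>y. y \<in> J \<Longrightarrow> of_nat m * y \<in> \<O>" using J(8) by auto
  show ?thesis
  proof (rule fractional_idealI[where n = "n * m"])
    show "iprod I J \<subseteq> K" by (rule iprod_subsetI) (use I(1) J(1) in \<open>auto intro: K_mult K_add\<close>)
    show "0 \<in> iprod I J" using iprod_mult[OF I(2) J(2)] by simp
    show "\<exists>x\<in>iprod I J. x \<noteq> 0" using I(3) J(3) iprod_mult by (metis mult_eq_0_iff)
    show "a * x \<in> iprod I J" if "a \<in> \<O>" "x \<in> iprod I J" for a x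
      using that(2)
    proof (induction rule: iprod_induct)
      case (mult i j)
      then show ?case using iprod_mult[OF I(5)[OF that(1)], of i j J] by (simp add: mult.assoc)
    qed (auto simp: distrib_left intro: iprod_add)
    show "of_nat (n * m) * x \<in> \<O>" if "x \<in> iprod I J" for x
      using that
    proof (induction rule: iprod_induct)
      case (mult i j)
      then show ?case using O_mult[OF n(2) m(2), of i j] by (simp add: mult_ac)
    qed (auto simp: distrib_left intro: O_add)
  qed (use n m in \<open>auto intro: iprod_add\<close>)
qed

lemma iprod_O:
  assumes "ideal_of_K I"
  shows "iprod \<O> I = I"
proof
  show "iprod \<O> I \<subseteq> I"
    by (rule iprod_subsetI) (use fractional_idealD(4,5)[OF assms] in auto)
  show "I \<subseteq> iprod \<O> I"
    using iprod_mult[OF O_1, of _ I] by auto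
qed

text \<open>Multiplying by the principal ideal of \<open>x\<close> is scaling by \<open>x\<close>;
  this turns cosets into families of scaled ideals and equality of classes into an explicit
  factor.\<close>

lemma ideal_class_eq:
  assumes "ideal_of_K I"
  shows "ideal_class K I = {scaled x I | x. x \<in> K \<and> x \<noteq> 0}"
proof -
  have "ideal_class K I = {iprod (scaled x \<O>) I | x. x \<in> K \<and> x \<noteq> 0}"
    unfolding ideal_class_def r_coset_def principal_ideals_def fractional_ideal_group_def by auto
  then show ?thesis by (simp add: scaled_iprod iprod_O assms)
qed

lemma ideal_class_eq_iff:
  assumes "ideal_of_K I" "ideal_of_K J"
  shows "ideal_class K I = ideal_class K J \<longleftrightarrow> (\<exists>x. x \<in> K \<and> x \<noteq> 0 \<and> I = scaled x J)"
proof
  assume "ideal_class K I = ideal_class K J"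
  moreover have "I \<in> ideal_class K I"
    unfolding ideal_class_eq[OF assms(1)] by (auto intro!: exI[of _ 1])
  ultimately show "\<exists>x. x \<in> K \<and> x \<noteq> 0 \<and> I = scaled x J"
    unfolding ideal_class_eq[OF assms(2)] by auto
next
  assume "\<exists>x. x \<in> K \<and> x \<noteq> 0 \<and> I = scaled x J"
  then obtain x where x: "x \<in> K" "x \<noteq> 0" "I = scaled x J" by auto
  have *: "scaled y J = scaled (y / x) I" "scaled y I = scaled (y * x) J" for y
    unfolding x(3) scaled_scaled using x(2) by simp_all
  then show "ideal_class K I = ideal_class K J"
    unfolding ideal_class_eq[OF assms(1)] ideal_class_eq[OF assms(2)]
  proof (intro equalityI subsetI)
    fix S assume "S \<in> {scaled y I | y. y \<in> K \<and> y \<noteq> 0}"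
    then obtain y where y: "S = scaled y I" "y \<in> K" "y \<noteq> 0" by blast
    show "S \<in> {scaled y J | y. y \<in> K \<and> y \<noteq> 0}"
      unfolding y(1) *(2) using y(2,3) x(1,2) by (intro CollectI exI[of _ "y * x"]) (simp add: K_mult)
  next
    fix S assume "S \<in> {scaled y J | y. y \<in> K \<and> y \<noteq> 0}"
    then obtain y where y: "S = scaled y J" "y \<in> K" "y \<noteq> 0" by blast
    show "S \<in> {scaled y I | y. y \<in> K \<and> y \<noteq> 0}"
      unfolding y(1) *(1) using y(2,3) x(1,2) by (intro CollectI exI[of _ "y / x"]) (simp add: K_divide)
  qed
qed

section \<open>The class group and the subgroup of order 2\<close>

lemma principal_ideals_eq_class: "principal_ideals K = ideal_class K \<O>"
  unfolding ideal_class_eq[OF fractional_ideal_O] principal_ideals_def ..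

lemma class_group_simps:
  "carrier (class_group K) = ideal_class K ` {I. ideal_of_K I}"
  "\<one>\<^bsub>class_group K\<^esub> = ideal_class K \<O>"
proof -
  show "carrier (class_group K) = ideal_class K ` {I. ideal_of_K I}"
    unfolding class_group_def FactGroup_def RCOSETS_def ideal_class_def
    by (auto simp: fractional_ideal_group_def)
  show "\<one>\<^bsub>class_group K\<^esub> = ideal_class K \<O>"
    by (simp add: class_group_def FactGroup_def principal_ideals_eq_class)
qed

lemma class_group_mult:
  assumes "ideal_of_K I" "ideal_of_K J"
  shows "ideal_class K I \<otimes>\<^bsub>class_group K\<^esub> ideal_class K J = ideal_class K (iprod I J)"
proof -
  have "ideal_class K I \<otimes>\<^bsub>class_group K\<^esub> ideal_class K J =
      {iprod (scaled x I) (scaled y J) | x y. x \<in> K \<and> x \<noteq> 0 \<and> y \<in> K \<and> y \<noteq> 0}"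
    unfolding class_group_def FactGroup_def set_mult_def
      ideal_class_eq[OF assms(1)] ideal_class_eq[OF assms(2)]
    by (auto simp: fractional_ideal_group_def)
  also have "\<dots> = {scaled (x * y) (iprod I J) | x y. x \<in> K \<and> x \<noteq> 0 \<and> y \<in> K \<and> y \<noteq> 0}"
    by (simp only: scaled_iprod iprod_scaled scaled_scaled mult.commute)
  also have "\<dots> = {scaled x (iprod I J) | x. x \<in> K \<and> x \<noteq> 0}"
  proof -
    have "\<exists>y z. scaled x (iprod I J) = scaled (y * z) (iprod I J) \<and> y \<in> K \<and> y \<noteq> 0 \<and> z \<in> K \<and> z \<noteq> 0"
      if "x \<in> K" "x \<noteq> 0" for x
      using that by (intro exI[of _ x] exI[of _ 1]) auto
    moreover have "\<exists>x. scaled (y * z) (iprod I J) = scaled x (iprod I J) \<and> x \<in> K \<and> x \<noteq> 0"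
      if "y \<in> K" "y \<noteq> 0" "z \<in> K" "z \<noteq> 0" for y z
      using that by (intro exI[of _ "y * z"]) (auto intro: K_mult)
    ultimately show ?thesis by blast
  qed
  finally show ?thesis
    by (simp add: ideal_class_eq fractional_ideal_iprod assms)
qed

text \<open>The laws of a commutative monoid are the base for the Polya group, where inverses are
  obtained from \<open>C \<otimes> C = \<one>\<close>.\<close>

lemma comm_monoid_class_group: "comm_monoid (class_group K)"
proof (rule comm_monoidI)
  fix x y z
  assume "x \<in> carrier (class_group K)" "y \<in> carrier (class_group K)" "z \<in> carrier (class_group K)"
  then obtain I J L where I: "x = ideal_class K I" "y = ideal_class K J" "z = ideal_class K L"
    "ideal_of_K I" "ideal_of_K J" "ideal_of_K L"
    by (auto simp: class_group_simps)
  show "x \<otimes>\<^bsub>class_group K\<^esub> y \<otimes>\<^bsub>class_group K\<^esub> z = x \<otimes>\<^bsub>class_group K\<^esub> (y \<otimes>\<^bsub>class_group K\<^esub> z)"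
    using I by (simp add: class_group_mult fractional_ideal_iprod iprod_assoc)
  show "x \<otimes>\<^bsub>class_group K\<^esub> y = y \<otimes>\<^bsub>class_group K\<^esub> x"
    using I by (simp add: class_group_mult iprod_commute)
qed (auto simp: class_group_simps class_group_mult fractional_ideal_iprod fractional_ideal_O iprod_O)

text \<open>All generators are 1 or the class \<open>C\<close> of \<open>\<PP>\<close>, and
  \<open>C\<close> has square 1. One nonprincipal characteristic ideal shows both that
  \<open>C\<close> is nontrivial and that it is among the generators.\<close>

lemma polya_group_iso_Z2:
  assumes \<PP>: "ideal_of_K \<PP>" "c \<in> K" "c \<noteq> 0" "iprod \<PP> \<PP> = scaled c \<O>"
    and frac: "\<And>n. ideal_of_K (char_ideal K n)"
    and classes: "\<And>n. \<exists>x. x \<in> K \<and> x \<noteq> 0 \<and>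
      (char_ideal K n = scaled x \<O> \<or> char_ideal K n = scaled x \<PP>)"
    and nonprincipal: "n \<ge> 1" "\<And>x. x \<in> K \<Longrightarrow> x \<noteq> 0 \<Longrightarrow> char_ideal K n \<noteq> scaled x \<O>"
  shows "polya_group K \<cong> integer_mod_group 2"
proof -
  interpret G: comm_monoid "class_group K" by (rule comm_monoid_class_group)
  define C where "C = ideal_class K \<PP>"
  let ?one = "\<one>\<^bsub>class_group K\<^esub>"
  let ?S = "{ideal_class K (char_ideal K n) | n. n \<ge> 1}"
  note O = fractional_ideal_O
  have C: "C \<in> carrier (class_group K)" using \<PP>(1) by (auto simp: C_def class_group_simps)
  have "ideal_class K (iprod \<PP> \<PP>) = ideal_class K \<O>"
    using ideal_class_eq_iff[OF fractional_ideal_iprod[OF \<PP>(1,1)] O] \<PP>(2-4) by auto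
  then have CC: "C \<otimes>\<^bsub>class_group K\<^esub> C = ?one"
    by (simp add: C_def class_group_simps class_group_mult \<PP>(1))
  have cls: "ideal_class K (char_ideal K k) \<in> {?one, C}" for k
    using classes[of k] ideal_class_eq_iff[OF frac O] ideal_class_eq_iff[OF frac \<PP>(1)]
    by (auto simp: C_def class_group_simps)
  have n1: "ideal_class K (char_ideal K n) \<noteq> ?one"
    using nonprincipal(2) ideal_class_eq_iff[OF frac O] by (auto simp: class_group_simps)
  with cls[of n] have nC: "ideal_class K (char_ideal K n) = C" and ne: "C \<noteq> ?one" by auto
  \<comment> \<open>An element of square 1 is its own inverse, so closing under inverses adds
    nothing to \<open>{\<one>, C}\<close>.\<close>
  have C_inv: "inv\<^bsub>class_group K\<^esub> C = C" "inv\<^bsub>class_group K\<^esub> ?one = ?one"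
    using G.inv_char[OF C C CC CC] G.inv_one by auto
  have "generate (class_group K) ?S = {?one, C}"
  proof
    show "generate (class_group K) ?S \<subseteq> {?one, C}"
    proof
      fix x assume "x \<in> generate (class_group K) ?S"
      then show "x \<in> {?one, C}"
      proof (induction rule: generate.induct)
        case (inv h)
        then have "h \<in> {?one, C}" using cls by auto
        then show ?case using C_inv by (elim insertE emptyE) simp_all
      next
        case (eng x y)
        then show ?case using CC C by (elim insertE emptyE) simp_all
      qed (use cls in auto)
    qed
    show "{?one, C} \<subseteq> generate (class_group K) ?S"
      using nC nonprincipal(1) by (auto intro!: generate.one generate.incl)
  qed
  then have carr: "carrier (polya_group K) = {?one, C}"
    and mult: "monoid.mult (polya_group K) = monoid.mult (class_group K)"
    by (simp_all add: polya_group_def)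
  define h :: "complex set set \<Rightarrow> int" where "h x = (if x = C then 1 else 0)" for x
  have h: "h ?one = 0" "h C = 1" using ne by (auto simp: h_def)
  have "h \<in> iso (polya_group K) (integer_mod_group 2)"
    unfolding iso_def hom_def bij_betw_def carr mult using h CC C
    by (simp add: carrier_integer_mod_group Pi_def) force
  then show ?thesis by (auto simp: is_iso_def)
qed

end

subsection \<open>Characteristic ideals\<close>

text \<open>Forward difference. Like the derivative it lowers the degree and multiplies the leading
  coefficient by the degree, but it also preserves integer-valuedness.\<close>

definition poly_diff :: "'a::comm_ring_1 poly \<Rightarrow> 'a poly" where
  "poly_diff f = pcompose f [:1, 1:] - f"

lemma poly_diff_poly: "poly (poly_diff f) x = poly f (x + 1) - poly f x"
  by (simp add: poly_diff_def poly_pcompose add.commute)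

lemma poly_diff_pCons: "poly_diff (pCons a f) = f + poly_diff f + pCons 0 (poly_diff f)"
  by (simp add: poly_diff_def pcompose_pCons algebra_simps)

text \<open>Stated coefficientwise and for any bound \<open>n\<close> on the degree, so that the
  induction along \<open>pCons\<close> avoids computing degrees of sums.\<close>

lemma coeff_poly_diff:
  "degree f \<le> n \<Longrightarrow> (\<forall>m\<ge>n. coeff (poly_diff f) m = 0) \<and>
    (\<forall>k. n = Suc k \<longrightarrow> coeff (poly_diff f) k = of_nat n * coeff f n)"
proof (induction f arbitrary: n)
  case 0
  then show ?case by (simp add: poly_diff_def)
next
  case (pCons a f)
  show ?case
  proof (cases "f = 0")
    \<comment> \<open>A constant is separated because the bound \<open>n\<close> may then be 0,
      while the other case uses a predecessor of \<open>n\<close>.\<close>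
    case True
    then have "poly_diff (pCons a f) = 0" by (simp add: poly_diff_def pcompose_pCons)
    with True show ?thesis by simp
  next
    case False
    with pCons.prems obtain k where k: "n = Suc k" "degree f \<le> k"
      by (cases n) auto
    note IH = pCons.IH[OF k(2)]
    have "coeff (poly_diff (pCons a f)) m = 0" if "m \<ge> n" for m
      using that k IH by (cases m) (auto simp: poly_diff_pCons coeff_eq_0)
    moreover have "coeff (poly_diff (pCons a f)) k = of_nat n * coeff (pCons a f) n"
      using k IH by (cases k) (auto simp: poly_diff_pCons algebra_simps)
    ultimately show ?thesis using k by auto
  qed
qed

lemma coeff_pcompose_in:
  fixes S :: "'a::comm_ring_1 set"
  assumes "\<And>i. coeff p i \<in> S" "\<And>i. coeff q i \<in> S"
    "0 \<in> S" "1 \<in> S" "\<And>x y. x \<in> S \<Longrightarrow> y \<in> S \<Longrightarrow> x + y \<in> S" "\<And>x y. x \<in> S \<Longrightarrow> y \<in> S \<Longrightarrow> x * y \<in> S"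
  shows "coeff (pcompose p q) i \<in> S"
  by (rule coeff_pcompose_semiring_closed) (use assms in auto)

context algebraic_subfield
begin

lemma int_valued_polysI:
  "(\<And>i. coeff f i \<in> K) \<Longrightarrow> (\<And>x. x \<in> \<O> \<Longrightarrow> poly f x \<in> \<O>) \<Longrightarrow> f \<in> int_valued_polys K"
  by (simp add: int_valued_polys_def)

lemma int_valued_polysD:
  "f \<in> int_valued_polys K \<Longrightarrow> coeff f i \<in> K" "f \<in> int_valued_polys K \<Longrightarrow> x \<in> \<O> \<Longrightarrow> poly f x \<in> \<O>"
  by (simp_all add: int_valued_polys_def)

text \<open>Taking the coefficient at \<open>n\<close> under the weaker condition
  \<open>degree f \<le> n\<close> absorbs the adjoined 0 and stays valid when leading terms cancel
  in a sum.\<close>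

lemma char_ideal_iff:
  "c \<in> char_ideal K n \<longleftrightarrow> (\<exists>f \<in> int_valued_polys K. degree f \<le> n \<and> coeff f n = c)"
proof
  have "0 \<in> int_valued_polys K" by (simp add: int_valued_polys_def)
  then show "\<exists>f \<in> int_valued_polys K. degree f \<le> n \<and> coeff f n = c" if "c \<in> char_ideal K n"
  proof (cases "c = 0")
    case True
    with \<open>0 \<in> int_valued_polys K\<close> show ?thesis by (intro bexI[of _ 0]) auto
  next
    case False
    with that show ?thesis by (auto simp: char_ideal_def)
  qed
next
  assume "\<exists>f \<in> int_valued_polys K. degree f \<le> n \<and> coeff f n = c"
  then obtain f where f: "f \<in> int_valued_polys K" "degree f \<le> n" "coeff f n = c" by blast
  then have "degree f = n" if "c \<noteq> 0"
    using that le_degree[of f n] by simp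
  with f show "c \<in> char_ideal K n" by (auto simp: char_ideal_def)
qed

lemma char_ideal_add:
  assumes "a \<in> char_ideal K n" "b \<in> char_ideal K n"
  shows "a + b \<in> char_ideal K n"
proof -
  obtain f g where "f \<in> int_valued_polys K" "degree f \<le> n" "coeff f n = a"
    "g \<in> int_valued_polys K" "degree g \<le> n" "coeff g n = b"
    using assms unfolding char_ideal_iff by blast
  note fg = this
  have "f + g \<in> int_valued_polys K"
    by (rule int_valued_polysI)
      (simp_all add: K_add O_add int_valued_polysD[OF fg(1)] int_valued_polysD[OF fg(4)])
  then show ?thesis unfolding char_ideal_iff using fg
    by (intro bexI[of _ "f + g"] conjI) (simp_all add: degree_add_le)
qed

lemma char_ideal_mult:
  assumes "a \<in> \<O>" "b \<in> char_ideal K n"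
  shows "a * b \<in> char_ideal K n"
proof -
  obtain f where "f \<in> int_valued_polys K" "degree f \<le> n" "coeff f n = b"
    using assms unfolding char_ideal_iff by blast
  note f = this
  have "smult a f \<in> int_valued_polys K"
    by (rule int_valued_polysI)
      (simp_all add: K_mult O_mult O_in_K assms(1) int_valued_polysD[OF f(1)])
  then show ?thesis unfolding char_ideal_iff using f
    by (intro bexI[of _ "smult a f"] conjI) (simp_all add: order.trans[OF degree_smult_le])
qed

text \<open>Multiplication by \<open>X\<close> keeps a polynomial integer-valued.\<close>

lemma char_ideal_Suc:
  assumes "a \<in> char_ideal K n"
  shows "a \<in> char_ideal K (Suc n)"
proof -
  obtain f where f: "f \<in> int_valued_polys K" "degree f \<le> n" "coeff f n = a"
    using assms unfolding char_ideal_iff by blast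
  have "coeff (pCons 0 f) i \<in> K" for i
    using int_valued_polysD(1)[OF f(1)] by (cases i) auto
  then have "pCons 0 f \<in> int_valued_polys K"
    by (rule int_valued_polysI) (simp_all add: O_mult int_valued_polysD[OF f(1)])
  then show ?thesis unfolding char_ideal_iff using f
    by (intro bexI[of _ "pCons 0 f"] conjI) (simp_all add: order.trans[OF degree_pCons_le])
qed

lemma one_in_char_ideal: "1 \<in> char_ideal K n"
proof (induction n)
  case 0
  show ?case unfolding char_ideal_iff
    by (rule bexI[of _ 1]) (auto intro!: int_valued_polysI simp: coeff_1)
qed (rule char_ideal_Suc)

text \<open>Witnessed by the forward difference. With \<open>char_ideal_Suc\<close> it squeezes
  consecutive characteristic ideals to within the factor \<open>Suc n\<close>.\<close>

lemma char_ideal_diff: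
  assumes "a \<in> char_ideal K (Suc n)"
  shows "of_nat (Suc n) * a \<in> char_ideal K n"
proof -
  obtain f where f: "f \<in> int_valued_polys K" "degree f \<le> Suc n" "coeff f (Suc n) = a"
    using assms unfolding char_ideal_iff by blast
  note d = coeff_poly_diff[OF f(2)]
  have "poly_diff f \<in> int_valued_polys K"
  proof (rule int_valued_polysI)
    have "coeff (pcompose f [:1, 1:]) i \<in> K" for i
      by (rule coeff_pcompose_in)
        (simp_all add: K_add K_mult int_valued_polysD(1)[OF f(1)] coeff_pCons split: nat.split)
    then show "coeff (poly_diff f) i \<in> K" for i
      using int_valued_polysD(1)[OF f(1)] by (simp add: poly_diff_def K_diff)
    show "poly (poly_diff f) x \<in> \<O>" if "x \<in> \<O>" for x
      using that int_valued_polysD(2)[OF f(1)] by (simp add: poly_diff_poly O_diff O_add)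
  qed
  moreover have "degree (poly_diff f) \<le> n"
    using d by (intro degree_le) auto
  ultimately show ?thesis
    using d f(3) unfolding char_ideal_iff by blast
qed

text \<open>Taking differences \<open>n\<close> times ends at a constant, whose value is
  integral.\<close>

lemma char_ideal_fact:
  "a \<in> char_ideal K n \<Longrightarrow> fact n * a \<in> \<O>"
proof (induction n arbitrary: a)
  case 0
  then obtain f where f: "f \<in> int_valued_polys K" "degree f = 0" "coeff f 0 = a"
    unfolding char_ideal_iff by auto
  then have "poly f 0 = a" by (simp add: poly_0_coeff_0)
  with int_valued_polysD(2)[OF f(1) O_0] show ?case by simp
next
  case (Suc n)
  from Suc.IH[OF char_ideal_diff[OF Suc.prems]] show ?case
    by (simp add: mult_ac)
qed

lemma fractional_ideal_char_ideal: "ideal_of_K (char_ideal K n)"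
proof (rule fractional_idealI[where n = "fact n"])
  show "char_ideal K n \<subseteq> K" by (auto simp: char_ideal_iff int_valued_polysD)
  show "0 \<in> char_ideal K n" by (simp add: char_ideal_def)
  show "\<exists>x\<in>char_ideal K n. x \<noteq> 0" using one_in_char_ideal by force
qed (auto intro: char_ideal_add char_ideal_mult simp: char_ideal_fact)

text \<open>The degrees of the basis are distinct, so the highest index in a representation alone
  determines degree and leading coefficient.\<close>

lemma char_ideal_regular_basis:
  assumes f: "regular_basis K f"
  shows "char_ideal K n = scaled (lead_coeff (f n)) \<O>" "lead_coeff (f n) \<in> K" "lead_coeff (f n) \<noteq> 0"
proof -
  have fI: "f j \<in> int_valued_polys K" and deg: "degree (f j) = j"
    and ex: "\<And>g. g \<in> int_valued_polys K \<Longrightarrow>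
      \<exists>!c. (\<forall>j. c j \<in> \<O>) \<and> finite {j. c j \<noteq> 0} \<and> g = (\<Sum>j | c j \<noteq> 0. smult (c j) (f j))" for j
    using f by (auto simp: regular_basis_def module_basis_def)
  show K: "lead_coeff (f n) \<in> K" using int_valued_polysD(1)[OF fI] .
  have lead: "lead_coeff (f n) \<in> char_ideal K n"
    unfolding char_ideal_iff using fI[of n] deg[of n] by (intro bexI[of _ "f n"]) auto
  \<comment> \<open>Since \<open>degree 0 = 0\<close>, the degree condition does not exclude
    \<open>f 0 = 0\<close>; uniqueness of the coefficients representing 0 does.\<close>
  have f0: "f j \<noteq> 0" for j
  proof
    assume fj: "f j = 0"
    have z: "0 \<in> int_valued_polys K" by (simp add: int_valued_polys_def)
    define c where "c i = (if i = j then 1 else 0 :: complex)" for i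
    have supp: "{i. c i \<noteq> 0} = {j}" by (auto simp: c_def)
    let ?P = "\<lambda>c. (\<forall>j. c j \<in> \<O>) \<and> finite {j. c j \<noteq> 0} \<and> 0 = (\<Sum>j | c j \<noteq> 0. smult (c j) (f j))"
    have "?P c" unfolding supp using fj by (simp add: c_def)
    moreover have "?P (\<lambda>_. 0)" by simp
    ultimately have "c = (\<lambda>_. 0)" by (rule the1_equality[OF ex[OF z], symmetric, THEN trans, OF _ the1_equality[OF ex[OF z]]])
    then have "c j = 0" by simp
    then show False by (simp add: c_def)
  qed
  then show nz: "lead_coeff (f n) \<noteq> 0" by simp
  show "char_ideal K n = scaled (lead_coeff (f n)) \<O>"
  proof
    show "scaled (lead_coeff (f n)) \<O> \<subseteq> char_ideal K n"
      using char_ideal_mult[OF _ lead] by (auto simp: mult.commute)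
    show "char_ideal K n \<subseteq> scaled (lead_coeff (f n)) \<O>"
    proof
      fix a assume "a \<in> char_ideal K n"
      then obtain g where g: "g \<in> int_valued_polys K" "degree g \<le> n" "coeff g n = a"
        unfolding char_ideal_iff by blast
      obtain c where c: "\<And>j. c j \<in> \<O>" "finite {j. c j \<noteq> 0}"
          "g = (\<Sum>j | c j \<noteq> 0. smult (c j) (f j))"
        using ex1_implies_ex[OF ex[OF g(1)]] by auto
      let ?S = "{j. c j \<noteq> 0}"
      \<comment> \<open>The largest index \<open>m\<close> of the support leaves an uncancelled
        coefficient at \<open>m\<close>, hence is at most \<open>degree g\<close>.\<close>
      have le: "j \<le> n" if "j \<in> ?S" for j
      proof -
        define m where "m = Max ?S"
        have m: "m \<in> ?S" "\<And>i. i \<in> ?S \<Longrightarrow> i \<le> m"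
          using that c(2) Max_in[of ?S] unfolding m_def by (blast, intro Max_ge)
        have "coeff g m = (\<Sum>i\<in>?S. c i * coeff (f i) m)"
          by (simp add: c(3) coeff_sum)
        also have "\<dots> = (\<Sum>i\<in>?S. if i = m then c m * lead_coeff (f m) else 0)"
        proof (intro sum.cong refl)
          fix i assume "i \<in> ?S"
          then have "i = m \<or> i < m" using m(2) by force
          then show "c i * coeff (f i) m = (if i = m then c m * lead_coeff (f m) else 0)"
            using deg by (auto simp: coeff_eq_0)
        qed
        also have "\<dots> = c m * lead_coeff (f m)" using m(1) c(2) by simp
        also have "\<dots> \<noteq> 0" using m(1) f0 by simp
        finally have "m \<le> degree g" by (rule le_degree)
        with m(2)[OF that] g(2) show "j \<le> n" by simp
      qed
      have "a = (\<Sum>i\<in>?S. c i * coeff (f i) n)"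
        using g(3) by (simp add: c(3) coeff_sum)
      also have "\<dots> = (\<Sum>i\<in>?S. if i = n then c n * lead_coeff (f n) else 0)"
      proof (intro sum.cong refl)
        fix i assume "i \<in> ?S"
        then have "i = n \<or> i < n" using le by force
        then show "c i * coeff (f i) n = (if i = n then c n * lead_coeff (f n) else 0)"
          using deg by (auto simp: coeff_eq_0)
      qed
      also have "\<dots> = c n * lead_coeff (f n)" using c(2) by auto
      finally show "a \<in> scaled (lead_coeff (f n)) \<O>"
        using c(1)[of n] by (auto simp: mult.commute)
    qed
  qed
qed

section \<open>Frobenius and Newton interpolation at a prime\<close>

lemma frobenius_divides:
  assumes "prime l" "x \<in> \<O>" "y \<in> \<O>"
  shows "((x + y) ^ l - (x ^ l + y ^ l)) / of_nat l \<in> \<O>"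
proof -
  have l: "l > 1" using assms(1) by (rule prime_gt_1_nat)
  let ?t = "\<lambda>k. of_nat (l choose k) * x ^ k * y ^ (l - k)"
  have "{..l} = insert 0 (insert l {1..<l})" using l by auto
  then have "(x + y) ^ l = y ^ l + (x ^ l + (\<Sum>k\<in>{1..<l}. ?t k))"
    unfolding binomial_ring using l by simp
  then have "((x + y) ^ l - (x ^ l + y ^ l)) / of_nat l = (\<Sum>k\<in>{1..<l}. ?t k / of_nat l)"
    by (simp add: sum_divide_distrib)
  also have "\<dots> \<in> \<O>"
  proof (rule O_sum)
    fix k assume "k \<in> {1..<l}"
    then have "l dvd (l choose k)" using assms(1) by (intro dvd_choose_prime) auto
    then obtain c where c: "l choose k = l * c" by blast
    have "?t k / of_nat l = of_nat c * x ^ k * y ^ (l - k)" using l by (simp add: c)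
    also have "\<dots> \<in> \<O>" using assms by (intro O_mult O_power) auto
    finally show "?t k / of_nat l \<in> \<O>" .
  qed
  finally show ?thesis .
qed

text \<open>The Newton basis polynomial: it vanishes at \<open>0, \<dots>, k - 1\<close> and takes
  the value \<open>k!\<close> at \<open>k\<close>.\<close>

lemma falling_product_poly:
  obtains w where "\<And>i. coeff w i \<in> K" "degree w = k" "coeff w k = 1"
    "\<And>x. poly w x = (\<Prod>i<k. x - of_nat i)"
proof -
  define w where "w = (\<Prod>i<k. [:- of_nat i, 1:] :: complex poly)"
  have "coeff (\<Prod>i\<in>A. [:- of_nat i, 1:] :: complex poly) j \<in> K" if "finite A" for A j
    using that
  proof (induction A arbitrary: j)
    case (insert x F)
    then show ?case
      by (auto simp: coeff_pCons split: nat.split intro!: K_diff K_mult K_uminus K_add)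
  qed (auto simp: coeff_1)
  then have "coeff w j \<in> K" for j by (simp add: w_def)
  moreover have deg: "degree w = k" unfolding w_def by (subst degree_prod_sum_eq) auto
  moreover have "lead_coeff w = 1" unfolding w_def lead_coeff_prod by simp
  moreover have "poly w x = (\<Prod>i<k. x - of_nat i)" for x
    by (simp add: w_def poly_prod)
  ultimately show thesis using that[of w] by simp
qed

text \<open>Newton interpolation at \<open>0, \<dots>, k\<close>; the denominators are products of numbers up to \<open>k\<close>.\<close>

lemma int_valued_at_initial_naturals:
  assumes "prime l" "k < l" "\<And>i. coeff g i \<in> K" "degree g \<le> k"
    and "\<And>j. j \<le> k \<Longrightarrow> poly g (of_nat j) \<in> \<O>"
  shows "\<exists>m::nat. Rings.coprime m l \<and> (\<forall>x\<in>\<O>. of_nat m * poly g x \<in> \<O>)"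
  using assms(2-)
proof (induction k arbitrary: g)
  case 0
  then obtain a where "g = [:a:]" by (auto elim: degree_eq_zeroE)
  with 0(4)[of 0] show ?case by (auto intro!: exI[of _ 1])
next
  case (Suc k)
  define c where "c = coeff g (Suc k)"
  obtain w where wK: "\<And>i. coeff w i \<in> K" and wdeg: "degree w = Suc k"
    and wlead: "coeff w (Suc k) = 1" and wpoly: "\<And>x. poly w x = (\<Prod>i<Suc k. x - of_nat i)"
    using falling_product_poly[of "Suc k"] by blast
  \<comment> \<open>Removing the top Newton term lowers the degree bound and keeps the values at
    \<open>0, \<dots>, k\<close>.\<close>
  define h where "h = g - smult c w"
  have hK: "coeff h i \<in> K" for i
    using Suc.prems(2) wK by (auto simp: h_def c_def intro!: K_diff K_mult)
  have hdeg: "degree h \<le> k"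
  proof (intro degree_le allI impI)
    fix i assume "k < i"
    then show "coeff h i = 0"
      using Suc.prems(3) wdeg wlead
      by (cases "i = Suc k") (auto simp: h_def c_def coeff_eq_0)
  qed
  have hval: "poly h (of_nat j) = poly g (of_nat j)" if "j \<le> k" for j
    using that by (auto simp: h_def wpoly prod_zero_iff)
  obtain m where m: "Rings.coprime m l" "\<And>x. x \<in> \<O> \<Longrightarrow> of_nat m * poly h x \<in> \<O>"
    using Suc.IH[of h] Suc.prems hK hdeg hval by (metis Suc_lessD le_SucI)
  have wfact: "poly w (of_nat (Suc k)) = fact (Suc k)"
  proof -
    have "poly w (of_nat (Suc k)) = (\<Prod>i<Suc k. of_nat (Suc k - i))"
      unfolding wpoly by (intro prod.cong) (auto simp: of_nat_diff simp del: of_nat_Suc)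
    also have "\<dots> = (\<Prod>i\<in>{1..Suc k}. of_nat i)"
      by (rule prod.reindex_bij_witness[of _ "\<lambda>i. Suc k - i" "\<lambda>i. Suc k - i"]) auto
    finally show ?thesis by (simp only: fact_prod of_nat_prod)
  qed
  have geq: "poly g x = poly h x + c * poly w x" for x
    by (simp add: h_def)
  \<comment> \<open>At \<open>k + 1\<close> the difference of \<open>g\<close> and \<open>h\<close>
    is \<open>c * (k + 1)!\<close>, so \<open>N\<close> clears the denominator of \<open>c\<close>;
    it stays prime to \<open>l\<close> because \<open>k + 1 < l\<close>.\<close>
  define N where "N = m * fact (Suc k)"
  have cN: "of_nat N * c \<in> \<O>"
  proof -
    have "of_nat m * poly g (of_nat (Suc k)) - of_nat m * poly h (of_nat (Suc k)) \<in> \<O>"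
      by (rule O_diff[OF O_mult[OF O_of_nat Suc.prems(4)] m(2)]) (rule order.refl, rule O_of_nat)
    also have "of_nat m * poly g (of_nat (Suc k)) - of_nat m * poly h (of_nat (Suc k)) = of_nat N * c"
      unfolding geq wfact N_def by (simp add: algebra_simps)
    finally show ?thesis .
  qed
  have "\<not> l dvd fact (Suc k)"
    using prime_dvd_fact_iff[OF assms(1)] Suc.prems(1) by (simp del: fact_Suc)
  then have "Rings.coprime (fact (Suc k)) l"
    using prime_imp_coprime[OF assms(1)] coprime_commute by blast
  with m(1) have "Rings.coprime N l" by (simp add: N_def del: fact_Suc)
  moreover have "of_nat N * poly g x \<in> \<O>" if x: "x \<in> \<O>" for x
  proof -
    have "of_nat (fact (Suc k)) * (of_nat m * poly h x) + (of_nat N * c) * poly w x \<in> \<O>"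
      unfolding wpoly
      by (rule O_add[OF O_mult[OF O_of_nat m(2)[OF x]] O_mult[OF cN O_prod]]) (rule O_diff[OF x O_of_nat])
    also have "of_nat (fact (Suc k)) * (of_nat m * poly h x) + (of_nat N * c) * poly w x
        = of_nat N * poly g x"
      unfolding geq N_def by (simp add: algebra_simps del: fact_Suc)
    finally show ?thesis .
  qed
  ultimately show ?case by blast
qed

text \<open>Subtracting \<open>a\<close> times the Newton polynomial of degree \<open>l\<close>
  leaves degree below \<open>l\<close> and the same values at \<open>0, \<dots>, l - 1\<close>. By
  interpolation the rest has no \<open>l\<close> in its denominators on \<open>\<O>\<close>, hence
  neither has the subtracted term.\<close>

lemma char_ideal_prime_bound:
  assumes "prime l" "a \<in> char_ideal K l" "x \<in> \<O>"
  shows "\<exists>m::nat. Rings.coprime m l \<and> of_nat m * (a * (\<Prod>i<l. x - of_nat i)) \<in> \<O>"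
proof -
  obtain f where f: "f \<in> int_valued_polys K" "degree f \<le> l" "coeff f l = a"
    using assms(2) unfolding char_ideal_iff by blast
  have pos: "l > 0" using prime_gt_0_nat[OF assms(1)] .
  obtain w where wK: "\<And>i. coeff w i \<in> K" and wdeg: "degree w = l"
    and wlead: "coeff w l = 1" and wpoly: "\<And>x. poly w x = (\<Prod>i<l. x - of_nat i)"
    using falling_product_poly[of l] by blast
  define h where "h = f - smult a w"
  have aK: "a \<in> K" using f by (auto dest: int_valued_polysD)
  have "\<exists>m::nat. Rings.coprime m l \<and> (\<forall>x\<in>\<O>. of_nat m * poly h x \<in> \<O>)"
  proof (rule int_valued_at_initial_naturals[OF assms(1), of "l - 1"])
    show "coeff h i \<in> K" for i
      using int_valued_polysD(1)[OF f(1)] wK aK by (auto simp: h_def intro!: K_diff K_mult)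
    show "degree h \<le> l - 1"
    proof (intro degree_le allI impI)
      fix i assume "l - 1 < i"
      then show "coeff h i = 0"
        using f wdeg wlead by (cases "i = l") (auto simp: h_def coeff_eq_0)
    qed
    show "poly h (of_nat j) \<in> \<O>" if "j \<le> l - 1" for j
    proof -
      have "poly w (of_nat j) = 0" using that pos by (auto simp: wpoly prod_zero_iff)
      then show ?thesis using int_valued_polysD(2)[OF f(1), of "of_nat j"] by (simp add: h_def)
    qed
  qed (use pos in simp)
  then obtain m where m: "Rings.coprime m l" "\<And>x. x \<in> \<O> \<Longrightarrow> of_nat m * poly h x \<in> \<O>" by blast
  have "of_nat m * poly f x - of_nat m * poly h x \<in> \<O>"
    by (rule O_diff[OF O_mult[OF O_of_nat int_valued_polysD(2)[OF f(1) assms(3)]] m(2)[OF assms(3)]])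
  also have "of_nat m * poly f x - of_nat m * poly h x = of_nat m * (a * (\<Prod>i<l. x - of_nat i))"
    by (simp add: h_def wpoly algebra_simps)
  finally show ?thesis using m(1) by blast
qed

end

subsection \<open>Rational squares\<close>

text \<open>In lowest terms, the square of the denominator divides \<open>N\<close>.\<close>

lemma rat_int_if_squarefree_mult_square:
  fixes x :: rat and N :: int
  assumes "squarefree N" "of_int N * x ^ 2 \<in> \<int>"
  shows "x \<in> \<int>"
proof -
  obtain a b where ab: "x = of_int a / of_int b" "b > 0" "Rings.coprime a b"
    by (metis Rats_cases' Rats_of_rat of_rat_eq_id id_apply surj_pair quotient_of_div quotient_of_coprime quotient_of_denom_pos)
  obtain m where m: "of_int N * x ^ 2 = of_int m" using assms(2) by (auto elim: Ints_cases)
  have "of_int (N * a ^ 2) = (of_int (m * b ^ 2) :: rat)"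
    using m ab(2) by (simp add: ab(1) power_divide field_simps)
  then have "N * a ^ 2 = m * b ^ 2" by (simp only: of_int_eq_iff)
  then have "b ^ 2 dvd N * a ^ 2" by simp
  moreover have "Rings.coprime (b ^ 2) (a ^ 2)" using ab(3) by (simp add: coprime_commute)
  ultimately have "b ^ 2 dvd N" using coprime_dvd_mult_left_iff by blast
  then have "b dvd 1" using assms(1) squarefreeD by blast
  then have "b = 1" using ab(2) by simp
  then show ?thesis using ab(1) by simp
qed

lemma squarefree_not_rat_square:
  fixes x :: rat and N :: int
  assumes "squarefree N" "N > 1"
  shows "x ^ 2 \<noteq> of_int N"
proof
  assume x: "x ^ 2 = of_int N"
  have "x \<in> \<int>" by (rule rat_int_if_squarefree_mult_square[of 1]) (simp_all add: x)
  then obtain a where "x = of_int a" by (auto elim: Ints_cases)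
  with x have "of_int (a ^ 2) = (of_int N :: rat)" by simp
  then have aN: "a ^ 2 = N" by (simp only: of_int_eq_iff)
  then have "a dvd 1" using assms(1) squarefreeD[of N a] by simp
  then have "\<bar>a\<bar> = 1" by simp
  then have "a ^ 2 = 1" by (metis power2_abs one_power2)
  with aN assms(2) show False by auto
qed

lemma sqrt_prime_not_rat:
  assumes "prime (p::nat)"
  shows "sqrt p \<notin> \<rat>"
proof
  assume "sqrt p \<in> \<rat>"
  then obtain x :: rat where x: "sqrt p = of_rat x" by (auto elim: Rats_cases)
  have "of_rat (x ^ 2) = (of_rat (of_int (int p)) :: real)"
    by (simp add: of_rat_power x[symmetric])
  then have "x ^ 2 = of_int (int p)" by (simp only: of_rat_eq_iff)
  moreover have "squarefree (int p)" using assms by (intro squarefree_prime) simp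
  ultimately show False
    using squarefree_not_rat_square[of "int p" x] prime_gt_1_nat[OF assms] by simp
qed

subsection \<open>Pell's equation and residues\<close>

text \<open>\<open>p\<close> divides one of the factors; once it is removed, two coprime numbers
  have a square product and are squares.\<close>

lemma coprime_mult_eq_prime_mult_square:
  fixes x y z p :: nat
  assumes "prime p" "Rings.coprime x y" "x * y = p * z ^ 2"
  shows "\<exists>g h. x = g ^ 2 \<and> y = p * h ^ 2 \<or> x = p * h ^ 2 \<and> y = g ^ 2"
proof -
  have p0: "p > 0" using prime_gt_0_nat[OF assms(1)] .
  have *: "\<exists>g h. x = p * h ^ 2 \<and> y = g ^ 2"
    if dvd: "p dvd x" and cop: "Rings.coprime x y" and eq: "x * y = p * z ^ 2" for x y
  proof -
    obtain x' where x': "x = p * x'" using dvd by blast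
    have "x' * y = z ^ 2" using eq p0 by (simp add: x' mult.assoc)
    moreover have "Rings.coprime x' y" using cop by (simp add: x')
    ultimately have "is_nth_power 2 x'" "is_nth_power 2 y"
      using is_nth_power_mult_coprime_natD[of x' y 2] by (cases "x' = 0"; cases "y = 0"; auto)+
    then show ?thesis by (auto simp: is_nth_power_def x')
  qed
  have "p dvd x \<or> p dvd y"
    using prime_dvd_mult_nat[OF assms(1), of x y] assms(3) by (metis dvd_triv_left)
  then show ?thesis
    using *[of x y] *[of y x] assms(2,3) by (metis coprime_commute mult.commute)
qed

text \<open>In \<open>(e + 1) * (e - 1) = p * f ^ 2\<close> the factors are coprime for even
  \<open>e\<close>, and their halves are coprime for odd \<open>e\<close>.\<close>

lemma pell_solution_split:
  fixes e f p :: nat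
  assumes "prime p" "e ^ 2 = p * f ^ 2 + 1"
  shows "even e \<Longrightarrow> \<exists>g h. e + 1 = g ^ 2 \<and> e - 1 = p * h ^ 2 \<or> e + 1 = p * h ^ 2 \<and> e - 1 = g ^ 2"
    and "odd e \<Longrightarrow> odd p \<Longrightarrow> \<exists>g h. e + 1 = 2 * g ^ 2 \<and> e - 1 = 2 * (p * h ^ 2)
      \<or> e + 1 = 2 * (p * h ^ 2) \<and> e - 1 = 2 * g ^ 2"
proof -
  have e: "e \<ge> 1" using assms(2) by (cases e) auto
  have prod: "(e + 1) * (e - 1) = p * f ^ 2"
  proof -
    obtain d where "e = Suc d" using e by (cases e) auto
    with assms(2) show ?thesis by (simp add: power2_eq_square)
  qed
  {
    assume "even e"
    have "Rings.coprime (e - 1) (e + 1)"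
    proof (rule coprimeI)
      fix d assume "d dvd e - 1" "d dvd e + 1"
      then have "d dvd (e + 1) - (e - 1)" by (rule_tac dvd_diff_nat)
      then have "d dvd 2" using e by simp
      moreover have "odd d"
        using \<open>d dvd e + 1\<close> \<open>even e\<close> by (meson dvd_trans odd_add odd_one)
      ultimately show "is_unit d"
        by (metis dvd_antisym even_Suc_Suc_iff  gcd_nat.extremum_uniqueI primes_dvd_imp_eq prime_nat_iff two_is_prime_nat dvd_refl)
    qed
    then show "\<exists>g h. e + 1 = g ^ 2 \<and> e - 1 = p * h ^ 2 \<or> e + 1 = p * h ^ 2 \<and> e - 1 = g ^ 2"
      using coprime_mult_eq_prime_mult_square[OF assms(1) _ prod] by (simp add: coprime_commute)
  next
    assume "odd e" "odd p"
    then obtain k where k: "e = 2 * k + 1" by (elim oddE)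
    have "even (p * f ^ 2)" using \<open>odd e\<close> assms(2) by (metis even_plus_one_iff even_power zero_less_numeral odd_one)
    with \<open>odd p\<close> have "even f" by simp
    then obtain j where j: "f = 2 * j" by (elim evenE)
    have "(k + 1) * k = p * j ^ 2" using prod by (simp add: k j power2_eq_square)
    then have "\<exists>g h. k + 1 = g ^ 2 \<and> k = p * h ^ 2 \<or> k + 1 = p * h ^ 2 \<and> k = g ^ 2"
      by (intro coprime_mult_eq_prime_mult_square[OF assms(1)]) auto
    then obtain g h where "k + 1 = g ^ 2 \<and> k = p * h ^ 2 \<or> k + 1 = p * h ^ 2 \<and> k = g ^ 2"
      by blast
    then show "\<exists>g h. e + 1 = 2 * g ^ 2 \<and> e - 1 = 2 * (p * h ^ 2)
      \<or> e + 1 = 2 * (p * h ^ 2) \<and> e - 1 = 2 * g ^ 2"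
      unfolding k by (intro exI[of _ g] exI[of _ h]) linarith
  }
qed

text \<open>If there were finitely many pairs, irrationality would bound the errors
  \<open>\<bar>k \<theta> - h\<bar>\<close> from below; Dirichlet's theorem then yields a further
  pair with a smaller error.\<close>

lemma sqrt_prime_approximations_infinite:
  assumes "prime (p::nat)"
  shows "infinite {(h::int, k::int). k > 0 \<and> \<bar>h ^ 2 - int p * k ^ 2\<bar> \<le> \<lceil>2 * sqrt p + 1\<rceil>}"
    (is "infinite ?S")
proof
  assume fin: "finite ?S"
  define \<theta> where "\<theta> = sqrt p"
  define \<delta> where "\<delta> = (\<lambda>(h, k). \<bar>of_int k * \<theta> - of_int h\<bar>)"
  have irr: "\<theta> \<notin> \<rat>" unfolding \<theta>_def using sqrt_prime_not_rat[OF assms] .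
  have pos: "\<delta> x > 0" if "x \<in> ?S" for x
  proof -
    obtain h k where x: "x = (h, k)" "k > 0" using \<open>x \<in> ?S\<close> by auto
    have "of_int k * \<theta> \<noteq> of_int h"
    proof
      assume "of_int k * \<theta> = of_int h"
      then have "\<theta> = of_int h / of_int k" using x by (simp add: field_simps)
      with irr show False by auto
    qed
    then show ?thesis by (simp add: \<delta>_def x)
  qed
  obtain \<epsilon> where \<epsilon>: "\<epsilon> > 0" "\<And>x. x \<in> ?S \<Longrightarrow> \<epsilon> \<le> \<delta> x"
  proof (cases "?S = {}")
    case False
    have "Min (\<delta> ` ?S) > 0" using fin False pos by (subst Min_gr_iff) auto
    moreover have "Min (\<delta> ` ?S) \<le> \<delta> x" if "x \<in> ?S" for x using fin that by (intro Min_le) auto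
    ultimately show thesis by (rule that)
  qed (use that[of 1] in auto)
  obtain N :: nat where N: "inverse (real (Suc N)) < \<epsilon>" using reals_Archimedean[OF \<epsilon>(1)] by auto
  obtain h k where hk: "0 < k" "k \<le> int (Suc N)" "\<bar>of_int k * \<theta> - of_int h\<bar> < 1 / real (Suc N)"
    using Dirichlet_approx[of "Suc N" \<theta>] by blast
  have small: "\<bar>of_int k * \<theta> - of_int h\<bar> < 1 / of_int k"
  proof -
    have "1 / real (Suc N) \<le> 1 / of_int k" using hk by (intro divide_left_mono) auto
    with hk(3) show ?thesis by linarith
  qed
  have k1: "1 / of_int k \<le> (1::real)" using hk(1) by simp
  have \<theta>0: "\<theta> \<ge> 0" by (simp add: \<theta>_def)
  \<comment> \<open>The error is below \<open>1 / k\<close>, so the conjugate factor is at most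
    \<open>2 k \<theta> + 1\<close> and the product at most \<open>2 \<theta> + 1 / k\<close>: this
    is the origin of the bound \<open>2 * sqrt p + 1\<close>.\<close>
  have "\<bar>of_int h + of_int k * \<theta>\<bar> \<le> 2 * (of_int k * \<theta>) + 1"
  proof -
    have "0 \<le> of_int k * \<theta>" using hk(1) \<theta>0 by simp
    with small k1 show ?thesis by linarith
  qed
  then have "\<bar>of_int k * \<theta> - of_int h\<bar> * \<bar>of_int h + of_int k * \<theta>\<bar> \<le> 1 / of_int k * (2 * (of_int k * \<theta>) + 1)"
    using small hk(1) by (intro mult_mono) auto
  also have "1 / of_int k * (2 * (of_int k * \<theta>) + 1) = 2 * \<theta> + 1 / of_int k"
    using hk(1) by (simp add: field_simps)
  also have "\<bar>of_int k * \<theta> - of_int h\<bar> * \<bar>of_int h + of_int k * \<theta>\<bar> = \<bar>of_int (h ^ 2 - int p * k ^ 2)\<bar>"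
  proof -
    have "(of_int k * \<theta> - of_int h) * (of_int h + of_int k * \<theta>) = of_int k ^ 2 * \<theta> ^ 2 - of_int h ^ 2"
      by (simp add: algebra_simps power2_eq_square)
    also have "\<theta> ^ 2 = p" by (simp add: \<theta>_def)
    finally show ?thesis unfolding abs_mult[symmetric] by (simp add: abs_minus_commute mult.commute)
  qed
  finally have "\<bar>of_int (h ^ 2 - int p * k ^ 2)\<bar> \<le> 2 * \<theta> + 1" using k1 by linarith
  then have "of_int \<bar>h ^ 2 - int p * k ^ 2\<bar> \<le> (of_int \<lceil>2 * \<theta> + 1\<rceil> :: real)"
    by (metis le_of_int_ceiling of_int_abs order.trans)
  then have "(h, k) \<in> ?S" using hk(1) by (simp only: of_int_le_iff mem_Collect_eq case_prod_conv \<theta>_def)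
  from \<epsilon>(2)[OF this] hk(3) N show False by (simp add: \<delta>_def inverse_eq_divide)
qed

text \<open>Pigeonhole: two pairs with the same norm \<open>N\<close> and congruent coordinates
  modulo \<open>N\<close> have an integral quotient of norm 1.\<close>

lemma pell_solution_exists:
  assumes "prime (p::nat)"
  shows "\<exists>e f. f > 0 \<and> e ^ 2 = p * f ^ 2 + 1"
proof -
  define B where "B = \<lceil>2 * sqrt p + 1\<rceil>"
  define S where "S = {(h::int, k::int). k > 0 \<and> \<bar>h ^ 2 - int p * k ^ 2\<bar> \<le> B}"
  define n where "n = (\<lambda>(h::int, k::int). h ^ 2 - int p * k ^ 2)"
  define F where "F x = (n x, fst x mod n x, snd x mod n x)" for x
  have n0: "n x \<noteq> 0" if "x \<in> S" for x
  proof
    assume "n x = 0"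
    obtain h k where x: "x = (h, k)" "k > 0" using \<open>x \<in> S\<close> by (auto simp: S_def)
    have "h ^ 2 = int p * k ^ 2" using \<open>n x = 0\<close> by (simp add: n_def x)
    then have "(of_int h / of_int k) ^ 2 = real p"
      using x(2) by (simp add: power_divide divide_simps flip: of_int_power of_int_mult) (metis of_int_mult of_int_of_nat_eq)
    then have "sqrt p = \<bar>of_int h / of_int k\<bar>" by (metis real_sqrt_abs)
    then have "sqrt p \<in> \<rat>" by simp
    with sqrt_prime_not_rat[OF assms] show False by simp
  qed
  have "infinite S" unfolding S_def B_def by (rule sqrt_prime_approximations_infinite[OF assms])
  moreover have "F ` S \<subseteq> {-B..B} \<times> {-B..B} \<times> {-B..B}"
  proof
    fix y assume "y \<in> F ` S"
    then obtain x where x: "x \<in> S" "y = F x" by auto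
    have "\<bar>n x\<bar> \<le> B" using x(1) by (auto simp: S_def n_def)
    moreover have "\<bar>a mod n x\<bar> \<le> \<bar>n x\<bar>" for a
      using n0[OF x(1)] abs_mod_less[of "n x" a] by simp
    ultimately show "y \<in> {-B..B} \<times> {-B..B} \<times> {-B..B}"
      unfolding x(2) F_def by (smt (verit) SigmaI atLeastAtMost_iff)
  qed
  then have "finite (F ` S)" by (rule finite_subset) auto
  ultimately obtain x where x: "x \<in> S" "infinite {y \<in> S. F y = F x}"
    using pigeonhole_infinite[of S F] by auto
  then obtain y where y: "y \<in> S" "F y = F x" "y \<noteq> x"
    by (metis (mono_tags, lifting) finite.emptyI finite_insert finite_subset insertCI mem_Collect_eq subsetI)
  obtain h1 k1 h2 k2 where xy: "x = (h1, k1)" "y = (h2, k2)" by (metis surj_pair)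
  define N where "N = n x"
  have N0: "N \<noteq> 0" using n0[OF x(1)] by (simp add: N_def)
  have N1: "h1 ^ 2 - int p * k1 ^ 2 = N" and N2: "h2 ^ 2 - int p * k2 ^ 2 = N"
    using y(2) by (auto simp: F_def N_def xy n_def)
  have k: "k1 > 0" "k2 > 0" using x(1) y(1) by (auto simp: S_def xy)
  have "[h2 = h1] (mod N)" "[k2 = k1] (mod N)"
    using y(2) by (auto simp: F_def N_def xy unique_euclidean_semiring_class.cong_def)
  then obtain a b where ab: "h2 = h1 + N * a" "k2 = k1 + N * b"
    by (metis cong_iff_lin cong_sym)
  \<comment> \<open>\<open>e + f \<theta>\<close> is
    \<open>(h2 + k2 \<theta>) / (h1 + k1 \<theta>)\<close> with \<open>\<theta> = \<surd>p\<close>;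
    the formulas show that the division by \<open>N\<close> is exact.\<close>
  define e where "e = 1 + h1 * a - int p * k1 * b"
  define f where "f = h1 * b - k1 * a"
  have eN: "e * N = h1 * h2 - int p * k1 * k2"
    unfolding e_def ab using N1 by (simp add: algebra_simps power2_eq_square)
  have fN: "f * N = h1 * k2 - k1 * h2"
    unfolding f_def ab by (simp add: algebra_simps)
  have "(e * N) ^ 2 - int p * (f * N) ^ 2 = (h1 ^ 2 - int p * k1 ^ 2) * (h2 ^ 2 - int p * k2 ^ 2)"
    unfolding eN fN by (simp add: algebra_simps power2_eq_square)
  also have "\<dots> = N ^ 2" unfolding N1 N2 by (simp add: power2_eq_square)
  finally have "(e ^ 2 - int p * f ^ 2) * N ^ 2 = 1 * N ^ 2"
    by (simp add: power_mult_distrib algebra_simps)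
  then have ef: "e ^ 2 - int p * f ^ 2 = 1" using N0 by (simp only: mult_cancel_right) simp
  \<comment> \<open>With \<open>f = 0\<close> the pairs would be proportional and of equal norm,
    hence equal, as both \<open>k1\<close> and \<open>k2\<close> are positive.\<close>
  have "f \<noteq> 0"
  proof
    assume "f = 0"
    then have eqp: "h1 * k2 = k1 * h2" using fN by simp
    have "N * k2 ^ 2 = (h1 * k2) ^ 2 - int p * k1 ^ 2 * k2 ^ 2"
      unfolding N1[symmetric] by (simp add: algebra_simps)
    also have "\<dots> = N * k1 ^ 2"
      unfolding eqp N2[symmetric] by (simp add: algebra_simps)
    finally have "k2 ^ 2 = k1 ^ 2" using N0 by simp
    then have "k2 = k1" using k by (simp add: power2_eq_iff)
    moreover from this eqp k have "h1 = h2" by simp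
    ultimately show False using y(3) xy by simp
  qed
  have "(nat \<bar>e\<bar>) ^ 2 = p * (nat \<bar>f\<bar>) ^ 2 + 1"
  proof -
    have "int ((nat \<bar>e\<bar>) ^ 2) = int (p * (nat \<bar>f\<bar>) ^ 2 + 1)"
      using ef by simp
    then show ?thesis by (simp only: of_nat_eq_iff)
  qed
  with \<open>f \<noteq> 0\<close> show ?thesis by (intro exI[of _ "nat \<bar>e\<bar>"] exI[of _ "nat \<bar>f\<bar>"]) auto
qed

text \<open>Descent on \<open>f\<close>: an odd \<open>e\<close> yields a smaller solution.\<close>

lemma norm_two_exists:
  assumes "prime (p::nat)" "[p = 3] (mod 4)"
  shows "\<exists>A B::int. \<bar>A ^ 2 - int p * B ^ 2\<bar> = 2"
proof -
  have "p mod 4 = 3" using assms(2) by (simp add: unique_euclidean_semiring_class.cong_def)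
  then have oddp: "odd p" by presburger
  have "\<exists>A B::int. \<bar>A ^ 2 - int p * B ^ 2\<bar> = 2" if "f > 0" "e ^ 2 = p * f ^ 2 + 1" for e f
    using that
  proof (induction f arbitrary: e rule: less_induct)
    case (less f e)
    have e: "e \<ge> 2"
    proof (rule ccontr)
      assume "\<not> e \<ge> 2"
      then have "e = 0 \<or> e = 1" by auto
      with less.prems prime_gt_0_nat[OF assms(1)] show False by auto
    qed
    show ?case
    proof (cases "even e")
      \<comment> \<open>\<open>e + 1\<close> and \<open>e - 1\<close> are \<open>g^2\<close> and
        \<open>p h^2\<close> in some order, and they differ by 2.\<close>
      case True
      then obtain g h where "e + 1 = g ^ 2 \<and> e - 1 = p * h ^ 2 \<or> e + 1 = p * h ^ 2 \<and> e - 1 = g ^ 2"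
        using pell_solution_split(1)[OF assms(1) less.prems(2)] by blast
      then have "g ^ 2 = p * h ^ 2 + 2 \<or> p * h ^ 2 = g ^ 2 + 2" using e by auto
      then have "int (g ^ 2) = int (p * h ^ 2 + 2) \<or> int (p * h ^ 2) = int (g ^ 2 + 2)"
        by (simp only: of_nat_eq_iff)
      then have "int g ^ 2 = int p * int h ^ 2 + 2 \<or> int p * int h ^ 2 = int g ^ 2 + 2"
        by (simp only: of_nat_add of_nat_mult of_nat_power of_nat_numeral)
      then have "\<bar>int g ^ 2 - int p * int h ^ 2\<bar> = 2" by linarith
      then show ?thesis by blast
    next
      case False
      then obtain g h where gh: "e + 1 = 2 * g ^ 2 \<and> e - 1 = 2 * (p * h ^ 2)
        \<or> e + 1 = 2 * (p * h ^ 2) \<and> e - 1 = 2 * g ^ 2"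
        using pell_solution_split(2)[OF assms(1) less.prems(2) _ oddp] by blast
      \<comment> \<open>The halves differ by 1. Either \<open>g^2 - p h^2 = 1\<close>, a solution
        with \<open>h < f = 2 g h\<close>, or \<open>p h^2 = g^2 + 1\<close>, where modulo 4 the
        left side is 0 or 3 and the right side 1 or 2.\<close>
      then show ?thesis
      proof
        assume *: "e + 1 = 2 * g ^ 2 \<and> e - 1 = 2 * (p * h ^ 2)"
        then have 1: "g ^ 2 = p * h ^ 2 + 1" using e by auto
        have "(e + 1) * (e - 1) = p * f ^ 2"
        proof -
          obtain d where "e = Suc d" using e by (cases e) auto
          with less.prems(2) show ?thesis by (simp add: power2_eq_square)
        qed
        then have "p * (2 * g * h) ^ 2 = p * f ^ 2"
          unfolding conjunct1[OF *] conjunct2[OF *] by (simp add: power_mult_distrib mult_ac)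
        then have f: "f = 2 * g * h" using prime_gt_0_nat[OF assms(1)] by (simp add: power2_eq_iff_nonneg)
        with less.prems(1) have "h > 0" "g > 0" by auto
        then have "h < f" unfolding f by simp
        from less.IH[OF this \<open>h > 0\<close> 1] show ?thesis .
      next
        assume "e + 1 = 2 * (p * h ^ 2) \<and> e - 1 = 2 * g ^ 2"
        then have 1: "p * h ^ 2 = g ^ 2 + 1" using e by auto
        have "(g ^ 2 + 1) mod 4 = (3 * (h ^ 2)) mod 4"
          using 1 assms(2) by (metis unique_euclidean_semiring_class.cong_def cong_scalar_right mod_mult_left_eq)
        moreover have "x ^ 2 mod 4 = 0 \<or> x ^ 2 mod 4 = 1" for x :: nat
        proof -
          have "x ^ 2 mod 4 = (x mod 4) ^ 2 mod 4" by (simp add: power_mod)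
          moreover have "x mod 4 \<in> {0, 1, 2, 3}" by auto
          ultimately show ?thesis by auto
        qed
        moreover have "(a + 1) mod 4 \<noteq> (3 * b) mod 4"
          if "a mod 4 = 0 \<or> a mod 4 = 1" "b mod 4 = 0 \<or> b mod 4 = 1" for a b :: nat
        proof -
          have "(a + 1) mod 4 = 1 \<or> (a + 1) mod 4 = 2" using that by (auto simp: mod_Suc)
          moreover obtain c where "b = 4 * c \<or> b = 4 * c + 1"
            using \<open>b mod 4 = 0 \<or> b mod 4 = 1\<close> by (metis mult_div_mod_eq add_0_right)
          then have "(3 * b) mod 4 = 0 \<or> (3 * b) mod 4 = 3"
          proof
            assume "b = 4 * c + 1"
            then have "3 * b = 3 + (3 * c) * 4" by simp
            then show ?thesis by (simp only: mod_mult_self1) simp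
          qed simp
          ultimately show ?thesis by auto
        qed
        ultimately show ?thesis by metis
      qed
    qed
  qed
  with pell_solution_exists[OF assms(1)] show ?thesis by blast
qed

text \<open>By Hilbert 90, \<open>2 * (1 + e) * (e + f * t) \<equiv> (1 + e + f * t)\<^sup>2\<close> modulo \<open>r\<close>, and
  \<open>1 + e\<close> is one of \<open>1, 2, p, 2 * p\<close> times a square.\<close>

lemma norm_one_unit_square_mod:
  fixes t i s e f :: int
  assumes p: "prime (p::nat)" "odd p" and r: "prime (r::nat)" "odd r" "r \<noteq> p"
    and t: "[t ^ 2 = int p] (mod int r)" and i: "[i ^ 2 = - 1] (mod int r)" and s: "[s ^ 2 = 2] (mod int r)"
    and ef: "e ^ 2 - int p * f ^ 2 = 1"
  shows "\<exists>k. [k ^ 2 = e + f * t] (mod int r)"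
proof -
  have pos: "\<exists>k. [k ^ 2 = e + f * t] (mod int r)" if ef: "e ^ 2 - int p * f ^ 2 = 1" and e: "e > 0" for e f
  proof -
    have "\<exists>w. [w ^ 2 = 2 * (e + 1)] (mod int r)"
    proof -
      have nat: "(nat e) ^ 2 = p * (nat \<bar>f\<bar>) ^ 2 + 1"
      proof -
        have "int ((nat e) ^ 2) = int (p * (nat \<bar>f\<bar>) ^ 2 + 1)" using ef e by simp
        then show ?thesis by (simp only: of_nat_eq_iff)
      qed
      have "\<exists>g. nat e + 1 = g ^ 2 \<or> nat e + 1 = p * g ^ 2 \<or> nat e + 1 = 2 * g ^ 2 \<or> nat e + 1 = 2 * (p * g ^ 2)"
        using pell_solution_split[OF p(1) nat] p(2) by blast
      then obtain g where "nat e + 1 = g ^ 2 \<or> nat e + 1 = p * g ^ 2 \<or> nat e + 1 = 2 * g ^ 2 \<or> nat e + 1 = 2 * (p * g ^ 2)"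
        by blast
      then have "int (nat e + 1) = int (g ^ 2) \<or> int (nat e + 1) = int (p * g ^ 2)
        \<or> int (nat e + 1) = int (2 * g ^ 2) \<or> int (nat e + 1) = int (2 * (p * g ^ 2))"
        by (simp only: of_nat_eq_iff)
      then consider "e + 1 = int g ^ 2" | "e + 1 = int p * int g ^ 2" | "e + 1 = 2 * int g ^ 2"
        | "e + 1 = 2 * int p * int g ^ 2"
        using e by auto
      then show ?thesis
      proof cases
        case 1
        have "[(s * int g) ^ 2 = 2 * (e + 1)] (mod int r)"
          unfolding 1 power_mult_distrib by (intro cong_mult s cong_refl)
        then show ?thesis by blast
      next
        case 2
        have "[(s * t * int g) ^ 2 = 2 * int p * int g ^ 2] (mod int r)"
          unfolding power_mult_distrib by (intro cong_mult s t cong_refl)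
        then show ?thesis unfolding 2 by (auto simp: mult.assoc)
      next
        case 3
        have "(2 * int g) ^ 2 = 2 * (e + 1)" unfolding 3 by (simp add: power2_eq_square)
        then show ?thesis by (metis cong_refl)
      next
        case 4
        have "[(2 * t * int g) ^ 2 = 2 ^ 2 * int p * int g ^ 2] (mod int r)"
          unfolding power_mult_distrib by (intro cong_mult t cong_refl)
        moreover have "2 ^ 2 * int p * int g ^ 2 = 2 * (e + 1)" unfolding 4 by simp
        ultimately show ?thesis by auto
      qed
    qed
    then obtain w where w: "[w ^ 2 = 2 * (e + 1)] (mod int r)" by blast
    show ?thesis
    proof (cases "int r dvd w")
      case False
      then have "Rings.coprime w (int r)"
        using r prime_imp_coprime[of "int r" w] by (simp add: coprime_commute)
      then obtain v where v: "[w * v = 1] (mod int r)" using cong_solve_coprime_int by blast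
      have "[2 * (e + 1) * (e + f * t) = (1 + e + f * t) ^ 2] (mod int r)"
      proof -
        have "(1 + e + f * t) ^ 2 - 2 * (e + 1) * (e + f * t) = f ^ 2 * t ^ 2 + 1 - e ^ 2"
          by (simp add: algebra_simps power2_eq_square)
        also have "\<dots> = f ^ 2 * (t ^ 2 - int p)" using ef by (simp add: algebra_simps)
        finally show ?thesis using t
          by (metis cong_iff_dvd_diff cong_sym dvd_mult)
      qed
      then have "[w ^ 2 * (e + f * t) = (1 + e + f * t) ^ 2] (mod int r)"
        using cong_mult[OF w cong_refl] cong_trans by blast
      then have "[v ^ 2 * (w ^ 2 * (e + f * t)) = v ^ 2 * (1 + e + f * t) ^ 2] (mod int r)"
        by (intro cong_mult cong_refl)
      moreover have "[(w * v) ^ 2 * (e + f * t) = 1 ^ 2 * (e + f * t)] (mod int r)"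
        by (intro cong_mult cong_pow v cong_refl)
      ultimately have "[(v * (1 + e + f * t)) ^ 2 = e + f * t] (mod int r)"
        by (simp add: power_mult_distrib mult_ac) (metis cong_sym cong_trans)
      then show ?thesis by blast
    next
      \<comment> \<open>Here \<open>e \<equiv> - 1\<close> and the Hilbert 90 factor vanishes; the
        norm equation forces \<open>f \<equiv> 0\<close>, so the unit is \<open>- 1\<close>, the
        square of \<open>i\<close>.\<close>
      case True
      then have "int r dvd w ^ 2" by (simp add: power2_eq_square)
      then have "int r dvd 2 * (e + 1)" using w cong_dvd_iff by blast
      moreover have "\<not> int r dvd 2"
        using r(1,2) two_is_prime_nat
        by (metis even_numeral int_dvd_int_iff of_nat_numeral primes_dvd_imp_eq)
      ultimately have r1: "int r dvd e + 1"
        using r prime_dvd_mult_iff[of "int r" 2 "e + 1"] by simp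
      have "int p * f ^ 2 = (e + 1) * (e - 1)"
        using ef by (simp add: algebra_simps power2_eq_square)
      with r1 have "int r dvd int p * f ^ 2" by simp
      then have "int r dvd f"
        using r p(1) prime_dvd_mult_iff[of "int r" "int p" "f ^ 2"]
        by (metis int_dvd_int_iff prime_dvd_power prime_nat_int_transfer primes_dvd_imp_eq)
      then have "int r dvd (e + 1) + f * t" using r1 by simp
      then have "[e + f * t = - 1] (mod int r)"
        by (simp add: cong_iff_dvd_diff algebra_simps)
      then have "[i ^ 2 = e + f * t] (mod int r)" using i cong_sym cong_trans by blast
      then show ?thesis by blast
    qed
  qed
  show ?thesis
  proof (cases "e > 0")
    case True
    with pos ef show ?thesis by blast
  next
    \<comment> \<open>Negating the unit makes \<open>e\<close> positive, and \<open>- 1\<close> is a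
      square.\<close>
    case False
    have "e \<noteq> 0"
    proof
      assume "e = 0"
      with ef have "int p * f ^ 2 = - 1" by simp
      moreover have "int p * f ^ 2 \<ge> 0" by simp
      ultimately show False by simp
    qed
    with False have "- e > 0" by simp
    moreover have "(- e) ^ 2 - int p * (- f) ^ 2 = 1" using ef by simp
    ultimately obtain k where "[k ^ 2 = - e + - f * t] (mod int r)" using pos by blast
    then have "[i ^ 2 * k ^ 2 = - 1 * (- e + - f * t)] (mod int r)" using i by (intro cong_mult)
    then have "[(i * k) ^ 2 = e + f * t] (mod int r)" by (simp add: power_mult_distrib add.commute)
    then show ?thesis by blast
  qed
qed

text \<open>By Euler's criterion the nonresidue \<open>q\<close> gives
  \<open>z = q ^ ((r - 1) div 8)\<close> with \<open>z^4 \<equiv> - 1\<close>, a primitive eighth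
  root of unity. Then \<open>z^2\<close> is a root of \<open>- 1\<close>, and
  \<open>z - z^3 = z + 1 / z\<close> is a root of 2.\<close>

lemma cong_square_minus_one_and_two:
  assumes r: "prime (r::nat)" "[r = 1] (mod 8)" and q: "Legendre q (int r) = - 1"
  shows "\<exists>i s. [i ^ 2 = - 1] (mod int r) \<and> [s ^ 2 = 2] (mod int r)"
proof -
  have r8: "r mod 8 = 1" using r(2) by (simp add: unique_euclidean_semiring_class.cong_def)
  then have "r \<noteq> 2" by auto
  then have "r > 2" using prime_gt_1_nat[OF r(1)] by simp
  have "(r - 1) div 2 = 4 * (r div 8)" using r8 by presburger
  then have "[Legendre q (int r) = q ^ (4 * (r div 8))] (mod int r)"
    using euler_criterion[OF r(1) \<open>r > 2\<close>, of q] by simp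
  define z where "z = q ^ (r div 8)"
  have z: "[z ^ 4 = - 1] (mod int r)"
    using \<open>[Legendre q (int r) = q ^ (4 * (r div 8))] (mod int r)\<close> q
    by (simp add: z_def cong_sym power_mult[symmetric] mult.commute)
  have "[(z - z ^ 3) ^ 2 = 2] (mod int r)"
  proof -
    have "(z - z ^ 3) ^ 2 - 2 = (z ^ 4 - - 1) * (z ^ 2 - 2)"
      by (simp add: algebra_simps power2_eq_square power3_eq_cube power4_eq_xxxx)
    with z show ?thesis by (metis cong_iff_dvd_diff dvd_mult2)
  qed
  moreover have "[(z ^ 2) ^ 2 = - 1] (mod int r)" using z by (simp add: power_mult[symmetric])
  ultimately show ?thesis by blast
qed

section \<open>Elementary arithmetic\<close>

lemma square_mod_4: "(x::int) ^ 2 mod 4 = 0 \<and> even x \<or> x ^ 2 mod 4 = 1 \<and> odd x"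
proof (cases "even x")
  case True
  then obtain k where "x = 2 * k" by (elim evenE)
  then show ?thesis by (simp add: power2_eq_square)
next
  case False
  then obtain k where "x = 2 * k + 1" by (elim oddE)
  then have "x ^ 2 = 1 + 4 * (k * k + k)" by (simp add: power2_eq_square algebra_simps)
  then have "x ^ 2 mod 4 = 1" by (simp only: mod_mult_self2) simp
  with False show ?thesis by simp
qed

lemma primes_coprime_int:
  assumes "prime l" "prime m" "l \<noteq> m"
  shows "Rings.coprime (int l) (int m)"
  using assms by (simp add: primes_coprime)

lemma odd_coprime_4: assumes "odd l" shows "Rings.coprime (int l) 4"
proof -
  have "Rings.coprime (int l) (2 ^ 2)" using assms by (simp only: coprime_power_right_iff) simp
  moreover have "(2::int) ^ 2 = 4" by simp
  ultimately show ?thesis by metis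
qed

lemma prime_power_if_unique_prime:
  fixes n :: nat
  assumes "n > 0" "prime l" "\<And>l'. prime l' \<Longrightarrow> l' dvd n \<Longrightarrow> l' = l"
  shows "\<exists>k. n = l ^ k"
proof -
  obtain k m where km: "n = l ^ k * m" "\<not> l dvd m"
    using assms(1,2) by (metis multiplicity_decompose' not_prime_unit not_gr_zero)
  have "m = 1"
  proof (rule ccontr)
    assume "m \<noteq> 1"
    then obtain l' where "prime l'" "l' dvd m" using prime_factor_nat by blast
    then show False using assms(3)[of l'] km by auto
  qed
  with km(1) show ?thesis by auto
qed

subsection \<open>The biquadratic field\<close>

lemma quadratic_independent:
  fixes w :: complex and N :: int
  assumes "w * w = of_int N" "squarefree N" "N > 1" "of_rat a + of_rat b * w = 0"
  shows "a = 0 \<and> b = 0"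
proof (cases "b = 0")
  case False
  then have "w = of_rat (- a / b)"
    using assms(4) by (simp add: of_rat_divide of_rat_minus field_simps add_eq_0_iff)
  then have "of_rat ((- a / b) ^ 2) = w * w"
    unfolding power2_eq_square by (simp only: of_rat_mult)
  with assms(1) have "of_rat ((- a / b) ^ 2) = (of_rat (of_int N) :: complex)"
    by (simp only: of_rat_of_int_eq)
  then have "(- a / b) ^ 2 = of_int N" by (simp only: of_rat_eq_iff)
  with squarefree_not_rat_square[OF assms(2,3)] show ?thesis by blast
qed (use assms(4) in simp)

lemma algebraic_multiple_closed:
  fixes x y :: "'a::field_char_0"
  assumes "\<exists>n>0. algebraic_int (of_nat n * x)" "\<exists>n>0. algebraic_int (of_nat n * y)"
  shows "\<exists>n>0. algebraic_int (of_nat n * (x + y))" "\<exists>n>0. algebraic_int (of_nat n * (x * y))"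
proof -
  obtain m n where m: "m > 0" "algebraic_int (of_nat m * x)" and n: "n > 0" "algebraic_int (of_nat n * y)"
    using assms by auto
  have "algebraic_int (of_nat n * (of_nat m * x) + of_nat m * (of_nat n * y))"
    by (rule algebraic_int_add[OF algebraic_int_mult[OF _ m(2)] algebraic_int_mult[OF _ n(2)]]) auto
  moreover have "of_nat n * (of_nat m * x) + of_nat m * (of_nat n * y) = of_nat (m * n) * (x + y)"
    by (simp add: algebra_simps)
  ultimately show "\<exists>n>0. algebraic_int (of_nat n * (x + y))"
    using m(1) n(1) by (metis mult_pos_pos)
  have "algebraic_int ((of_nat m * x) * (of_nat n * y))"
    using algebraic_int_mult[OF m(2) n(2)] .
  moreover have "(of_nat m * x) * (of_nat n * y) = of_nat (m * n) * (x * y)"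
    by (simp add: algebra_simps)
  ultimately show "\<exists>n>0. algebraic_int (of_nat n * (x * y))"
    using m(1) n(1) by (metis mult_pos_pos)
qed

locale biquadratic =
  fixes p q r :: nat
  assumes prime_p: "prime p" and prime_q: "prime q" and prime_r: "prime r"
    and distinct: "p \<noteq> q" "p \<noteq> r" "q \<noteq> r"
    and p_mod_4: "[p = 3] (mod 4)" and q_mod_4: "[q = 3] (mod 4)" and r_mod_8: "[r = 1] (mod 8)"
    and Legendre_p: "Legendre (int p) (int r) = 1" and Legendre_q: "Legendre (int q) (int r) = - 1"
begin

definition u :: complex where "u = complex_of_real (sqrt (real p))"
definition v :: complex where "v = complex_of_real (sqrt (real (q * r)))"

definition el :: "rat \<Rightarrow> rat \<Rightarrow> rat \<Rightarrow> rat \<Rightarrow> complex" where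
  "el a b c d = of_rat a + of_rat b * u + of_rat c * v + of_rat d * (u * v)"

definition F :: "complex set" where "F = {el a b c d | a b c d. True}"

lemma u_square: "u * u = of_nat p" and v_square: "v * v = of_nat (q * r)"
proof -
  have "complex_of_real (sqrt x) * complex_of_real (sqrt x) = complex_of_real x" if "x \<ge> 0" for x
    using that by (metis of_real_mult real_sqrt_mult_self abs_of_nonneg)
  from this[of "real p"] this[of "real (q * r)"] show "u * u = of_nat p" "v * v = of_nat (q * r)"
    unfolding u_def v_def by simp_all
qed

lemma squarefree_p: "squarefree (int p)"
  and squarefree_qr: "squarefree (int (q * r))"
  and squarefree_pqr: "squarefree (int (p * (q * r)))"
proof -
  have cop: "Rings.coprime (int p) (int q)" "Rings.coprime (int p) (int r)" "Rings.coprime (int q) (int r)"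
    using prime_p prime_q prime_r distinct by (simp_all add: primes_coprime)
  show p: "squarefree (int p)" using prime_p by (intro squarefree_prime) simp
  have "squarefree (int q)" "squarefree (int r)"
    using prime_q prime_r by (auto intro!: squarefree_prime)
  then show qr: "squarefree (int (q * r))"
    using cop by (simp add: squarefree_mult_coprime)
  from p qr show "squarefree (int (p * (q * r)))"
    using cop by (simp only: of_nat_mult squarefree_mult_coprime coprime_mult_right_iff simp_thms)
qed

lemma p_gt_1: "int p > 1" and qr_gt_1: "int (q * r) > 1" and pqr_gt_1: "int (p * (q * r)) > 1"
proof -
  have 1: "p > 1" "q > 1" "r > 1" using prime_p prime_q prime_r by (auto dest: prime_gt_1_nat)
  then have 2: "q * r > 1" by (metis less_1_mult)
  with 1 have 3: "p * (q * r) > 1" by (metis less_1_mult)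
  from 1 2 3 show "int p > 1" "int (q * r) > 1" "int (p * (q * r)) > 1"
    by (simp_all only: of_nat_less_iff[of 1, unfolded of_nat_1])
qed

lemma u_independent: "of_rat a + of_rat b * u = 0 \<Longrightarrow> a = 0 \<and> b = 0"
  using quadratic_independent[of u "int p" a b] u_square squarefree_p p_gt_1 by simp

lemma el_add: "el a b c d + el a' b' c' d' = el (a + a') (b + b') (c + c') (d + d')"
  by (simp add: el_def of_rat_add algebra_simps)

lemma el_minus: "- el a b c d = el (- a) (- b) (- c) (- d)"
  by (simp add: el_def of_rat_minus algebra_simps)

lemma el_mult:
  "el a b c d * el a' b' c' d' =
   el (a * a' + of_nat p * (b * b') + of_nat (q * r) * (c * c') + of_nat p * of_nat (q * r) * (d * d'))
      (a * b' + b * a' + of_nat (q * r) * (c * d' + d * c'))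
      (a * c' + c * a' + of_nat p * (b * d' + d * b'))
      (a * d' + d * a' + b * c' + c * b')"
proof -
  have id: "(A + B * u + C * v + D * (u * v)) * (A' + B' * u + C' * v + D' * (u * v)) =
    (A * A' + (u * u) * (B * B') + (v * v) * (C * C') + (u * u) * (v * v) * (D * D'))
    + (A * B' + B * A' + (v * v) * (C * D' + D * C')) * u
    + (A * C' + C * A' + (u * u) * (B * D' + D * B')) * v
    + (A * D' + D * A' + B * C' + C * B') * (u * v)" for A B C D A' B' C' D' :: complex
    by (simp add: algebra_simps)
  show ?thesis unfolding el_def id u_square v_square
    by (simp only: of_rat_add of_rat_mult of_rat_of_nat_eq)
qed

lemma el_rat: "el a 0 0 0 = of_rat a"
  by (simp add: el_def)

text \<open>If \<open>c + d u\<close> is nonzero, then \<open>v = x + y u\<close> with rational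
  \<open>x\<close>, \<open>y\<close>. Squaring gives \<open>x * y = 0\<close>, which makes
  \<open>pqr\<close> or \<open>qr\<close> a rational square.\<close>

lemma el_eq_0:
  assumes "el a b c d = 0"
  shows "a = 0 \<and> b = 0 \<and> c = 0 \<and> d = 0"
proof -
  let ?a = "of_rat a + of_rat b * u" and ?c = "of_rat c + of_rat d * u" and ?c' = "of_rat c - of_rat d * u"
  have eq: "?a + ?c * v = 0" using assms by (simp add: el_def algebra_simps)
  define n where "n = c * c - of_nat p * (d * d)"
  have n: "?c * ?c' = of_rat n"
  proof -
    have "?c * ?c' = of_rat c * of_rat c - (u * u) * (of_rat d * of_rat d)" by (simp add: algebra_simps)
    then show ?thesis by (simp add: n_def u_square of_rat_diff of_rat_mult)
  qed
  show ?thesis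
  proof (cases "n = 0")
    case True
    with n have "?c = 0 \<or> ?c' = 0" by simp
    moreover have "?c' = of_rat c + of_rat (- d) * u" by (simp add: of_rat_minus)
    ultimately have "c = 0 \<and> d = 0" using u_independent[of c d] u_independent[of c "- d"] by auto
    with eq u_independent[of a b] show ?thesis by simp
  next
    case False
    \<comment> \<open>The coordinates of \<open>- (a + b u) * (c - d u) / n\<close>, that is of
      \<open>v\<close> solved from the linear relation.\<close>
    define x y where "x = - (a * c - of_nat p * (b * d)) / n" and "y = - (b * c - a * d) / n"
    have xy: "x * n = - (a * c - of_nat p * (b * d))" "y * n = - (b * c - a * d)"
      using False by (simp_all add: x_def y_def)
    have "?c * v = - ?a" using eq by (simp only: eq_neg_iff_add_eq_0 add.commute)
    then have "of_rat n * v = - (?a * ?c')"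
      unfolding n[symmetric] by (metis mult.commute mult.left_commute mult_minus_left)
    also have "?a * ?c' = (of_rat a * of_rat c - (u * u) * (of_rat b * of_rat d)) + (of_rat b * of_rat c - of_rat a * of_rat d) * u"
      by (simp add: algebra_simps)
    also have "- \<dots> = of_rat (x * n) + of_rat (y * n) * u"
      unfolding xy u_square by (simp add: of_rat_diff of_rat_mult of_rat_minus algebra_simps)
    also have "\<dots> = of_rat n * (of_rat x + of_rat y * u)"
      by (simp add: of_rat_mult algebra_simps)
    finally have v: "v = of_rat x + of_rat y * u" using False by simp
    have "v * v = (of_rat x * of_rat x + (u * u) * (of_rat y * of_rat y)) + 2 * of_rat x * of_rat y * u"
      unfolding v by (simp add: algebra_simps)
    then have "of_rat (x * x + of_nat p * (y * y) - of_nat (q * r)) + of_rat (2 * x * y) * u = 0"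
      unfolding u_square v_square by (simp add: of_rat_add of_rat_mult of_rat_diff algebra_simps)
    from u_independent[OF this] have 1: "x * x + of_nat p * (y * y) = of_nat (q * r)" and 2: "x = 0 \<or> y = 0"
      by auto
    from 2 show ?thesis
    proof
      assume "x = 0"
      with 1 have "(of_nat p * y) ^ 2 = of_int (int (p * (q * r)))"
        by (simp add: power2_eq_square algebra_simps)
      then show ?thesis using squarefree_not_rat_square[OF squarefree_pqr pqr_gt_1] by blast
    next
      assume "y = 0"
      with 1 have "x ^ 2 = of_int (int (q * r))" by (simp add: power2_eq_square)
      then show ?thesis using squarefree_not_rat_square[OF squarefree_qr qr_gt_1] by blast
    qed
  qed
qed

lemma el_inject: "el a b c d = el a' b' c' d' \<longleftrightarrow> a = a' \<and> b = b' \<and> c = c' \<and> d = d'"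
proof
  assume "el a b c d = el a' b' c' d'"
  then have "el a b c d + - el a' b' c' d' = 0" by simp
  then have "el (a - a') (b - b') (c - c') (d - d') = 0" by (simp only: el_minus el_add) simp
  from el_eq_0[OF this] show "a = a' \<and> b = b' \<and> c = c' \<and> d = d'" by simp
qed simp

lemma el_in_F [simp]: "el a b c d \<in> F" by (auto simp: F_def)

lemma F_cases: assumes "x \<in> F" obtains a b c d where "x = el a b c d"
  using assms by (auto simp: F_def)

lemma of_rat_in_F [simp]: "of_rat a \<in> F"
  using el_in_F[of a 0 0 0] by (simp add: el_rat)

lemma u_el: "u = el 0 1 0 0" and v_el: "v = el 0 0 1 0" and uv_el: "u * v = el 0 0 0 1"
  by (simp_all add: el_def)

text \<open>For \<open>s, t = \<plusminus>1\<close> these are the four automorphisms of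
  \<open>F\<close>, sending \<open>u\<close> to \<open>s u\<close> and \<open>v\<close> to
  \<open>t v\<close>. The description determines a value on \<open>F\<close> only, by uniqueness of
  coordinates.\<close>

definition conj :: "rat \<Rightarrow> rat \<Rightarrow> complex \<Rightarrow> complex" where
  "conj s t x = (THE y. \<exists>a b c d. x = el a b c d \<and> y = el a (s * b) (t * c) (s * t * d))"

lemma conj_el: "conj s t (el a b c d) = el a (s * b) (t * c) (s * t * d)"
  unfolding conj_def by (rule the_equality) (auto simp: el_inject)

lemma conj_in_F: "x \<in> F \<Longrightarrow> conj s t x \<in> F"
  by (elim F_cases) (simp add: conj_el)

lemma conj_rat [simp]: "conj s t (of_rat a) = of_rat a"
  using conj_el[of s t a 0 0 0] by (simp add: el_rat)

lemma conj_of_int [simp]: "conj s t (of_int a) = of_int a"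
  using conj_rat[of s t "of_int a"] by simp

lemma conj_of_nat [simp]: "conj s t (of_nat a) = of_nat a"
  using conj_rat[of s t "of_nat a"] by simp

lemma conj_0 [simp]: "conj s t 0 = 0" and conj_1 [simp]: "conj s t 1 = 1"
  using conj_of_nat[of s t 0] conj_of_nat[of s t 1] by simp_all

lemma conj_add: "x \<in> F \<Longrightarrow> y \<in> F \<Longrightarrow> conj s t (x + y) = conj s t x + conj s t y"
  by (elim F_cases) (simp add: conj_el el_add algebra_simps)

lemma conj_mult:
  assumes "s * s = 1" "t * t = 1" "x \<in> F" "y \<in> F"
  shows "conj s t (x * y) = conj s t x * conj s t y"
proof -
  have st: "s * (s * x) = x" "t * (t * x) = x" for x
    using assms(1,2) by (simp_all flip: mult.assoc)
  show ?thesis using assms(3,4)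
    by (elim F_cases) (simp add: conj_el el_mult el_inject algebra_simps st)
qed

lemma conj_conj: "s * s = 1 \<Longrightarrow> t * t = 1 \<Longrightarrow> x \<in> F \<Longrightarrow> conj s t (conj s t x) = x"
  by (elim F_cases) (simp add: conj_el el_inject mult.assoc[symmetric], simp add: mult_ac)

text \<open>The product with the conjugate under \<open>u \<mapsto> - u\<close> lies in
  \<open>\<rat>(v)\<close>; one more conjugation makes it the rational number
  \<open>n\<close>.\<close>

lemma el_inverse: 
  assumes "x \<in> F"
  shows "inverse x \<in> F"
proof (cases "x = 0")
  case True
  then show ?thesis using of_rat_in_F[of 0] by simp
next
  case False
  obtain a b c d where x: "x = el a b c d" using assms by (rule F_cases)
  define x' where "x' = el a (- b) c (- d)"
  define A C where "A = a * a - of_nat p * (b * b) + of_nat (q * r) * (c * c) - of_nat p * of_nat (q * r) * (d * d)"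
    and "C = 2 * (a * c) - 2 * (of_nat p * (b * d))"
  have y: "x * x' = el A 0 C 0"
    unfolding x x'_def el_mult el_inject A_def C_def by (simp add: algebra_simps)
  define n where "n = A * A - of_nat (q * r) * (C * C)"
  have n: "x * x' * el A 0 (- C) 0 = of_rat n"
    unfolding y el_mult el_rat[symmetric] el_inject n_def by (simp add: algebra_simps)
  have "x' \<noteq> 0"
  proof
    assume "x' = 0"
    from el_eq_0[OF this[unfolded x'_def]] have "a = 0" "b = 0" "c = 0" "d = 0" by auto
    with False x show False by (simp add: el_def)
  qed
  with False have "el A 0 C 0 \<noteq> 0" unfolding y[symmetric] by simp
  moreover have "el A 0 C 0 = 0" if "el A 0 (- C) 0 = 0"
    using el_eq_0[OF that] by (simp add: el_def)
  ultimately have "x * x' * el A 0 (- C) 0 \<noteq> 0" using y by auto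
  then have n0: "n \<noteq> 0" unfolding n by simp
  have "x * (x' * el A 0 (- C) 0 * of_rat (inverse n)) = 1"
    using n n0 by (simp add: mult.assoc[symmetric] of_rat_inverse)
  then have "inverse x = x' * el A 0 (- C) 0 * of_rat (inverse n)"
    by (rule inverse_unique)
  also have "\<dots> \<in> F" unfolding x'_def el_rat[symmetric] el_mult by simp
  finally show ?thesis .
qed

lemma algebraic_int_u [simp]: "algebraic_int u" and algebraic_int_v [simp]: "algebraic_int v"
proof -
  have "algebraic_int (u ^ 2)" "algebraic_int (v ^ 2)"
    unfolding power2_eq_square u_square v_square by (simp_all del: of_nat_mult)
  then show "algebraic_int u" "algebraic_int v" unfolding algebraic_int_square_iff .
qed

sublocale algebraic_subfield F
proof
  show "1 \<in> F" using of_rat_in_F[of 1] by simp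
  show "x + y \<in> F" "x * y \<in> F" if "x \<in> F" "y \<in> F" for x y
    using that by (auto elim!: F_cases simp: el_add el_mult)
  show "- x \<in> F" if "x \<in> F" for x using that by (auto elim!: F_cases simp: el_minus)
  show "inverse x \<in> F" if "x \<in> F" for x using el_inverse[OF that] .
  have rat: "\<exists>n>0. algebraic_int (of_nat n * of_rat a :: complex)" for a
  proof -
    obtain k l where kl: "a = of_int k / of_int l" "l > 0"
      by (metis Fract_of_int_quotient quotient_of_div quotient_of_denom_pos surj_pair)
    have "of_nat (nat l) * (of_rat a :: complex) = of_int k"
      using kl(2) by (simp add: kl(1) of_rat_divide)
    then show ?thesis using kl(2) by (intro exI[of _ "nat l"]) simp
  qed
  have uv: "\<exists>n>0. algebraic_int (of_nat n * u)" "\<exists>n>0. algebraic_int (of_nat n * v)"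
    by (auto intro!: exI[of _ 1])
  show "\<exists>n>0. algebraic_int (of_nat n * x)" if "x \<in> F" for x
  proof -
    obtain a b c d where x: "x = el a b c d" using \<open>x \<in> F\<close> by (rule F_cases)
    show ?thesis unfolding x el_def
      by (intro algebraic_multiple_closed rat uv)
  qed
qed

lemma u_in_O [simp]: "u \<in> \<O>" and v_in_O [simp]: "v \<in> \<O>"
  using el_in_F[of 0 1 0 0] el_in_F[of 0 0 1 0] by (simp_all only: O_iff flip: u_el v_el) simp_all

lemma rat_adjoin_eq_F: "rat_adjoin {u, v} = F"
proof -
  interpret C: field "complex_field" by (rule field_from_type_algebra)
  let ?G = "generate_field complex_field {u, v}"
  have add: "x \<in> ?G \<Longrightarrow> y \<in> ?G \<Longrightarrow> x + y \<in> ?G" and mult: "x \<in> ?G \<Longrightarrow> y \<in> ?G \<Longrightarrow> x * y \<in> ?G" for x y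
    using generate_field.eng_add[of x complex_field "{u, v}" y] generate_field.eng_mult[of x complex_field "{u, v}" y]
    by (simp_all add: ring_of_type_algebra_def)
  have one: "1 \<in> ?G" using generate_field.one[of complex_field "{u, v}"] by (simp add: ring_of_type_algebra_def)
  have minus_eq: "\<ominus>\<^bsub>complex_field\<^esub> x = - x" for x
    by (rule C.minus_equality) (simp_all add: ring_of_type_algebra_def)
  have inv_eq: "inv\<^bsub>complex_field\<^esub> x = inverse x" if "x \<noteq> 0" for x
    by (rule C.comm_inv_char) (use that in \<open>simp_all add: ring_of_type_algebra_def\<close>)
  have neg: "- x \<in> ?G" if "x \<in> ?G" for x
    using generate_field.a_inv[OF that] by (simp add: minus_eq)
  have inv: "inverse x \<in> ?G" if "x \<in> ?G" "x \<noteq> 0" for x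
    using generate_field.m_inv[OF that(1)] that(2) unfolding inv_eq[OF that(2)]
    by (simp add: ring_of_type_algebra_def)
  have zero: "0 \<in> ?G" using add[OF one neg[OF one]] by simp
  have nat: "of_nat n \<in> ?G" for n by (induction n) (auto intro: zero one add)
  have int: "of_int n \<in> ?G" for n by (cases n) (auto intro: nat neg simp del: of_nat_Suc)
  have rat: "of_rat a \<in> ?G" for a
  proof -
    obtain k l where kl: "a = of_int k / of_int l" "l > 0"
      by (metis Fract_of_int_quotient quotient_of_div quotient_of_denom_pos surj_pair)
    have "of_rat a = of_int k * inverse (of_int l :: complex)"
      unfolding kl(1) by (simp add: of_rat_divide divide_inverse[symmetric])
    then show ?thesis using mult[OF int inv[OF int]] kl(2) by simp
  qed
  have "u \<in> ?G" "v \<in> ?G" by (auto intro: generate_field.incl)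
  then have "el a b c d \<in> ?G" for a b c d
    unfolding el_def by (intro add mult rat)
  then have "F \<subseteq> ?G" by (auto simp: F_def)
  moreover have "x \<in> F" if "x \<in> ?G" for x
    using that
  proof (induction rule: generate_field.induct)
    case (m_inv h)
    then show ?case using inv_eq[of h] by (auto simp: ring_of_type_algebra_def K_inverse)
  qed (auto simp: ring_of_type_algebra_def minus_eq[unfolded ring_of_type_algebra_def] u_el v_el
      intro: K_add K_mult K_uminus)
  ultimately show ?thesis by (auto simp: rat_adjoin_def)
qed

section \<open>Integers of \<open>F\<close> and units of \<open>\<rat>(u)\<close>\<close>

lemma conj_O:
  assumes "s * s = 1" "t * t = 1" "x \<in> \<O>"
  shows "conj s t x \<in> \<O>"
proof -
  have x: "x \<in> F" "algebraic_int x" using assms(3) by (auto simp: O_iff)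
  obtain P where P: "poly (map_poly of_int P) x = 0" "lead_coeff P = 1"
    using x(2) unfolding algebraic_int_altdef_ipoly by auto
  have "poly (map_poly of_int f) x \<in> F \<and>
      conj s t (poly (map_poly of_int f) x) = poly (map_poly of_int f) (conj s t x)" for f :: "int poly"
    by (induction f) (auto simp: map_poly_pCons conj_add conj_mult assms(1,2) x(1) K_add K_mult)
  from this[of P] have "poly (map_poly of_int P) (conj s t x) = 0" by (simp add: P)
  then have "algebraic_int (conj s t x)" using P(2) unfolding algebraic_int_altdef_ipoly by blast
  then show ?thesis using conj_in_F[OF x(1)] by (simp add: O_iff)
qed

lemma rat_in_O_iff: "of_rat a \<in> \<O> \<longleftrightarrow> a \<in> \<int>"
proof
  assume "of_rat a \<in> \<O>"
  then have "of_rat a \<in> (\<int> :: complex set)" by (intro rational_algebraic_int_is_int) (auto simp: O_iff)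
  then obtain k where "of_rat a = (of_int k :: complex)" by (auto elim: Ints_cases)
  then have "of_rat a = (of_rat (of_int k) :: complex)" by simp
  then have "a = of_int k" by (simp only: of_rat_eq_iff)
  then show "a \<in> \<int>" by simp
qed (auto elim: Ints_cases)

lemma el_scaleR: "of_rat k * el a b c d = el (k * a) (k * b) (k * c) (k * d)"
  by (simp add: el_def of_rat_mult algebra_simps)

lemma trace_conj:
  "el a b c d + conj (- 1) 1 (el a b c d) + conj 1 (- 1) (el a b c d) + conj (- 1) (- 1) (el a b c d) = of_rat (4 * a)"
  by (simp add: conj_el el_add flip: el_rat)

lemma trace_in_O: "el a b c d \<in> \<O> \<Longrightarrow> of_rat (4 * a) \<in> \<O>"
  unfolding trace_conj[symmetric, of a b c d] by (intro O_add conj_O) auto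

text \<open>Signed sums of the four conjugates isolate one term, such as \<open>4 b u\<close>; its
  square \<open>p (4 b)^2\<close> is an integer and \<open>p\<close> is squarefree. This bound on
  denominators serves in place of an integral basis.\<close>

lemma O_coordinates:
  assumes "el a b c d \<in> \<O>"
  shows "4 * a \<in> \<int>" "4 * b \<in> \<int>" "4 * c \<in> \<int>" "4 * d \<in> \<int>"
proof -
  let ?x = "el a b c d"
  show "4 * a \<in> \<int>" using trace_in_O[OF assms] by (simp add: rat_in_O_iff)
  have *: "y \<in> \<int>" if "w * w = of_nat N" "squarefree (int N)" "of_rat y * w \<in> \<O>" for y w N
  proof -
    have "(of_rat y * w) * (of_rat y * w) \<in> \<O>" using O_mult[OF that(3) that(3)] .
    also have "(of_rat y * w) * (of_rat y * w) = of_rat y * of_rat y * (w * w)" by simp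
    also have "\<dots> = of_rat (of_int (int N) * y ^ 2)"
      unfolding that(1) by (simp add: of_rat_mult power2_eq_square of_rat_power)
    finally show ?thesis using rat_int_if_squarefree_mult_square[OF that(2)] by (simp only: rat_in_O_iff)
  qed
  have conj: "conj (- 1) 1 ?x \<in> \<O>" "conj 1 (- 1) ?x \<in> \<O>" "conj (- 1) (- 1) ?x \<in> \<O>"
    using assms by (auto intro!: conj_O)
  have "?x - conj (- 1) 1 ?x + conj 1 (- 1) ?x - conj (- 1) (- 1) ?x \<in> \<O>"
    using assms conj by (intro O_add O_diff)
  also have "?x - conj (- 1) 1 ?x + conj 1 (- 1) ?x - conj (- 1) (- 1) ?x = of_rat (4 * b) * u"
    unfolding conj_el unfolding el_def by (simp add: of_rat_mult of_rat_minus algebra_simps)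
  finally show "4 * b \<in> \<int>" using *[OF u_square squarefree_p] by blast
  have "?x + conj (- 1) 1 ?x - conj 1 (- 1) ?x - conj (- 1) (- 1) ?x \<in> \<O>"
    using assms conj by (intro O_add O_diff)
  also have "?x + conj (- 1) 1 ?x - conj 1 (- 1) ?x - conj (- 1) (- 1) ?x = of_rat (4 * c) * v"
    unfolding conj_el unfolding el_def by (simp add: of_rat_mult of_rat_minus algebra_simps)
  finally show "4 * c \<in> \<int>" using *[OF v_square squarefree_qr] by blast
  have "?x - conj (- 1) 1 ?x - conj 1 (- 1) ?x + conj (- 1) (- 1) ?x \<in> \<O>"
    using assms conj by (intro O_add O_diff)
  also have "?x - conj (- 1) 1 ?x - conj 1 (- 1) ?x + conj (- 1) (- 1) ?x = of_rat (4 * d) * (u * v)"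
    unfolding conj_el unfolding el_def by (simp add: of_rat_mult of_rat_minus algebra_simps)
  finally have "of_rat (4 * d) * (u * v) \<in> \<O>" .
  moreover have "(u * v) * (u * v) = of_nat (p * (q * r))"
  proof -
    have "(u * v) * (u * v) = (u * u) * (v * v)" by (simp add: mult_ac)
    then show ?thesis by (simp add: u_square v_square)
  qed
  ultimately show "4 * d \<in> \<int>" using *[OF _ squarefree_pqr] by blast
qed

text \<open>Elements \<open>el e f 0 0\<close> form the subfield \<open>\<rat>(\<surd>p)\<close>, whose integers are \<open>\<int>[\<surd>p]\<close>
  because \<open>p \<equiv> 3\<close> modulo 4; no unit has norm \<open>- 1\<close>.\<close>

lemma quadratic_subfield_unit:
  assumes "el e f 0 0 \<in> \<O>" "inverse (el e f 0 0) \<in> \<O>" "el e f 0 0 \<noteq> 0"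
  shows "\<exists>e' f'. e = of_int e' \<and> f = of_int f' \<and> e' ^ 2 - int p * f' ^ 2 = 1"
proof -
  let ?n = "el e f 0 0"
  have inF: "?n \<in> F" "inverse ?n \<in> F" using assms(2) by (auto simp: O_iff)
  \<comment> \<open>The norm of a unit is an integer with integral inverse, hence
    \<open>\<plusminus>1\<close>.\<close>
  define N where "N = e * e - of_nat p * (f * f)"
  have N: "?n * conj (- 1) 1 ?n = of_rat N"
    unfolding conj_el el_mult el_rat[symmetric] el_inject N_def by (simp add: algebra_simps)
  have conj_inv: "conj (- 1) 1 ?n * conj (- 1) 1 (inverse ?n) = 1"
    using conj_mult[of "- 1" 1 ?n "inverse ?n"] inF assms(3) by simp
  have conjO: "conj (- 1) 1 ?n \<in> \<O>" "conj (- 1) 1 (inverse ?n) \<in> \<O>"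
    using assms by (auto intro!: conj_O)
  have "of_rat N \<in> \<O>" unfolding N[symmetric] by (intro O_mult assms conjO)
  then have NZ: "N \<in> \<int>" by (simp add: rat_in_O_iff)
  have "of_rat N * (inverse ?n * conj (- 1) 1 (inverse ?n)) = 1"
    unfolding N[symmetric] using conj_inv assms(3) by (simp add: field_simps)
  then have inv: "inverse (of_rat N) = inverse ?n * conj (- 1) 1 (inverse ?n)" and N0: "N \<noteq> 0"
    by (auto intro: inverse_unique)
  have "of_rat (inverse N) \<in> \<O>" unfolding of_rat_inverse inv by (intro O_mult assms conjO)
  then have "inverse N \<in> \<int>" by (simp only: rat_in_O_iff)
  with NZ obtain m m' where m: "N = of_int m" "inverse N = of_int m'" by (auto elim!: Ints_cases)
  then have "of_int (m * m') = (of_int 1 :: rat)" using N0 by (simp flip: m)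
  then have "m * m' = 1" by (simp only: of_int_eq_iff)
  then have m1: "m = 1 \<or> m = - 1" by (auto simp: zmult_eq_1_iff)
  have "?n + conj (- 1) 1 ?n \<in> \<O>" by (intro O_add assms conjO)
  also have "?n + conj (- 1) 1 ?n = of_rat (2 * e)"
    unfolding conj_el el_add el_rat[symmetric] el_inject by simp
  finally have "2 * e \<in> \<int>" by (simp only: rat_in_O_iff)
  then obtain E where E: "2 * e = of_int E" by (auto elim: Ints_cases)
  have "(?n - conj (- 1) 1 ?n) ^ 2 \<in> \<O>" by (intro O_power O_diff assms conjO)
  also have "(?n - conj (- 1) 1 ?n) ^ 2 = (of_rat (2 * f) * u) * (of_rat (2 * f) * u)"
    unfolding conj_el unfolding el_def power2_eq_square by (simp add: of_rat_minus of_rat_mult)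
  also have "\<dots> = of_rat (2 * f) * of_rat (2 * f) * (u * u)" by simp
  also have "\<dots> = of_rat (of_int (int p) * (2 * f) ^ 2)"
    unfolding u_square by (simp add: of_rat_mult power2_eq_square)
  finally have "2 * f \<in> \<int>"
    using rat_int_if_squarefree_mult_square[OF squarefree_p] by (simp only: rat_in_O_iff)
  then obtain G where G: "2 * f = of_int G" by (auto elim: Ints_cases)
  have "(2 * e) ^ 2 - of_nat p * (2 * f) ^ 2 = 4 * N"
    by (simp add: N_def power2_eq_square algebra_simps)
  then have "of_int (E ^ 2 - int p * G ^ 2) = (of_int (4 * m) :: rat)"
    unfolding E G m by simp
  then have EG: "E ^ 2 - int p * G ^ 2 = 4 * m" by (simp only: of_int_eq_iff)
  have "p mod 4 = 3" using p_mod_4 by (simp add: unique_euclidean_semiring_class.cong_def)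
  then have "int p mod 4 = 3" by presburger
  then obtain P where P: "int p = 4 * P + 3" by (metis mult_div_mod_eq)
  \<comment> \<open>As \<open>p \<equiv> - 1\<close> modulo 4, the norm equation for the doubled
    coordinates makes \<open>E^2 + G^2\<close> divisible by 4, which forces both to be even.\<close>
  have sum4: "x ^ 2 + y ^ 2 = 4 * (m + (P + 1) * y ^ 2)" if "x ^ 2 - int p * y ^ 2 = 4 * m" for x y m
    using that unfolding P by (simp add: algebra_simps)
  have "(E ^ 2 + G ^ 2) mod 4 = 0" unfolding sum4[OF EG] by simp
  then have "(E ^ 2 mod 4 + G ^ 2 mod 4) mod 4 = 0" by (simp add: mod_add_eq)
  with square_mod_4[of E] square_mod_4[of G] have "even E" "even G" by auto
  then obtain e' f' where ef: "E = 2 * e'" "G = 2 * f'" by (auto elim!: evenE)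
  have eq: "e' ^ 2 - int p * f' ^ 2 = m" using EG by (simp add: ef power2_eq_square)
  have "m \<noteq> - 1"
  proof
    assume "m = - 1"
    then have "e' ^ 2 + f' ^ 2 = 3 + 4 * ((P + 1) * f' ^ 2 - 1)"
      using eq unfolding P by (simp add: algebra_simps)
    then have "(e' ^ 2 + f' ^ 2) mod 4 = 3" by (simp only: mod_mult_self2) simp
    then have "(e' ^ 2 mod 4 + f' ^ 2 mod 4) mod 4 = 3" by (simp add: mod_add_eq)
    with square_mod_4[of e'] square_mod_4[of f'] show False by auto
  qed
  with m1 eq have "e' ^ 2 - int p * f' ^ 2 = 1" by simp
  moreover have "e = of_int e'" "f = of_int f'" using E G by (simp_all add: ef)
  ultimately show ?thesis by blast
qed

lemma r_gt_2: "r > 2" and odd_r: "odd r" and odd_p: "odd p" and odd_q: "odd q"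
proof -
  have "p mod 4 = 3" "q mod 4 = 3" "r mod 8 = 1"
    using p_mod_4 q_mod_4 r_mod_8 by (simp_all add: unique_euclidean_semiring_class.cong_def)
  then show "odd r" "odd p" "odd q" by presburger+
  moreover have "r > 1" using prime_r by (rule prime_gt_1_nat)
  ultimately show "r > 2" by (cases "r = 2") auto
qed

text \<open>Write \<open>y = z * v / r\<close>, so that \<open>y\<^sup>2 = q * z\<^sup>2 / r\<close>. The relative norm of \<open>y\<close> to
  \<open>\<rat>(\<surd>p)\<close> is \<open>- q\<close> times a unit \<open>n\<close>; since \<open>n\<close> is a square modulo \<open>r\<close>, so is \<open>q\<close>.\<close>

lemma no_square_root_of_r_times_unit:
  assumes z: "z \<in> F" "z \<noteq> 0" "z ^ 2 / of_nat r \<in> \<O>" "of_nat r / z ^ 2 \<in> \<O>"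
  shows False
proof -
  have r0: "(of_nat r :: complex) \<noteq> 0" and q0: "(of_nat q :: complex) \<noteq> 0"
    using prime_gt_0_nat prime_r prime_q by auto
  define y where "y = z * v / of_nat r"
  define w where "w = z ^ 2 / of_nat r"
  have vF: "v \<in> F" by (simp add: v_el)
  have yF: "y \<in> F" unfolding y_def by (intro K_divide K_mult z vF) simp
  have wO: "w \<in> \<O>" "inverse w \<in> \<O>" using z by (simp_all add: w_def)
  then have wF: "w \<in> F" "inverse w \<in> F" by (auto simp: O_iff)
  have w0: "w \<noteq> 0" using z(2) r0 by (simp add: w_def)
  have yw: "y ^ 2 = of_nat q * w"
  proof -
    have "y ^ 2 = z ^ 2 * (v * v) / of_nat r ^ 2" by (simp add: y_def power2_eq_square)
    also have "\<dots> = of_nat q * w" unfolding v_square w_def using r0 by (simp add: power2_eq_square)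
    finally show ?thesis .
  qed
  then have "y ^ 2 \<in> \<O>" using wO by (simp add: O_mult)
  then have yO: "y \<in> \<O>" using O_square_iff[OF yF] by simp
  obtain a b c d where y: "y = el a b c d" using yF by (rule F_cases)
  \<comment> \<open>The relative norm of \<open>y\<close> is
    \<open>(a + b u)^2 - qr (c + d u)^2\<close>; dividing by \<open>- q\<close> isolates the
    expected unit.\<close>
  define e f where "e = - (a * a + of_nat p * (b * b) - of_nat (q * r) * (c * c + of_nat p * (d * d))) / of_nat q"
    and "f = - (2 * (a * b) - 2 * (of_nat (q * r) * (c * d))) / of_nat q"
  have qr0: "(of_nat q :: rat) \<noteq> 0" using prime_gt_0_nat[OF prime_q] by simp
  have norm: "y * conj 1 (- 1) y = - of_nat q * el e f 0 0"
  proof -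
    have "y * conj 1 (- 1) y = el (- of_nat q * e) (- of_nat q * f) 0 0"
      unfolding y conj_el el_mult el_inject e_def f_def using qr0 by (simp add: algebra_simps)
    also have "\<dots> = of_rat (- of_nat q) * el e f 0 0" by (simp add: el_scaleR)
    finally show ?thesis by (simp add: of_rat_minus)
  qed
  \<comment> \<open>The formulas for \<open>e\<close> and \<open>f\<close> divide by
    \<open>q\<close>, so integrality is read off the square, which is the relative norm of the unit
    \<open>w\<close>.\<close>
  have sq: "el e f 0 0 ^ 2 = w * conj 1 (- 1) w"
  proof -
    have "of_nat q ^ 2 * el e f 0 0 ^ 2 = (y * conj 1 (- 1) y) ^ 2"
      unfolding norm by (simp add: power_mult_distrib)
    also have "\<dots> = y ^ 2 * conj 1 (- 1) (y ^ 2)"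
      using yF by (simp add: power2_eq_square conj_mult)
    also have "\<dots> = of_nat q ^ 2 * (w * conj 1 (- 1) w)"
      unfolding yw using wF by (simp add: conj_mult power2_eq_square)
    finally show ?thesis using q0 by simp
  qed
  have conj_inv: "conj 1 (- 1) w * conj 1 (- 1) (inverse w) = 1"
    using conj_mult[of 1 "- 1" w "inverse w"] wF w0 by simp
  have conj_wO: "conj 1 (- 1) w \<in> \<O>" "conj 1 (- 1) (inverse w) \<in> \<O>" using wO by (auto intro: conj_O)
  have "el e f 0 0 ^ 2 \<in> \<O>" unfolding sq by (intro O_mult wO conj_wO)
  then have nO: "el e f 0 0 \<in> \<O>" using O_square_iff by simp
  have "el e f 0 0 ^ 2 * (inverse w * conj 1 (- 1) (inverse w)) = 1"
    unfolding sq using conj_inv w0 by (simp add: field_simps)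
  then have inv: "inverse (el e f 0 0 ^ 2) = inverse w * conj 1 (- 1) (inverse w)" and n0: "el e f 0 0 \<noteq> 0"
    by (auto intro: inverse_unique)
  have "inverse (el e f 0 0) ^ 2 \<in> \<O>" unfolding power_inverse inv by (intro O_mult wO conj_wO)
  then have "inverse (el e f 0 0) \<in> \<O>" using O_square_iff[OF K_inverse[OF el_in_F]] by simp
  from quadratic_subfield_unit[OF nO this n0] obtain e' f' where
    ef: "e = of_int e'" "f = of_int f'" "e' ^ 2 - int p * f' ^ 2 = 1" by blast
  obtain A B C D where ABCD: "4 * a = of_int A" "4 * b = of_int B" "4 * c = of_int C" "4 * d = of_int D"
    using O_coordinates[OF yO[unfolded y]] by (auto elim!: Ints_cases)
  have 1: "A ^ 2 + int p * B ^ 2 - int (q * r) * (C ^ 2 + int p * D ^ 2) = - 16 * int q * e'"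
  proof -
    have "(4 * a) ^ 2 + of_nat p * (4 * b) ^ 2 - of_nat (q * r) * ((4 * c) ^ 2 + of_nat p * (4 * d) ^ 2)
        = - 16 * of_nat q * e"
      unfolding e_def using qr0 by (simp add: power2_eq_square algebra_simps)
    then have "of_int (A ^ 2 + int p * B ^ 2 - int (q * r) * (C ^ 2 + int p * D ^ 2)) = (of_int (- 16 * int q * e') :: rat)"
      unfolding ABCD ef by simp
    then show ?thesis by (simp only: of_int_eq_iff)
  qed
  have 2: "2 * A * B - int (q * r) * (2 * C * D) = - 16 * int q * f'"
  proof -
    have "2 * (4 * a) * (4 * b) - of_nat (q * r) * (2 * (4 * c) * (4 * d)) = - 16 * of_nat q * f"
      unfolding f_def using qr0 by (simp add: algebra_simps)
    then have "of_int (2 * A * B - int (q * r) * (2 * C * D)) = (of_int (- 16 * int q * f') :: rat)"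
      unfolding ABCD ef by simp
    then show ?thesis by (simp only: of_int_eq_iff)
  qed
  have "QuadRes (int r) (int p)"
    using Legendre_p by (simp add: Legendre_def split: if_splits)
  then obtain t where t: "[t ^ 2 = int p] (mod int r)" by (auto simp: QuadRes_def)
  obtain i s where i: "[i ^ 2 = - 1] (mod int r)" and s: "[s ^ 2 = 2] (mod int r)"
    using cong_square_minus_one_and_two[OF prime_r r_mod_8 Legendre_q] by blast
  obtain k where k: "[k ^ 2 = e' + f' * t] (mod int r)"
    using norm_one_unit_square_mod[OF prime_p odd_p prime_r odd_r _ t i s ef(3)] distinct by auto
  have pt: "int r dvd t ^ 2 - int p" using t by (simp add: cong_iff_dvd_diff)
  \<comment> \<open>Reduction modulo \<open>r\<close> by \<open>u \<mapsto> t\<close>,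
    \<open>v \<mapsto> 0\<close>: all terms with \<open>C\<close> and \<open>D\<close> carry
    \<open>v * v = q * r\<close>, so the norm of \<open>4 * y\<close> becomes the square of
    \<open>A + B * t\<close>.\<close>
  have "[(A + B * t) ^ 2 = - 16 * int q * (e' + f' * t)] (mod int r)"
  proof -
    have "(A + B * t) ^ 2 - (- 16 * int q * e' + - 16 * int q * f' * t) =
      B ^ 2 * (t ^ 2 - int p) + int r * (int q * (C ^ 2 + int p * D ^ 2) + int q * (2 * C * D) * t)"
      unfolding 1[symmetric] 2[symmetric] by (simp add: power2_eq_square algebra_simps)
    also have "int r dvd \<dots>" by (rule dvd_add[OF dvd_mult[OF pt] dvd_triv_left])
    finally show ?thesis by (simp add: cong_iff_dvd_diff algebra_simps)
  qed
  also have "[- 16 * int q * (e' + f' * t) = i ^ 2 * 16 * int q * k ^ 2] (mod int r)"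
    using cong_mult[OF cong_mult[OF cong_sym[OF i] cong_refl[of "16 * int q"]] cong_sym[OF k]]
    by (simp add: mult.assoc)
  finally have main: "[(A + B * t) ^ 2 = (4 * i * k) ^ 2 * int q] (mod int r)"
    by (simp add: power_mult_distrib mult_ac)
  \<comment> \<open>\<open>k\<close> is invertible modulo \<open>r\<close> because
    \<open>k^2\<close> is congruent to the image of a unit of norm 1.\<close>
  have "Rings.coprime (4 * i * k) (int r)"
  proof -
    have "[k ^ 2 * (e' - f' * t) = (e' + f' * t) * (e' - f' * t)] (mod int r)"
      by (intro cong_mult k cong_refl)
    also have "[(e' + f' * t) * (e' - f' * t) = 1] (mod int r)"
    proof -
      have "(e' + f' * t) * (e' - f' * t) - 1 = - (f' ^ 2 * (t ^ 2 - int p))"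
        using ef(3) by (simp add: power2_eq_square algebra_simps)
      also have "int r dvd \<dots>" using pt by simp
      finally show ?thesis by (simp add: cong_iff_dvd_diff)
    qed
    finally have k1: "[k ^ 2 * (e' - f' * t) = 1] (mod int r)" .
    have "\<not> int r dvd k"
    proof
      assume "int r dvd k"
      then have "int r dvd k ^ 2 * (e' - f' * t)" by (simp add: power2_eq_square)
      then have "int r dvd 1" using k1 cong_dvd_iff by blast
      then show False using r_gt_2 by simp
    qed
    moreover have "\<not> int r dvd i"
    proof
      assume "int r dvd i"
      then have "int r dvd i ^ 2" by (simp add: power2_eq_square)
      then have "int r dvd - 1" using i cong_dvd_iff by blast
      then show False using r_gt_2 by simp
    qed
    moreover have "\<not> int r dvd 4"
    proof
      assume "int r dvd 4"
      then have "r dvd 4" by (metis int_dvd_int_iff of_nat_numeral)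
      then have "r dvd 2 ^ 2" by simp
      then have "r dvd 2" using prime_r prime_dvd_power by blast
      then show False using r_gt_2 by (auto dest: dvd_imp_le)
    qed
    ultimately have "\<not> int r dvd 4 * i * k"
      using prime_r by (simp add: prime_dvd_mult_iff)
    then show ?thesis using prime_r prime_imp_coprime[of "int r" "4 * i * k"] coprime_commute by auto
  qed
  then obtain x where x: "[4 * i * k * x = 1] (mod int r)" using cong_solve_coprime_int by blast
  have "[(x * (A + B * t)) ^ 2 = x ^ 2 * ((4 * i * k) ^ 2 * int q)] (mod int r)"
    unfolding power_mult_distrib[of x "A + B * t"] by (intro cong_mult main cong_refl)
  also have "x ^ 2 * ((4 * i * k) ^ 2 * int q) = (4 * i * k * x) ^ 2 * int q"
    by (simp add: power_mult_distrib)
  also have "[(4 * i * k * x) ^ 2 * int q = 1 ^ 2 * int q] (mod int r)"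
    by (intro cong_mult cong_pow x cong_refl)
  finally have "QuadRes (int r) (int q)" by (auto simp: QuadRes_def)
  then show False using Legendre_q by (simp add: Legendre_def split: if_splits)
qed

section \<open>Divisibility by \<open>r\<close> and the characteristic ideals at \<open>r\<close>
  and \<open>r - 1\<close>\<close>

abbreviation dv :: "complex \<Rightarrow> bool" where "dv x \<equiv> x / of_nat r \<in> \<O>"

lemma pqr_nonzero [simp]: "p \<noteq> 0" "q \<noteq> 0" "r \<noteq> 0"
  using prime_gt_0_nat prime_r prime_q prime_p by auto

lemma dv_add: "dv x \<Longrightarrow> dv y \<Longrightarrow> dv (x + y)"
  by (simp add: add_divide_distrib O_add)

lemma dv_mult: "dv x \<Longrightarrow> y \<in> \<O> \<Longrightarrow> dv (x * y)"
  using O_mult[of "x / of_nat r" y] by simp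

lemma dv_of_int: "int r dvd k \<Longrightarrow> dv (of_int k)"
  by (elim dvdE) simp

lemma dv_frobenius: "x \<in> \<O> \<Longrightarrow> y \<in> \<O> \<Longrightarrow> dv ((x + y) ^ r - (x ^ r + y ^ r))"
  by (rule frobenius_divides[OF prime_r])

lemma fermat_int: "[a ^ r = a] (mod int r)"
proof -
  define b where "b = nat (a mod int r)"
  have b: "[a = int b] (mod int r)"
    using r_gt_2 by (simp add: b_def unique_euclidean_semiring_class.cong_def)
  have "[b ^ r = b] (mod r)"
  proof (cases "r dvd b")
    case True
    then have "r dvd b ^ r" using r_gt_2 by (simp add: dvd_power_iff_le dvd_trans[OF _ dvd_power])
    with True show ?thesis by (simp add: unique_euclidean_semiring_class.cong_def)
  next
    case False
    have "[b * b ^ (r - 1) = b * 1] (mod r)"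
      using fermat_theorem[OF prime_r False] by (intro cong_mult cong_refl)
    moreover have "b * b ^ (r - 1) = b ^ r" using r_gt_2 by (simp flip: power_Suc)
    ultimately show ?thesis by simp
  qed
  then have "[int b ^ r = int b] (mod int r)" by (metis cong_int_iff of_nat_power)
  with b show ?thesis by (meson cong_pow cong_sym cong_trans)
qed

text \<open>Because \<open>u ^ r = u * p ^ ((r - 1) div 2)\<close>, this says that Frobenius fixes
  \<open>u\<close> modulo \<open>r\<close>.\<close>

lemma p_power_cong_1: "[int p ^ ((r - 1) div 2) = 1] (mod int r)"
  using euler_criterion[OF prime_r r_gt_2, of "int p"] Legendre_p by (simp add: cong_sym)

lemma r_half: "r = Suc (2 * ((r - 1) div 2))"
  using odd_r r_gt_2 by presburger

text \<open>Both primes of \<open>F\<close> above \<open>r\<close> have residue field of size \<open>r\<close>, and the square of their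
  product is \<open>r\<O>\<close>.\<close>

lemma r_divides_square_of_frobenius:
  assumes "x \<in> \<O>"
  shows "dv ((x ^ r - x) ^ 2)"
proof -
  obtain a b c d where x: "x = el a b c d" using O_in_K[OF assms] by (rule F_cases)
  obtain A B C D where ABCD: "4 * a = of_int A" "4 * b = of_int B" "4 * c = of_int C" "4 * d = of_int D"
    using O_coordinates[OF assms[unfolded x]] by (auto elim!: Ints_cases)
  \<comment> \<open>\<open>\<alpha>\<close> and \<open>\<beta>\<close> are fixed by Frobenius modulo
    \<open>r\<close>, while \<open>\<gamma>\<close>, the part containing \<open>v\<close>, has
    square divisible by \<open>r\<close>.\<close>
  define \<alpha> \<beta> \<gamma> where "\<alpha> = (of_int A :: complex)" and "\<beta> = of_int B * u" and "\<gamma> = (of_int C + of_int D * u) * v"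
  have inO: "\<alpha> \<in> \<O>" "\<beta> \<in> \<O>" "\<gamma> \<in> \<O>" by (auto simp: \<alpha>_def \<beta>_def \<gamma>_def intro!: O_mult O_add)
  have x4: "4 * x = \<alpha> + \<beta> + \<gamma>"
  proof -
    have "of_rat 4 * x = el (of_int A) (of_int B) (of_int C) (of_int D)"
      unfolding x el_scaleR ABCD ..
    then show ?thesis by (simp add: el_def \<alpha>_def \<beta>_def \<gamma>_def algebra_simps)
  qed
  have \<gamma>2: "dv (\<gamma> ^ 2)"
  proof -
    have "\<gamma> ^ 2 = (of_int C + of_int D * u) ^ 2 * (v * v)" by (simp add: \<gamma>_def power2_eq_square)
    then have "\<gamma> ^ 2 / of_nat r = (of_int C + of_int D * u) ^ 2 * of_nat q" unfolding v_square by simp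
    also have "\<dots> \<in> \<O>" by (intro O_mult O_power O_add) auto
    finally show ?thesis .
  qed
  have "\<gamma> ^ (2 + (r - 2)) = \<gamma> ^ 2 * \<gamma> ^ (r - 2)" by (rule power_add)
  moreover have "2 + (r - 2) = r" using r_gt_2 by simp
  ultimately have "\<gamma> ^ r = \<gamma> ^ 2 * \<gamma> ^ (r - 2)" by metis
  then have \<gamma>r: "dv (\<gamma> ^ r)" using dv_mult[OF \<gamma>2 O_power[OF inO(3)]] by simp
  have \<alpha>r: "dv (\<alpha> ^ r - \<alpha>)"
    using dv_of_int[of "A ^ r - A"] fermat_int[of A] by (simp add: \<alpha>_def cong_iff_dvd_diff)
  have \<beta>r: "dv (\<beta> ^ r - \<beta>)"
  proof -
    define h where "h = (r - 1) div 2"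
    have "u ^ r = u * (u * u) ^ h" unfolding h_def by (subst r_half) (simp add: power_mult power2_eq_square)
    then have eq: "\<beta> ^ r - \<beta> = of_int (B ^ r * int p ^ h - B) * u"
      by (simp add: \<beta>_def power_mult_distrib u_square algebra_simps)
    have "[B ^ r * int p ^ h = B * 1] (mod int r)"
      unfolding h_def by (intro cong_mult fermat_int p_power_cong_1)
    then have "int r dvd B ^ r * int p ^ h - B" by (simp add: cong_iff_dvd_diff)
    then show ?thesis unfolding eq by (intro dv_mult dv_of_int u_in_O)
  qed
  have "dv ((4 * x) ^ r - (\<alpha> + \<beta>))"
  proof -
    have "(4 * x) ^ r - (\<alpha> + \<beta>) = (((\<alpha> + \<beta>) + \<gamma>) ^ r - ((\<alpha> + \<beta>) ^ r + \<gamma> ^ r))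
       + ((\<alpha> + \<beta>) ^ r - (\<alpha> ^ r + \<beta> ^ r)) + (\<alpha> ^ r - \<alpha>) + (\<beta> ^ r - \<beta>) + \<gamma> ^ r"
      unfolding x4 by simp
    then show ?thesis using dv_frobenius[OF O_add[OF inO(1,2)] inO(3)] dv_frobenius[OF inO(1,2)] \<alpha>r \<beta>r \<gamma>r
      by (simp only: dv_add)
  qed
  \<comment> \<open>Fermat replaces \<open>(4 x) ^ r\<close> by \<open>4 x ^ r\<close>.\<close>
  moreover have "dv (of_int (4 - 4 ^ r) * x ^ r)"
    using fermat_int[of 4] by (intro dv_mult dv_of_int O_power assms) (simp add: cong_iff_dvd_diff cong_sym_eq dvd_diff_commute)
  ultimately have "dv (((4 * x) ^ r - (\<alpha> + \<beta>)) + of_int (4 - 4 ^ r) * x ^ r)" by (rule dv_add)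
  also have "((4 * x) ^ r - (\<alpha> + \<beta>)) + of_int (4 - 4 ^ r) * x ^ r = 4 * (x ^ r - x) + \<gamma>"
  proof -
    have "\<alpha> + \<beta> = 4 * x - \<gamma>" using x4 by simp
    then show ?thesis by (simp add: power_mult_distrib algebra_simps)
  qed
  finally have "dv (4 * (x ^ r - x) + \<gamma>)" .
  then obtain w where w: "w \<in> \<O>" "4 * (x ^ r - x) + \<gamma> = of_nat r * w"
    by (metis nonzero_mult_div_cancel_left of_nat_eq_0_iff pqr_nonzero(3) times_divide_eq_right)
  let ?y = "(x ^ r - x) ^ 2"
  \<comment> \<open>Squaring removes \<open>\<gamma>\<close> modulo \<open>r\<close>, and the factor
    16 cancels because \<open>r\<close> is odd.\<close>
  have "16 * ?y = (of_nat r * w - \<gamma>) ^ 2"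
    unfolding w(2)[symmetric] by (simp add: power2_eq_square algebra_simps)
  also have "\<dots> = of_nat r * (of_nat r * w ^ 2 - 2 * w * \<gamma>) + \<gamma> ^ 2"
    by (simp add: power2_eq_square algebra_simps)
  finally have "16 * ?y / of_nat r = (of_nat r * w ^ 2 - 2 * w * \<gamma>) + \<gamma> ^ 2 / of_nat r"
    by (simp add: add_divide_distrib)
  also have "\<dots> \<in> \<O>" using \<gamma>2 w(1) inO by (intro O_add O_diff O_mult O_power) auto
  finally have "of_int 16 * (?y / of_nat r) \<in> \<O>" by simp
  moreover have "of_int (int r) * (?y / of_nat r) \<in> \<O>" using assms by (auto intro!: O_power O_diff)
  moreover have "Rings.coprime (2 ^ 4) (int r)" using odd_r by (intro coprime_power_left_iff[THEN iffD2]) simp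
  then have "Rings.coprime 16 (int r)" by simp
  moreover have "?y / of_nat r \<in> F" by (intro K_divide K_power K_diff O_in_K[OF assms] K_of_nat)
  ultimately show ?thesis using O_coprime_multiples by blast
qed

text \<open>Witnessed by \<open>(v / r) * (X ^ r - X)\<close>: the square of a value is
  \<open>q * ((x ^ r - x) ^ 2 / r)\<close>.\<close>

lemma v_over_r_in_char_ideal: "v / of_nat r \<in> char_ideal F r"
proof -
  define f where "f = smult (v / of_nat r) (monom 1 r - monom 1 1)"
  have vr: "v / of_nat r \<in> F" by (intro K_divide) (auto simp: v_el)
  have "f \<in> int_valued_polys F"
  proof (rule int_valued_polysI)
    show "coeff f i \<in> F" for i using vr r_gt_2 by (auto simp: f_def intro!: K_mult K_diff K_uminus)
    fix x assume x: "x \<in> \<O>"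
    have val: "poly f x = v / of_nat r * (x ^ r - x)" by (simp add: f_def poly_monom)
    have "poly f x ^ 2 = (v * v) * (x ^ r - x) ^ 2 / (of_nat r * of_nat r)"
      unfolding val by (simp add: power2_eq_square)
    also have "\<dots> = of_nat q * ((x ^ r - x) ^ 2 / of_nat r)" unfolding v_square by simp
    also have "\<dots> \<in> \<O>" by (intro O_mult r_divides_square_of_frobenius x) auto
    finally have "poly f x ^ 2 \<in> \<O>" .
    moreover have "poly f x \<in> F" unfolding val by (intro K_mult[OF vr] K_diff K_power O_in_K x)
    ultimately show "poly f x \<in> \<O>" using O_square_iff by blast
  qed
  moreover have "degree f \<le> r"
    unfolding f_def using r_gt_2
    by (intro order.trans[OF degree_smult_le] degree_diff_le) (auto simp: degree_monom_eq)
  moreover have "coeff f r = v / of_nat r" using r_gt_2 by (simp add: f_def)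
  ultimately show ?thesis unfolding char_ideal_iff by blast
qed

text \<open>Interpolation at \<open>0, \<dots>, r - 1\<close> and \<open>v\<close>.\<close>

lemma char_ideal_r_bound:
  assumes "x \<in> char_ideal F r"
  shows "\<exists>M. Rings.coprime M (int r) \<and> of_int M * x * v \<in> \<O>"
proof -
  have xF: "x \<in> F" using fractional_idealD(1)[OF fractional_ideal_char_ideal assms] .
  obtain m :: nat where m: "Rings.coprime m r" "of_nat m * (x * (\<Prod>i<r. v - of_nat i)) \<in> \<O>"
    using char_ideal_prime_bound[OF prime_r assms v_in_O] by blast
  \<comment> \<open>The node 0 contributes the factor \<open>v\<close>. Each other factor
    \<open>v - i\<close> is completed by \<open>v + i\<close> to the integer
    \<open>qr - i^2\<close>, which is prime to \<open>r\<close>.\<close>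
  have split: "{..<r} = insert 0 {1..<r}" using r_gt_2 by auto
  have "of_nat m * (x * (\<Prod>i<r. v - of_nat i)) * (\<Prod>i\<in>{1..<r}. v + of_nat i) \<in> \<O>"
    by (intro O_mult[OF m(2)] O_prod O_add) auto
  also have "of_nat m * (x * (\<Prod>i<r. v - of_nat i)) * (\<Prod>i\<in>{1..<r}. v + of_nat i)
      = of_nat m * x * v * (\<Prod>i\<in>{1..<r}. (v - of_nat i) * (v + of_nat i))"
    unfolding split by (simp add: prod.distrib)
  also have "(\<Prod>i\<in>{1..<r}. (v - of_nat i) * (v + of_nat i)) = (\<Prod>i\<in>{1..<r}. of_int (int (q * r) - int i ^ 2))"
  proof (rule prod.cong)
    fix i
    have "(v - of_nat i) * (v + of_nat i) = v * v - of_nat i ^ 2" by (simp add: power2_eq_square algebra_simps)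
    then show "(v - of_nat i) * (v + of_nat i) = of_int (int (q * r) - int i ^ 2)" by (simp add: v_square)
  qed simp
  also have "of_nat m * x * v * \<dots> = of_int (int m * (\<Prod>i\<in>{1..<r}. int (q * r) - int i ^ 2)) * x * v"
    by simp
  finally have "of_int (int m * (\<Prod>i\<in>{1..<r}. int (q * r) - int i ^ 2)) * x * v \<in> \<O>" .
  moreover have "Rings.coprime (int m * (\<Prod>i\<in>{1..<r}. int (q * r) - int i ^ 2)) (int r)"
  proof -
    have "Rings.coprime (int (q * r) - int i ^ 2) (int r)" if i: "i \<in> {1..<r}" for i
    proof -
      have "\<not> int r dvd int (q * r) - int i ^ 2"
      proof
        assume "int r dvd int (q * r) - int i ^ 2"
        then have "int r dvd int (q * r) - (int (q * r) - int i ^ 2)" by (rule_tac dvd_diff) (simp, assumption)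
        also have "int (q * r) - (int (q * r) - int i ^ 2) = int i ^ 2" by simp
        finally have "int r dvd int i ^ 2" .
        then have "int r dvd int i" using prime_r prime_dvd_power[of "int r" "int i" 2] by simp
        then have "r dvd i" by simp
        with i show False by (auto dest: dvd_imp_le)
      qed
      then show ?thesis using prime_imp_coprime[of "int r"] prime_r coprime_commute by auto
    qed
    then have "Rings.coprime (\<Prod>i\<in>{1..<r}. int (q * r) - int i ^ 2) (int r)"
      by (rule prod_coprime_left)
    moreover have "Rings.coprime (int m) (int r)" using m(1) by simp
    ultimately show ?thesis by simp
  qed
  ultimately show ?thesis by blast
qed

text \<open>The quotient \<open>z = y / x\<close> of the generators would satisfy
  \<open>z^2 = r * unit\<close>. This follows from bounds on both ideals: \<open>v / r\<close> and
  \<open>r * x\<close> for one divisibility each, against \<open>(r - 1)!\<close> and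
  \<open>M * v\<close> as denominators prime to \<open>r\<close>.\<close>

lemma char_ideals_not_both_principal:
  assumes x: "x \<in> F" "x \<noteq> 0" "char_ideal F r = scaled x \<O>"
    and y: "y \<in> F" "y \<noteq> 0" "char_ideal F (r - 1) = scaled y \<O>"
  shows False
proof -
  have Suc: "Suc (r - 1) = r" using r_gt_2 by simp
  have xJ: "x \<in> char_ideal F r" and yJ: "y \<in> char_ideal F (r - 1)"
    unfolding x(3) y(3) by (auto intro!: image_eqI[of _ _ 1])
  obtain s where s: "s \<in> \<O>" "v / of_nat r = x * s"
    using v_over_r_in_char_ideal unfolding x(3) by auto
  obtain t where t: "t \<in> \<O>" "1 = y * t"
    using one_in_char_ideal[of "r - 1"] unfolding y(3) by auto
  obtain w where w: "w \<in> \<O>" "of_nat r * x = y * w"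
    using char_ideal_diff[of x "r - 1"] xJ unfolding Suc y(3) by auto
  obtain z where z: "z \<in> \<O>" "y = x * z"
    using char_ideal_Suc[OF yJ] unfolding Suc x(3) by auto
  obtain M where M: "Rings.coprime M (int r)" "of_int M * x * v \<in> \<O>"
    using char_ideal_r_bound[OF xJ] by blast
  define f :: int where "f = fact (r - 1)"
  have f: "of_int f * y \<in> \<O>" using char_ideal_fact[OF yJ] by (simp add: f_def)
  have z0: "z \<noteq> 0" using z(2) y(2) by auto
  have zF: "z \<in> F" using z(1) by (rule O_in_K)
  have rq: "Rings.coprime (int r) (int q)" using prime_q prime_r distinct by (simp add: primes_coprime)
  have rf: "Rings.coprime (int r) f"
  proof -
    have "\<not> r dvd fact (r - 1)" using prime_dvd_fact_iff[OF prime_r] r_gt_2 by simp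
    then have "Rings.coprime r (fact (r - 1))" by (rule prime_imp_coprime[OF prime_r])
    then have "Rings.coprime (int r) (int (fact (r - 1)))" by (simp only: coprime_int_iff)
    then show ?thesis by (simp add: f_def)
  qed
  \<comment> \<open>Multiplying by \<open>r\<close> tests integrality away from \<open>r\<close>,
    multiplying by \<open>f ^ 2 * q\<close> tests it at \<open>r\<close>; the reciprocal is treated
    alike with \<open>M ^ 2 * q\<close>.\<close>
  have "z ^ 2 / of_nat r \<in> \<O>"
  proof (rule O_coprime_multiples)
    show "of_int (int r) * (z ^ 2 / of_nat r) \<in> \<O>" using z(1) by (simp add: O_power)
    have "(of_int f * y) ^ 2 * s ^ 2 \<in> \<O>" by (intro O_mult O_power f s)
    also have "s = v / (of_nat r * x)" using s(2) x(2) by (simp add: field_simps)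
    also have "(of_int f * y) ^ 2 * (v / (of_nat r * x)) ^ 2 = of_int f ^ 2 * (y / x) ^ 2 * (v * v) / (of_nat r * of_nat r)"
      by (simp add: power2_eq_square mult_ac)
    also have "\<dots> = of_int (f ^ 2 * int q) * (z ^ 2 / of_nat r)"
      unfolding v_square z(2) using x(2) by simp
    finally show "of_int (f ^ 2 * int q) * (z ^ 2 / of_nat r) \<in> \<O>" .
    show "Rings.coprime (int r) (f ^ 2 * int q)" using rq rf by simp
  qed (use zF in \<open>auto intro!: K_divide K_power\<close>)
  moreover have "of_nat r / z ^ 2 \<in> \<O>"
  proof (rule O_coprime_multiples)
    have "w ^ 2 \<in> \<O>" by (intro O_power w)
    also have "w = of_nat r / z" using w(2) z x(2) z0 by (simp add: field_simps)
    finally show "of_int (int r) * (of_nat r / z ^ 2) \<in> \<O>" by (simp add: power2_eq_square)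
    have "(of_int M * x * v) ^ 2 * t ^ 2 \<in> \<O>" by (intro O_mult O_power M t)
    also have "t = 1 / (x * z)" using t(2) z(2) x(2) z0 by (simp add: field_simps)
    also have "(of_int M * x * v) ^ 2 * (1 / (x * z)) ^ 2 = of_int M ^ 2 * (v * v) / z ^ 2"
      using x(2) z0 by (simp add: power2_eq_square field_simps)
    also have "\<dots> = of_int (M ^ 2 * int q) * (of_nat r / z ^ 2)"
      unfolding v_square by simp
    finally show "of_int (M ^ 2 * int q) * (of_nat r / z ^ 2) \<in> \<O>" .
    show "Rings.coprime (int r) (M ^ 2 * int q)" using rq M(1) by (simp add: coprime_commute)
  qed (use zF in \<open>auto intro!: K_divide K_power\<close>)
  ultimately show False using no_square_root_of_r_times_unit[OF zF z0] by blast
qed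

end

subsection \<open>Galois-stable ideals\<close>

context biquadratic
begin

lemma poly_conj:
  assumes "s * s = 1" "t * t = 1" "\<And>i. coeff f i \<in> F" "x \<in> F"
  shows "poly (map_poly (conj s t) f) (conj s t x) = conj s t (poly f x)"
  using assms(3)
proof (induction f)
  case (pCons a f)
  have a: "a \<in> F" using pCons.prems[of 0] by simp
  have f: "coeff f i \<in> F" for i using pCons.prems[of "Suc i"] by simp
  have "poly f x \<in> F" by (intro K_poly f assms(4))
  then show ?case using pCons.IH[OF f] pCons.hyps a assms
    by (simp add: map_poly_pCons conj_add conj_mult K_mult)
qed simp

text \<open>Conjugating the coefficients of \<open>f\<close> gives the map that conjugates, applies
  \<open>f\<close> and conjugates again, and conjugation preserves \<open>\<O>\<close>.\<close>

lemma conj_char_ideal: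
  assumes st: "s * s = 1" "t * t = 1" and x: "x \<in> char_ideal F n"
  shows "conj s t x \<in> char_ideal F n"
proof -
  obtain f where f: "f \<in> int_valued_polys F" "degree f \<le> n" "coeff f n = x"
    using x unfolding char_ideal_iff by blast
  note fK = int_valued_polysD(1)[OF f(1)]
  have "map_poly (conj s t) f \<in> int_valued_polys F"
  proof (rule int_valued_polysI)
    show "coeff (map_poly (conj s t) f) i \<in> F" for i
      by (simp add: coeff_map_poly conj_in_F fK)
    fix y assume y: "y \<in> \<O>"
    have "poly (map_poly (conj s t) f) y = conj s t (poly f (conj s t y))"
      using poly_conj[OF st fK, of "conj s t y"] y by (simp add: conj_conj st conj_in_F O_in_K)
    also have "\<dots> \<in> \<O>" by (intro conj_O st int_valued_polysD(2)[OF f(1)] y)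
    finally show "poly (map_poly (conj s t) f) y \<in> \<O>" .
  qed
  moreover have "degree (map_poly (conj s t) f) \<le> n"
    using f(2) degree_map_poly_le order.trans by blast
  ultimately show ?thesis
    using f(3) unfolding char_ideal_iff by (intro bexI) (auto simp: coeff_map_poly)
qed

abbreviation \<sigma> :: "complex \<Rightarrow> complex" where "\<sigma> \<equiv> conj (- 1) 1"
abbreviation \<tau> :: "complex \<Rightarrow> complex" where "\<tau> \<equiv> conj 1 (- 1)"

text \<open>\<open>\<sigma>\<close> and \<open>\<tau>\<close> generate the Galois group. Integrality
  is included so that \<open>I \<inter> \<int>\<close> is an ideal of the integers.\<close>

definition stable :: "complex set \<Rightarrow> bool" where
  "stable I \<longleftrightarrow> ideal_of_K I \<and> I \<subseteq> \<O> \<and> (\<forall>x\<in>I. \<sigma> x \<in> I \<and> \<tau> x \<in> I)"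

lemma stableD:
  assumes "stable I"
  shows "ideal_of_K I" "x \<in> I \<Longrightarrow> x \<in> \<O>" "x \<in> I \<Longrightarrow> \<sigma> x \<in> I" "x \<in> I \<Longrightarrow> \<tau> x \<in> I"
    "x \<in> I \<Longrightarrow> y \<in> I \<Longrightarrow> x + y \<in> I" "a \<in> \<O> \<Longrightarrow> x \<in> I \<Longrightarrow> a * x \<in> I"
  using assms fractional_idealD(4,5)[of I] by (auto simp: stable_def)

text \<open>The positive generator of \<open>I \<inter> \<int>\<close>.\<close>

definition gen :: "complex set \<Rightarrow> nat" where
  "gen I = (LEAST n. n > 0 \<and> of_nat n \<in> I)"

lemma gen:
  assumes "stable I"
  shows "gen I > 0" "of_nat (gen I) \<in> I"
proof -
  obtain x where x: "x \<in> I" "x \<noteq> 0" using fractional_idealD(3)[OF stableD(1)[OF assms]] by blast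
  then have xF: "x \<in> F" using stableD(2)[OF assms] O_in_K by blast
  obtain n where n: "n > 0" "algebraic_int (of_nat n * inverse x)"
    using K_denominator[OF K_inverse[OF xF]] by blast
  then have "of_nat n * inverse x \<in> \<O>" by (simp add: O_iff K_mult K_inverse xF)
  from stableD(6)[OF assms this x(1)] have "of_nat n \<in> I" using x(2) by (simp add: mult.assoc)
  with n(1) have "\<exists>n. n > 0 \<and> of_nat n \<in> I" by blast
  then show "gen I > 0" "of_nat (gen I) \<in> I" unfolding gen_def by (rule LeastI2_ex, simp)+
qed

lemma gen_le: "n > 0 \<Longrightarrow> of_nat n \<in> I \<Longrightarrow> gen I \<le> n"
  unfolding gen_def by (rule Least_le) simp

lemma gen_dvd:
  assumes "stable I" "of_int k \<in> I"
  shows "int (gen I) dvd k"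
proof (rule ccontr)
  assume "\<not> int (gen I) dvd k"
  define m where "m = nat (k mod int (gen I))"
  have m: "int m = k mod int (gen I)" using gen(1)[OF assms(1)] by (simp add: m_def)
  have "m > 0" "m < gen I"
    using \<open>\<not> int (gen I) dvd k\<close> gen(1)[OF assms(1)] m
    by (metis gr0I mod_eq_0_iff_dvd of_nat_0, metis of_nat_0_less_iff of_nat_less_iff pos_mod_bound)
  moreover have "of_nat m \<in> I"
  proof -
    have "int m = k + - (k div int (gen I)) * int (gen I)"
      unfolding m by (simp add: minus_div_mult_eq_mod[symmetric])
    then have "(of_nat m :: complex) = of_int k + of_int (- (k div int (gen I))) * of_nat (gen I)"
      by (metis of_int_add of_int_mult of_int_of_nat_eq)
    then show ?thesis
      using stableD(5)[OF assms(1,2) stableD(6)[OF assms(1) O_of_int gen(2)[OF assms(1)]]] by metis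
  qed
  ultimately show False using gen_le[of m I] by simp
qed

lemma gen_dvd_nat: "stable I \<Longrightarrow> of_nat n \<in> I \<Longrightarrow> gen I dvd n"
  using gen_dvd[of I "int n"] by simp

lemma gen_eq_1_iff: assumes "stable I" shows "gen I = 1 \<longleftrightarrow> I = \<O>"
proof
  assume "gen I = 1"
  with gen(2)[OF assms] have "1 \<in> I" by simp
  then have "x \<in> I" if "x \<in> \<O>" for x using stableD(6)[OF assms that, of 1] by simp
  with stableD(2)[OF assms] show "I = \<O>" by blast
next
  assume "I = \<O>"
  then have "gen I \<le> 1" by (intro gen_le) auto
  with gen(1)[OF assms] show "gen I = 1" by simp
qed

section \<open>Divisibility of stable ideals by odd primes\<close>

definition dvd_rat :: "nat \<Rightarrow> rat \<Rightarrow> bool" where "dvd_rat n a \<longleftrightarrow> a / of_nat n \<in> \<int>"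

lemma dvd_rat_if_in:
  assumes I: "stable I" "l dvd gen I" "of_rat a \<in> I"
  shows "dvd_rat l a"
proof -
  have "a \<in> \<int>" using stableD(2)[OF I(1,3)] by (simp only: rat_in_O_iff)
  then obtain k where k: "a = of_int k" by (elim Ints_cases)
  have "int l dvd k" using gen_dvd[OF I(1), of k] I(2,3) by (simp add: k) (meson dvd_trans int_dvd_int_iff)
  then obtain j where "k = int l * j" by blast
  then show ?thesis by (cases "l = 0") (simp_all add: dvd_rat_def k)
qed

text \<open>A stable ideal contains the traces of its elements, and its rational elements are
  multiples of \<open>gen I\<close>.\<close>

lemma trace_dvd_rat:
  assumes I: "stable I" "l dvd gen I" and x: "el a b c d \<in> I"
  shows "dvd_rat l (4 * a)"
proof -
  let ?x = "el a b c d"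
  have "conj (- 1) (- 1) ?x = \<sigma> (\<tau> ?x)" by (simp add: conj_el)
  then have "of_rat (4 * a) \<in> I"
    unfolding trace_conj[symmetric, of a b c d] using stableD(3-5)[OF I(1)] x by simp
  then show ?thesis by (rule dvd_rat_if_in[OF I])
qed

text \<open>Multiplying by \<open>u\<close>, \<open>v\<close> or \<open>u * v\<close> moves each
  coordinate in turn to the rational place, where the trace sees it.\<close>

lemma coordinates_dvd_rat:
  assumes I: "stable I" "l dvd gen I" and x: "el a b c d \<in> I"
  shows "dvd_rat l (4 * a)" "dvd_rat l (4 * of_nat p * b)" "dvd_rat l (4 * of_nat (q * r) * c)"
    "dvd_rat l (4 * of_nat p * of_nat (q * r) * d)"
proof -
  have *: "y * el a b c d \<in> I" if "y \<in> \<O>" for y using stableD(6)[OF I(1) that x] .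
  show "dvd_rat l (4 * a)" by (rule trace_dvd_rat[OF I x])
  have "u * el a b c d = el (of_nat p * b) a (of_nat p * d) c"
    unfolding u_el el_mult el_inject by simp
  with trace_dvd_rat[OF I, of "of_nat p * b"] *[OF u_in_O] show "dvd_rat l (4 * of_nat p * b)"
    by (simp add: mult.assoc)
  have "v * el a b c d = el (of_nat (q * r) * c) (of_nat (q * r) * d) a b"
    unfolding v_el el_mult el_inject by simp
  with trace_dvd_rat[OF I, of "of_nat (q * r) * c"] *[OF v_in_O] show "dvd_rat l (4 * of_nat (q * r) * c)"
    by (simp add: mult.assoc)
  have "(u * v) * el a b c d = el (of_nat p * of_nat (q * r) * d) (of_nat (q * r) * c) (of_nat p * b) a"
    unfolding uv_el el_mult el_inject by simp
  with trace_dvd_rat[OF I, of "of_nat p * of_nat (q * r) * d"] *[OF O_mult[OF u_in_O v_in_O]]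
  show "dvd_rat l (4 * of_nat p * of_nat (q * r) * d)" by (simp add: mult.assoc)
qed

lemma el_integers_in_O:
  assumes "a \<in> \<int>" "b \<in> \<int>" "c \<in> \<int>" "d \<in> \<int>"
  shows "el a b c d \<in> \<O>"
proof -
  have "of_rat x \<in> \<O>" if "x \<in> \<int>" for x using that rat_in_O_iff by blast
  then show ?thesis unfolding el_def using assms by (intro O_add O_mult) auto
qed

text \<open>\<open>4 * p * q * r * x / l\<close> has integer coordinates, and \<open>l\<close> is
  prime to \<open>4 * p * q * r\<close>.\<close>

lemma unramified_divides:
  assumes I: "stable I" "l dvd gen I" and l: "prime l" "l \<noteq> 2" "l \<noteq> p" "l \<noteq> q" "l \<noteq> r"
    and x: "x \<in> I"
  shows "x / of_nat l \<in> \<O>"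
proof (rule O_coprime_multiples)
  have xO: "x \<in> \<O>" by (rule stableD(2)[OF I(1) x])
  have l0: "l \<noteq> 0" using l(1) by auto
  obtain a b c d where e: "x = el a b c d" using O_in_K[OF xO] by (rule F_cases)
  note co = coordinates_dvd_rat[OF I x[unfolded e], unfolded dvd_rat_def]
  let ?D = "of_nat p * of_nat (q * r) :: rat"
  have "of_int (4 * int p * int (q * r)) * (x / of_nat l) = of_rat (4 * ?D / of_nat l) * x"
    by (simp add: of_rat_mult of_rat_divide)
  also have "\<dots> = el (?D * (4 * a / of_nat l)) (of_nat (q * r) * (4 * of_nat p * b / of_nat l))
      (of_nat p * (4 * of_nat (q * r) * c / of_nat l)) (4 * of_nat p * of_nat (q * r) * d / of_nat l)"
    unfolding e el_scaleR el_inject by simp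
  also have "\<dots> \<in> \<O>" by (intro el_integers_in_O Ints_mult co) (auto simp del: of_nat_mult intro!: Ints_mult)
  finally show "of_int (4 * int p * int (q * r)) * (x / of_nat l) \<in> \<O>" .
  show "of_int (int l) * (x / of_nat l) \<in> \<O>" using xO l0 by simp
  have "odd l" using l(1,2) primes_dvd_imp_eq two_is_prime_nat by blast
  then have "Rings.coprime (int l) (4 * int p * (int q * int r))"
    using primes_coprime_int[OF l(1)] prime_p prime_q prime_r l odd_coprime_4
    by (simp only: coprime_mult_right_iff simp_thms not_False_eq_True)
  then show "Rings.coprime (4 * int p * int (q * r)) (int l)"
    by (simp add: coprime_commute)
  show "x / of_nat l \<in> F" using xO by (intro K_divide O_in_K) auto
qed

text \<open>\<open>x / u = x * u / p\<close>, and multiplication by \<open>u\<close> places the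
  factors \<open>p\<close> exactly where \<open>coordinates_dvd_rat\<close> controls them.\<close>

lemma p_divides:
  assumes I: "stable I" "p dvd gen I" and x: "x \<in> I"
  shows "x / u \<in> \<O>"
proof -
  have xO: "x \<in> \<O>" by (rule stableD(2)[OF I(1) x])
  obtain a b c d where e: "x = el a b c d" using O_in_K[OF xO] by (rule F_cases)
  note co = coordinates_dvd_rat[OF I x[unfolded e], unfolded dvd_rat_def]
  have xu_el: "x * u = el (of_nat p * b) a (of_nat p * d) c"
    unfolding e u_el el_mult el_inject by simp
  have u0: "u \<noteq> 0" using u_square by auto
  have xu: "x / u = x * u / of_nat p" unfolding u_square[symmetric] using u0 by simp
  have "x * u / of_nat p \<in> \<O>"
  proof (rule O_coprime_multiples)
    have "of_int (4 * int (q * r)) * (x * u / of_nat p) = of_rat (4 * of_nat (q * r) / of_nat p) * (x * u)"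
      by (simp add: of_rat_mult of_rat_divide)
    also have "\<dots> =
        el (of_nat (q * r) * (4 * of_nat p * b / of_nat p)) (of_nat (q * r) * (4 * a / of_nat p))
          (4 * of_nat p * of_nat (q * r) * d / of_nat p) (4 * of_nat (q * r) * c / of_nat p)"
      unfolding xu_el el_scaleR el_inject by simp
    also have "\<dots> \<in> \<O>" by (intro el_integers_in_O Ints_mult co) (auto simp del: of_nat_mult)
    finally show "of_int (4 * int (q * r)) * (x * u / of_nat p) \<in> \<O>" .
    show "of_int (int p) * (x * u / of_nat p) \<in> \<O>" using O_mult[OF xO u_in_O] by simp
    have "Rings.coprime (int p) (4 * (int q * int r))"
      using primes_coprime_int[OF prime_p] prime_q prime_r distinct odd_coprime_4[OF odd_p]
      by (simp only: coprime_mult_right_iff simp_thms not_False_eq_True)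
    then show "Rings.coprime (4 * int (q * r)) (int p)" by (simp add: coprime_commute)
    show "x * u / of_nat p \<in> F" using xO by (intro K_divide K_mult O_in_K) auto
  qed
  then show ?thesis by (simp only: xu)
qed

text \<open>For \<open>l\<close> equal to \<open>q\<close> or \<open>r\<close>: \<open>v\<close>
  generates the product of the radicals of \<open>l\<close> and \<open>m\<close>, and
  \<open>l\<close> the square of the first, so \<open>v / l\<close> is the radical of
  \<open>m\<close> divided by the radical of \<open>l\<close>.\<close>

lemma qr_factor_divides:
  assumes I: "stable I" "l dvd gen I" and l: "prime l" "odd l" "l \<noteq> p" "l * m = q * r" and x: "x \<in> I"
  shows "x * v / of_nat l \<in> \<O>"
proof (rule O_coprime_multiples)
  have xO: "x \<in> \<O>" by (rule stableD(2)[OF I(1) x])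
  have l0: "l \<noteq> 0" using l(1) by auto
  obtain a b c d where e: "x = el a b c d" using O_in_K[OF xO] by (rule F_cases)
  note co = coordinates_dvd_rat[OF I x[unfolded e], unfolded dvd_rat_def]
  have xv_el: "x * v = el (of_nat (q * r) * c) (of_nat (q * r) * d) a b"
    unfolding e v_el el_mult el_inject by simp
  have "of_int (4 * int p) * (x * v / of_nat l) = of_rat (4 * of_nat p / of_nat l) * (x * v)"
    by (simp add: of_rat_mult of_rat_divide)
  also have "\<dots> =
      el (of_nat p * (4 * of_nat (q * r) * c / of_nat l)) (4 * of_nat p * of_nat (q * r) * d / of_nat l)
        (of_nat p * (4 * a / of_nat l)) (4 * of_nat p * b / of_nat l)"
    unfolding xv_el el_scaleR el_inject by simp
  also have "\<dots> \<in> \<O>" by (intro el_integers_in_O Ints_mult co) auto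
  finally show "of_int (4 * int p) * (x * v / of_nat l) \<in> \<O>" .
  show "of_int (int l) * (x * v / of_nat l) \<in> \<O>" using O_mult[OF xO v_in_O] l0 by simp
  show "Rings.coprime (4 * int p) (int l)"
    using primes_coprime_int[OF l(1) prime_p l(3)] odd_coprime_4[OF l(2)] coprime_commute
    by (metis coprime_mult_right_iff)
  show "x * v / of_nat l \<in> F" using xO by (intro K_divide K_mult O_in_K) auto
qed

section \<open>The prime 2\<close>

lemma pqr_mod_4: "\<exists>k. p * (q * r) = 4 * k + 1"
proof -
  have "p mod 4 = 3" "q mod 4 = 3" using p_mod_4 q_mod_4
    by (simp_all add: unique_euclidean_semiring_class.cong_def)
  moreover have "r mod 8 = 1" using r_mod_8 by (simp add: unique_euclidean_semiring_class.cong_def)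
  then have "r mod 4 = 1" by presburger
  ultimately have "(p mod 4) * ((q mod 4) * (r mod 4)) mod 4 = 1" by simp
  then have "p * (q * r) mod 4 = 1" by (metis mod_mult_eq mod_mult_right_eq)
  then show ?thesis by (metis mult_div_mod_eq)
qed

text \<open>\<open>(1 + \<surd>(pqr)) / 2\<close>, a root of \<open>X^2 - X - k\<close> where
  \<open>pqr = 4 k + 1\<close>.\<close>

definition \<theta> :: complex where "\<theta> = el (1 / 2) 0 0 (1 / 2)"

lemma theta_in_O: "\<theta> \<in> \<O>"
proof -
  obtain k where k: "p * (q * r) = 4 * k + 1" using pqr_mod_4 by blast
  have D: "(of_nat p * of_nat (q * r) :: rat) = 4 * of_nat k + 1"
    unfolding of_nat_mult[symmetric] k by simp
  have "\<theta> * \<theta> = el (1 / 2 + of_nat k) 0 0 (1 / 2)"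
    unfolding \<theta>_def el_mult el_inject D by (simp del: of_nat_mult)
  also have "\<dots> = \<theta> + of_nat k"
    using el_add[of "1 / 2" 0 0 "1 / 2" "of_nat k" 0 0 0] by (simp add: \<theta>_def el_rat)
  finally have eq: "\<theta> ^ 2 - \<theta> = of_nat k" by (simp add: power2_eq_square)
  have "algebraic_int \<theta>"
  proof (rule algebraic_int_root)
    show "poly [:0, - 1, 1:] \<theta> = of_nat k"
      using eq by (simp add: power2_eq_square algebra_simps)
  qed (auto simp: coeff_pCons split: nat.split)
  then show ?thesis unfolding O_iff by (simp add: \<theta>_def)
qed

text \<open>On \<open>\<rat>(\<surd>(pqr))\<close> the map \<open>\<sigma>\<close> is the nontrivial
  automorphism, so the quadratic traces of \<open>x\<close>, \<open>u v x\<close> and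
  \<open>\<theta> x\<close> lie in \<open>I\<close> and are even. As 2 is unramified there, these
  traces detect divisibility by 2.\<close>

lemma fixed_half_in_O:
  assumes I: "stable I" "2 dvd gen I" and x: "el a 0 0 d \<in> I"
  shows "el a 0 0 d / 2 \<in> \<O>"
proof -
  let ?x = "el a 0 0 d"
  define D where "D = (of_nat p * of_nat (q * r) :: rat)"
  have half_trace: "dvd_rat 2 (2 * b)" if "el b 0 0 c \<in> I" for b c
  proof (rule dvd_rat_if_in[OF I])
    have "el b 0 0 c + \<sigma> (el b 0 0 c) = of_rat (2 * b)"
      unfolding conj_el el_add el_rat[symmetric] el_inject by simp
    then show "of_rat (2 * b) \<in> I" using stableD(3,5)[OF I(1)] that by metis
  qed
  have xO: "?x \<in> \<O>" by (rule stableD(2)[OF I(1) x])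
  have aZ: "a \<in> \<int>" using half_trace[OF x] by (simp add: dvd_rat_def)
  have "(u * v) * ?x \<in> I" by (intro stableD(6)[OF I(1) _ x] O_mult) auto
  also have "(u * v) * ?x = el (D * d) 0 0 a" unfolding uv_el el_mult el_inject D_def by simp
  finally have dZ: "D * d \<in> \<int>" using half_trace by (simp add: dvd_rat_def)
  have "\<theta> * ?x \<in> I" by (intro stableD(6)[OF I(1) _ x] theta_in_O)
  also have "\<theta> * ?x = el ((a + D * d) / 2) 0 0 ((a + d) / 2)"
    unfolding \<theta>_def el_mult el_inject D_def by (simp add: field_simps)
  finally have sZ: "(a + D * d) / 2 \<in> \<int>" using half_trace by (fastforce simp: dvd_rat_def)
  obtain k where k: "p * (q * r) = 4 * k + 1" using pqr_mod_4 by blast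
  have Dk: "D = 4 * of_nat k + 1"
    unfolding D_def of_nat_mult[symmetric] k by simp
  show ?thesis
  proof (rule O_coprime_multiples)
    \<comment> \<open>The aim is to write \<open>D * x / 2\<close> as an integral combination of 1
      and \<open>\<theta>\<close>; the odd factor \<open>D = pqr\<close> is then removed.\<close>
    have "(D * a - D * d) / 2 = (a + D * d) / 2 - D * d + 2 * of_nat k * a"
      unfolding Dk by (simp add: field_simps)
    also have "\<dots> \<in> \<int>" by (rule Ints_add[OF Ints_diff[OF sZ dZ] Ints_mult[OF _ aZ]]) simp
    finally have e: "(D * a - D * d) / 2 \<in> \<int>" .
    have "of_int (int (p * (q * r))) * (?x / 2) = of_rat (D / 2) * ?x"
      by (simp add: D_def of_rat_divide of_rat_mult)
    also have "\<dots> = of_rat ((D * a - D * d) / 2) + of_rat (D * d) * \<theta>"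
      unfolding \<theta>_def el_scaleR unfolding el_rat[symmetric] el_add el_inject by (simp add: field_simps)
    also have "\<dots> \<in> \<O>"
      using e dZ by (intro O_add O_mult theta_in_O) (simp_all only: rat_in_O_iff)
    finally show "of_int (int (p * (q * r))) * (?x / 2) \<in> \<O>" .
    show "of_int 2 * (?x / 2) \<in> \<O>" using xO by simp
    have "odd (p * (q * r))" using odd_p odd_q odd_r by simp
    then show "Rings.coprime (int (p * (q * r))) 2" by simp
    show "?x / 2 \<in> F" by (intro K_divide) auto
  qed
qed

text \<open>Modulo 2, the automorphism \<open>\<sigma> \<circ> \<tau>\<close> generates the inertia group; it fixes \<open>\<rat>(\<surd>(pqr))\<close>,
  in which 2 is unramified.\<close>

lemma two_divides_square:
  assumes I: "stable I" "2 dvd gen I" and x: "x \<in> I"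
  shows "x ^ 2 / 2 \<in> \<O>"
proof -
  have xO: "x \<in> \<O>" by (rule stableD(2)[OF I(1) x])
  obtain a b c d where e: "x = el a b c d" using O_in_K[OF xO] by (rule F_cases)
  have y: "\<sigma> (\<tau> x) = el a (- b) (- c) d" by (simp add: e conj_el)
  have yI: "\<sigma> (\<tau> x) \<in> I" using stableD(3,4)[OF I(1)] x by blast
  \<comment> \<open>\<open>x\<close> is a root of \<open>X^2 - s X + n\<close>, where
    \<open>s\<close> and \<open>n\<close> are the sum and product of \<open>x\<close> and
    \<open>\<sigma> (\<tau> x)\<close>; both lie in \<open>I\<close> and are fixed by inertia, hence
    divisible by 2.\<close>
  have sum: "x + \<sigma> (\<tau> x) = el (2 * a) 0 0 (2 * d)"
    unfolding y unfolding e el_add el_inject by simp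
  have s: "(x + \<sigma> (\<tau> x)) / 2 \<in> \<O>"
    using fixed_half_in_O[OF I] stableD(5)[OF I(1) x yI] unfolding sum by blast
  have "x * \<sigma> (\<tau> x) = el (a * a - of_nat p * (b * b) - of_nat (q * r) * (c * c) + of_nat p * of_nat (q * r) * (d * d)) 0 0 (2 * (a * d) - 2 * (b * c))"
    unfolding y unfolding e el_mult el_inject by (simp add: algebra_simps)
  then have p: "x * \<sigma> (\<tau> x) / 2 \<in> \<O>"
    using fixed_half_in_O[OF I] stableD(6)[OF I(1) xO yI] by metis
  have "x ^ 2 / 2 = x * ((x + \<sigma> (\<tau> x)) / 2) - x * \<sigma> (\<tau> x) / 2"
    by (simp add: power2_eq_square field_simps)
  also have "\<dots> \<in> \<O>" by (intro O_diff O_mult xO s p)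
  finally show ?thesis .
qed

text \<open>\<open>\<pi> = A + B u\<close> has norm \<open>2 \<epsilon>\<close> with
  \<open>\<epsilon> = \<plusminus>1\<close>. Since
  \<open>(A^2 + p B^2) / 2 = \<epsilon> + p B^2\<close>, the square of \<open>\<pi>\<close> is 2
  times a unit, and \<open>\<pi> / \<sigma> \<pi> = \<epsilon> \<pi>^2 / 2\<close>.\<close>

lemma prime_above_two:
  obtains \<pi> where "\<pi> \<in> F" "\<pi> \<noteq> 0" "\<pi> ^ 2 / 2 \<in> \<O>" "2 / \<pi> ^ 2 \<in> \<O>" "\<pi> / \<sigma> \<pi> \<in> \<O>" "\<pi> / \<tau> \<pi> \<in> \<O>"
proof -
  obtain A B :: int where AB: "\<bar>A ^ 2 - int p * B ^ 2\<bar> = 2"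
    using norm_two_exists[OF prime_p p_mod_4] by blast
  define \<epsilon> where "\<epsilon> = (A ^ 2 - int p * B ^ 2) div 2"
  have \<epsilon>: "A ^ 2 - int p * B ^ 2 = 2 * \<epsilon>" "\<epsilon> * \<epsilon> = 1" 
  proof -
    have "A ^ 2 - int p * B ^ 2 = 2 \<or> A ^ 2 - int p * B ^ 2 = - 2" using AB by linarith
    then show "A ^ 2 - int p * B ^ 2 = 2 * \<epsilon>" "\<epsilon> * \<epsilon> = 1" unfolding \<epsilon>_def by (elim disjE; simp)+
  qed
  define \<pi> \<pi>' where "\<pi> = el (of_int A) (of_int B) 0 0" and "\<pi>' = el (of_int A) (- of_int B) 0 0"
  have norm: "\<pi> * \<pi>' = 2 * of_int \<epsilon>"
  proof -
    have "\<pi> * \<pi>' = of_rat (of_int (A ^ 2 - int p * B ^ 2))"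
      unfolding \<pi>_def \<pi>'_def el_mult el_rat[symmetric] el_inject by (simp add: power2_eq_square)
    then show ?thesis unfolding \<epsilon> of_rat_of_int_eq by simp
  qed
  have \<epsilon>0: "of_int \<epsilon> * of_int \<epsilon> = (1::complex)" using \<epsilon>(2) by (metis of_int_1 of_int_mult)
  then have nz: "\<pi> \<noteq> 0" "\<pi>' \<noteq> 0" using norm by auto
  have sq: "el (of_int A) (of_int C) 0 0 ^ 2 / 2 \<in> \<O>" if "C ^ 2 = B ^ 2" for C
  proof -
    have "el (of_int A) (of_int C) 0 0 ^ 2 / 2 = of_rat (1 / 2) * (el (of_int A) (of_int C) 0 0 * el (of_int A) (of_int C) 0 0)"
      by (simp add: power2_eq_square of_rat_divide)
    also have "\<dots> = el (of_int (\<epsilon> + int p * B ^ 2)) (of_int (A * C)) 0 0"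
    proof -
      have "A ^ 2 + int p * C ^ 2 = 2 * (\<epsilon> + int p * B ^ 2)"
        unfolding that distrib_left using \<epsilon>(1) by (simp add: algebra_simps)
      then have "A * A + int p * (C * C) = 2 * (\<epsilon> + int p * B ^ 2)"
        by (simp only: power2_eq_square)
      then have "(of_int (A * A + int p * (C * C)) :: rat) = of_int (2 * (\<epsilon> + int p * B ^ 2))" by simp
      then show ?thesis unfolding el_mult el_scaleR el_inject by simp
    qed
    also have "\<dots> \<in> \<O>" by (rule el_integers_in_O) auto
    finally show ?thesis .
  qed
  have 1: "\<pi> ^ 2 / 2 \<in> \<O>" "\<pi>' ^ 2 / 2 \<in> \<O>"
    using sq[of B] sq[of "- B"] by (simp_all add: \<pi>_def \<pi>'_def)
  have inv: "1 / \<pi> = of_int \<epsilon> * \<pi>' / 2" "1 / \<pi>' = of_int \<epsilon> * \<pi> / 2"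
  proof -
    have "of_int \<epsilon> * (\<pi> * \<pi>') = 2" 
      unfolding norm mult.left_commute[of "of_int \<epsilon>" 2] \<epsilon>0 by simp
    moreover have "\<pi> * (of_int \<epsilon> * \<pi>' / 2) = of_int \<epsilon> * (\<pi> * \<pi>') / 2"
      "\<pi>' * (of_int \<epsilon> * \<pi> / 2) = of_int \<epsilon> * (\<pi> * \<pi>') / 2"
      by (simp_all only: mult_ac times_divide_eq_right)
    ultimately have "\<pi> * (of_int \<epsilon> * \<pi>' / 2) = 1" "\<pi>' * (of_int \<epsilon> * \<pi> / 2) = 1"
      by simp_all
    from this[THEN inverse_unique] show "1 / \<pi> = of_int \<epsilon> * \<pi>' / 2" "1 / \<pi>' = of_int \<epsilon> * \<pi> / 2"
      by (simp_all only: inverse_eq_divide)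
  qed
  have "2 / \<pi> ^ 2 = 2 * (1 / \<pi>) ^ 2" by (simp add: power_divide)
  also have "\<dots> = \<pi>' ^ 2 / 2" unfolding inv using \<epsilon>0 by (simp add: power2_eq_square)
  finally have 2: "2 / \<pi> ^ 2 \<in> \<O>" using 1(2) by metis
  have "\<sigma> \<pi> = \<pi>'" "\<tau> \<pi> = \<pi>" by (simp_all add: \<pi>_def \<pi>'_def conj_el)
  moreover have eq: "\<pi> / \<pi>' = of_int \<epsilon> * (\<pi> ^ 2 / 2)"
    using arg_cong[OF inv(2), of "\<lambda>y. \<pi> * y"] by (simp add: power2_eq_square mult_ac)
  have "\<pi> / \<pi>' \<in> \<O>" unfolding eq by (intro O_mult O_of_int 1)
  ultimately show thesis using that[of \<pi>] 1 2 nz by (simp add: \<pi>_def)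
qed

section \<open>The radical of \<open>r\<close>\<close>

definition \<PP> :: "complex set" where "\<PP> = {x \<in> \<O>. dv (x ^ 2)}"

text \<open>\<open>(x y / r)^2\<close> is the product of \<open>x^2 / r\<close> and
  \<open>y^2 / r\<close>. This makes the set \<open>\<PP>\<close>, given by a condition on squares,
  closed under addition.\<close>

lemma dv_product:
  assumes "x \<in> \<PP>" "y \<in> \<PP>"
  shows "dv (x * y)"
proof -
  have "(x * y / of_nat r) ^ 2 = (x ^ 2 / of_nat r) * (y ^ 2 / of_nat r)"
    by (simp add: power2_eq_square)
  also have "\<dots> \<in> \<O>" using assms by (intro O_mult) (auto simp: \<PP>_def)
  finally have "(x * y / of_nat r) ^ 2 \<in> \<O>" .
  moreover have "x * y / of_nat r \<in> F" using assms by (intro K_divide K_mult) (auto simp: \<PP>_def O_in_K)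
  ultimately show ?thesis using O_square_iff by blast
qed

lemma r_in_PP: "of_nat r \<in> \<PP>" and v_in_PP: "v \<in> \<PP>"
  by (simp_all add: \<PP>_def power2_eq_square v_square)

lemma fractional_ideal_PP: "ideal_of_K \<PP>"
proof (rule fractional_idealI[where n = 1])
  show "\<exists>x\<in>\<PP>. x \<noteq> 0" by (rule bexI[OF _ r_in_PP]) simp
  show "x + y \<in> \<PP>" if "x \<in> \<PP>" "y \<in> \<PP>" for x y
  proof -
    have eq: "(x + y) ^ 2 = x ^ 2 + y ^ 2 + x * y * 2" by (simp add: power2_eq_square algebra_simps)
    have "dv (x ^ 2)" "dv (y ^ 2)" using that by (simp_all add: \<PP>_def)
    then have "dv ((x + y) ^ 2)"
      unfolding eq by (intro dv_add dv_mult[OF dv_product[OF that] O_numeral])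
    then show ?thesis using that by (auto simp: \<PP>_def intro: O_add)
  qed
  show "a * x \<in> \<PP>" if "a \<in> \<O>" "x \<in> \<PP>" for a x
    using that dv_mult[of "x ^ 2" "a ^ 2"]
    by (simp add: \<PP>_def O_mult O_power power_mult_distrib mult.commute)
qed (auto simp: \<PP>_def O_in_K)

text \<open>\<open>\<PP>\<close> contains \<open>r\<close> and \<open>v\<close>; the integers
  \<open>r^2\<close> and \<open>v^2 = q r\<close> have greatest common divisor
  \<open>r\<close>.\<close>

lemma iprod_PP: "iprod \<PP> \<PP> = scaled (of_nat r) \<O>"
proof
  have dvE: "x \<in> scaled (of_nat r) \<O>" if "dv x" for x
    using that by (intro image_eqI[of _ _ "x / of_nat r"]) simp_all
  show "iprod \<PP> \<PP> \<subseteq> scaled (of_nat r) \<O>"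
  proof (rule iprod_subsetI)
    show "x * y \<in> scaled (of_nat r) \<O>" if "x \<in> \<PP>" "y \<in> \<PP>" for x y
      by (rule dvE[OF dv_product[OF that]])
    show "x + y \<in> scaled (of_nat r) \<O>" if "x \<in> scaled (of_nat r) \<O>" "y \<in> scaled (of_nat r) \<O>" for x y
      using that by (intro dvE dv_add) auto
  qed
  note PP = fractional_idealD[OF fractional_ideal_iprod[OF fractional_ideal_PP fractional_ideal_PP]]
  have rq: "Rings.coprime (int r) (int q)" using prime_q prime_r distinct by (simp add: primes_coprime)
  then obtain a b where ab: "a * int r + b * int q = 1"
    by (metis bezout_int coprime_imp_gcd_eq_1)
  have "of_int a * (of_nat r * of_nat r) + of_int b * (v * v) \<in> iprod \<PP> \<PP>"
    by (intro PP(4,5) iprod_mult r_in_PP v_in_PP) auto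
  also have "of_int a * (of_nat r * of_nat r) + of_int b * (v * v) = of_nat r * of_int (a * int r + b * int q)"
    unfolding v_square by (simp add: algebra_simps)
  finally have "of_nat r \<in> iprod \<PP> \<PP>" unfolding ab by simp
  then show "scaled (of_nat r) \<O> \<subseteq> iprod \<PP> \<PP>"
    using PP(5) by (auto simp: mult.commute)
qed

section \<open>Descent on stable ideals\<close>

definition good :: "complex set \<Rightarrow> bool" where
  "good I \<longleftrightarrow> (\<exists>x. x \<in> F \<and> x \<noteq> 0 \<and> (I = scaled x \<O> \<or> I = scaled x \<PP>))"

lemma good_scaledD:
  assumes "c \<in> F" "c \<noteq> 0" "good (scaled c I)"
  shows "good I"
proof -
  obtain x where x: "x \<in> F" "x \<noteq> 0" "scaled c I = scaled x \<O> \<or> scaled c I = scaled x \<PP>"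
    using assms(3) by (auto simp: good_def)
  then have "I = scaled (inverse c) (scaled x \<O>) \<or> I = scaled (inverse c) (scaled x \<PP>)"
    using scaled_inverse[OF assms(2), of I] by metis
  then show ?thesis unfolding good_def scaled_scaled using x(1,2) assms(1,2)
    by (intro exI[of _ "inverse c * x"]) (simp add: K_mult K_inverse)
qed

lemma good_O: "good \<O>" and good_PP: "good \<PP>"
  by (auto simp: good_def intro: exI[of _ 1])

text \<open>The conditions on \<open>\<sigma> c / c\<close> and \<open>\<tau> c / c\<close> say that
  the principal ideal of \<open>c\<close> is itself stable.\<close>

lemma stable_scaled:
  assumes I: "stable I" and c: "c \<in> F" "c \<noteq> 0" "\<And>x. x \<in> I \<Longrightarrow> c * x \<in> \<O>"
    and u: "\<sigma> c / c \<in> \<O>" "\<tau> c / c \<in> \<O>"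
  shows "stable (scaled c I)"
proof -
  have "conj s t (c * x) \<in> scaled c I"
    if "x \<in> I" "conj s t x \<in> I" "conj s t c / c \<in> \<O>" "s * s = 1" "t * t = 1" for s t x
  proof -
    have "x \<in> F" using stableD(2)[OF I that(1)] by (rule O_in_K)
    then have "conj s t (c * x) = c * (conj s t c / c * conj s t x)"
      using c(1,2) that(4,5) by (simp add: conj_mult)
    then show ?thesis using stableD(6)[OF I that(3,2)] by blast
  qed
  then show ?thesis unfolding stable_def
    using fractional_ideal_scaled[OF stableD(1)[OF I] c(1,2)] c(3) stableD(3,4)[OF I] u
    by auto
qed

text \<open>\<open>I / l\<close> contains \<open>gen I / l\<close>, so its generator is
  smaller.\<close>

lemma good_by_division:
  assumes I: "stable I" and IH: "\<And>J. stable J \<Longrightarrow> gen J < gen I \<Longrightarrow> good J"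
    and l: "l > 1" and div: "\<And>x. x \<in> I \<Longrightarrow> x / of_nat l \<in> \<O>"
  shows "good I"
proof -
  let ?J = "scaled (1 / of_nat l) I"
  have c: "1 / of_nat l \<in> F" by (intro K_divide) auto
  have conj_c: "conj s t (1 / of_nat l) = 1 / of_nat l" for s t
    using conj_rat[of s t "1 / of_nat l"] by (simp add: of_rat_divide)
  have J: "stable ?J"
    by (rule stable_scaled[OF I c]) (use l div in \<open>simp_all add: conj_c\<close>)
  have "of_rat (of_nat (gen I) / of_nat l) \<in> \<O>" using div[OF gen(2)[OF I]] by (simp add: of_rat_divide)
  then have "of_nat (gen I) / of_nat l \<in> (\<int> :: rat set)" by (simp only: rat_in_O_iff)
  then obtain k where "of_nat (gen I) / of_nat l = (of_int k :: rat)" by (elim Ints_cases)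
  then have "of_int (int (gen I)) = (of_int (k * int l) :: rat)" using l by (simp add: field_simps)
  then have k: "int (gen I) = k * int l" by (simp only: of_int_eq_iff)
  have "0 < k * int l" unfolding k[symmetric] using gen(1)[OF I] by simp
  then have "k > 0" by (simp add: zero_less_mult_iff)
  then have "int (gen I) = int (nat k * l)" using k by simp
  then have kn: "gen I = nat k * l" by (simp only: of_nat_eq_iff)
  have "of_nat (nat k) \<in> ?J"
    using gen(2)[OF I] l unfolding kn by (intro image_eqI[of _ _ "of_nat (nat k * l)"]) simp_all
  then have "gen ?J \<le> nat k" using \<open>k > 0\<close> by (intro gen_le) auto
  also have "nat k < gen I" unfolding kn using \<open>k > 0\<close> l by simp
  finally have "good ?J" by (rule IH[OF J])
  then show ?thesis by (rule good_scaledD[rotated 2]) (use c l in auto)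
qed

text \<open>If dividing by \<open>\<pi>\<close> does not make the generator smaller, dividing by \<open>\<pi>\<^sup>2 \<sim> L\<close> does.\<close>

lemma good_by_uniformizer:
  assumes I: "stable I" and IH: "\<And>J. stable J \<Longrightarrow> gen J < gen I \<Longrightarrow> good J"
    and L: "L > 1" "L dvd gen I"
    and \<pi>: "\<pi> \<in> F" "\<pi> \<noteq> 0" "\<pi> ^ 2 / of_nat L \<in> \<O>" "\<pi> / \<sigma> \<pi> \<in> \<O>" "\<pi> / \<tau> \<pi> \<in> \<O>"
    and div: "\<And>J x. stable J \<Longrightarrow> L dvd gen J \<Longrightarrow> x \<in> J \<Longrightarrow> x / \<pi> \<in> \<O>"
  shows "good I"
proof -
  define c where "c = 1 / \<pi>"
  have c: "c \<in> F" "c \<noteq> 0" unfolding c_def using \<pi>(1,2) by (auto intro: K_divide)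
  have conj_c: "conj s t c / c = \<pi> / conj s t \<pi>" if "s * s = 1" "t * t = 1" for s t
  proof -
    have "conj s t \<pi> * conj s t c = 1" using conj_mult[OF that \<pi>(1) c(1)] \<pi>(2) by (simp add: c_def)
    from inverse_unique[OF this] have "conj s t c = 1 / conj s t \<pi>" by (simp add: inverse_eq_divide)
    then show ?thesis by (simp add: c_def)
  qed
  have stab: "stable (scaled c J)" if "stable J" "L dvd gen J" for J
  proof (rule stable_scaled[OF that(1) c])
    show "c * x \<in> \<O>" if "x \<in> J" for x
      using div[OF \<open>stable J\<close> \<open>L dvd gen J\<close> that] by (simp add: c_def)
  qed (use \<pi> in \<open>simp_all only: conj_c mult_1 mult_minus_left mult_minus_right minus_minus\<close>)
  have \<pi>O: "\<pi> \<in> \<O>"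
  proof -
    have "of_nat L * (\<pi> ^ 2 / of_nat L) \<in> \<O>" by (intro O_mult \<pi>) auto
    then show ?thesis using L(1) O_square_iff[OF \<pi>(1)] by simp
  qed
  let ?J = "scaled c I"
  have J: "stable ?J" by (rule stab[OF I L(2)])
  show ?thesis
  proof (cases "gen ?J < gen I")
    case True
    then show ?thesis using IH[OF J] good_scaledD c by blast
  next
    case False
    have "of_nat (gen I) = c * (\<pi> * of_nat (gen I))" using \<pi>(2) by (simp add: c_def)
    then have "of_nat (gen I) \<in> ?J" using stableD(6)[OF I \<pi>O gen(2)[OF I]] by blast
    then have "gen ?J \<le> gen I" using gen(1)[OF I] by (intro gen_le)
    with False have eq: "gen ?J = gen I" by simp
    \<comment> \<open>The generator being unchanged, \<open>L\<close> still divides it and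
      \<open>div\<close> applies to \<open>?J\<close>; integrality of \<open>\<pi>^2 / L\<close>
      puts \<open>gen I / L\<close> into \<open>?J2\<close>.\<close>
    let ?J2 = "scaled c ?J"
    have J2: "stable ?J2" by (rule stab[OF J]) (simp add: eq L)
    obtain k where k: "gen I = L * k" using L(2) by blast
    have "(of_nat k :: complex) = c * (c * (\<pi> ^ 2 / of_nat L * of_nat (gen I)))"
      using \<pi>(2) L(1) by (simp add: c_def k power2_eq_square)
    then have "of_nat k \<in> ?J2" using stableD(6)[OF I \<pi>(3) gen(2)[OF I]] by blast
    moreover have "k > 0" "k < gen I" using gen(1)[OF I] L(1) by (auto simp: k)
    ultimately have "gen ?J2 < gen I" using gen_le[of k ?J2] by simp
    from IH[OF J2 this] show ?thesis using good_scaledD c by blast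
  qed
qed

lemma v_nonzero: "v \<noteq> 0" and u_nonzero: "u \<noteq> 0"
  using v_square u_square by auto

lemma conj_u_v: "\<sigma> u = - u" "\<tau> u = u" "\<sigma> v = v" "\<tau> v = - v"
  by (simp_all add: u_el v_el conj_el el_minus)

lemma u_v_in_F: "u \<in> F" "v \<in> F" by (simp_all add: u_el v_el)

text \<open>Multiplication by \<open>v / l\<close> exchanges the primes above \<open>l\<close> and above \<open>m\<close>.\<close>

lemma exchange_prime:
  assumes I: "stable I" "gen I = l ^ k" "k > 0"
    and l: "prime l" "odd l" "l \<noteq> p" "l * m = q * r" "prime m" "m \<noteq> l"
    and not_div: "\<not> (\<forall>x\<in>I. x / of_nat l \<in> \<O>)"
  shows "stable (scaled (v / of_nat l) I)" "gen (scaled (v / of_nat l) I) dvd m"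
proof -
  let ?c = "v / of_nat l" and ?J = "scaled (v / of_nat l) I"
  have l0: "(of_nat l :: complex) \<noteq> 0" using l(1) by auto
  have cF: "?c \<in> F" and c0: "?c \<noteq> 0" using u_v_in_F v_nonzero l0 by (auto intro: K_divide)
  have conj_c: "\<sigma> ?c = ?c" "\<tau> ?c = - ?c"
  proof -
    have "?c = of_rat (1 / of_nat l) * v" by (simp add: of_rat_divide)
    then have e: "?c = el 0 0 (1 / of_nat l) 0" by (simp only: v_el el_scaleR) simp
    show "\<sigma> ?c = ?c" "\<tau> ?c = - ?c" unfolding e by (simp_all add: conj_el el_minus)
  qed
  have div: "x * v / of_nat l \<in> \<O>" if "stable J" "l dvd gen J" "x \<in> J" for J x
    by (rule qr_factor_divides[OF that(1,2) l(1-4) that(3)])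
  have l_dvd: "l dvd gen I" using I(2,3) by simp
  have vv: "v * v = of_nat l * of_nat m" unfolding v_square l(4)[symmetric] by simp
  show J: "stable ?J"
  proof (rule stable_scaled[OF I(1) cF c0])
    show "?c * x \<in> \<O>" if "x \<in> I" for x using div[OF I(1) l_dvd that] by (simp add: mult.commute)
  qed (use c0 O_uminus[OF O_1] in \<open>simp_all add: conj_c\<close>)
  \<comment> \<open>Otherwise a second multiplication by \<open>v / l\<close> stays integral; as
    \<open>(v / l)^2 = m / l\<close>, every \<open>x / l\<close> with \<open>x\<close> in
    \<open>I\<close> would be integral.\<close>
  have "\<not> l dvd gen ?J"
  proof
    assume "l dvd gen ?J"
    have "x / of_nat l \<in> \<O>" if x: "x \<in> I" for x
    proof (rule O_coprime_multiples)
      have xO: "x \<in> \<O>" by (rule stableD(2)[OF I(1) x])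
      have "?c * x * v / of_nat l \<in> \<O>" by (rule div[OF J \<open>l dvd gen ?J\<close>]) (use x in blast)
      also have "?c * x * v / of_nat l = (v * v) * x / (of_nat l * of_nat l)" by simp
      also have "\<dots> = of_int (int m) * (x / of_nat l)" unfolding vv using l0 by simp
      finally show "of_int (int m) * (x / of_nat l) \<in> \<O>" .
      show "of_int (int l) * (x / of_nat l) \<in> \<O>" using xO l0 by simp
      show "Rings.coprime (int m) (int l)" by (rule primes_coprime_int[OF l(5,1,6)])
      show "x / of_nat l \<in> F" using xO by (intro K_divide O_in_K) auto
    qed
    with not_div show False by blast
  qed
  then have "Rings.coprime (gen ?J) l" using prime_imp_coprime[OF l(1)] coprime_commute by blast
  moreover have "gen ?J dvd m * l ^ k"
  proof (rule gen_dvd_nat[OF J])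
    have "of_nat (m * l ^ k) = ?c * (v * of_nat (gen I))"
      using vv l0 by (simp add: I(2) field_simps)
    then show "of_nat (m * l ^ k) \<in> ?J" using stableD(6)[OF I(1) v_in_O gen(2)[OF I(1)]] by blast
  qed
  ultimately show "gen ?J dvd m" by (meson coprime_dvd_mult_left_iff coprime_power_right_iff)
qed

text \<open>Integrality of \<open>x v / r\<close> gives \<open>I \<subseteq> \<PP>\<close>.
  Conversely the exchanged ideal contains \<open>q\<close>, so \<open>q \<PP>\<close> lies in
  \<open>I\<close>; so does \<open>r ^ k \<PP>\<close>, and Bezout combines the two.\<close>

lemma stable_eq_PP:
  assumes I: "stable I" "gen I = r ^ k" "k > 0" and not_div: "\<not> (\<forall>x\<in>I. x / of_nat r \<in> \<O>)"
  shows "I = \<PP>"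
proof
  have rq: "r * q = q * r" by simp
  have r_dvd: "r dvd gen I" using I(2,3) by simp
  have cop: "Rings.coprime (int r) (int q)" using primes_coprime_int prime_q prime_r distinct by metis
  show "I \<subseteq> \<PP>"
  proof
    fix x assume x: "x \<in> I"
    have xO: "x \<in> \<O>" by (rule stableD(2)[OF I(1) x])
    have "x ^ 2 / of_nat r \<in> \<O>"
    proof (rule O_coprime_multiples)
      have "x * v / of_nat r \<in> \<O>"
        by (rule qr_factor_divides[OF I(1) r_dvd prime_r odd_r _ rq x]) (use distinct in simp)
      then have "(x * v / of_nat r) ^ 2 \<in> \<O>" by (rule O_power)
      also have "(x * v / of_nat r) ^ 2 = x ^ 2 * (v * v) / (of_nat r * of_nat r)"
        by (simp add: power2_eq_square)
      also have "\<dots> = of_int (int q) * (x ^ 2 / of_nat r)" unfolding v_square by simp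
      finally show "of_int (int q) * (x ^ 2 / of_nat r) \<in> \<O>" .
      show "of_int (int r) * (x ^ 2 / of_nat r) \<in> \<O>" using O_power[OF xO] by simp
      show "Rings.coprime (int q) (int r)" using cop coprime_commute by blast
      show "x ^ 2 / of_nat r \<in> F" by (intro K_divide K_power O_in_K[OF xO]) simp
    qed
    with xO show "x \<in> \<PP>" by (simp add: \<PP>_def)
  qed
  show "\<PP> \<subseteq> I"
  proof
    fix y assume y: "y \<in> \<PP>"
    let ?c = "v / of_nat r" and ?J = "scaled (v / of_nat r) I"
    have yO: "y \<in> \<O>" using y by (simp add: \<PP>_def)
    note J = exchange_prime[OF I prime_r odd_r _ rq prime_q _ not_div]
    have J1: "stable ?J" and J2: "gen ?J dvd q" using J distinct by auto
    obtain j where "q = gen ?J * j" using J2 by blast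
    then have "of_nat q = of_nat j * (of_nat (gen ?J) :: complex)" by (metis mult.commute of_nat_mult)
    then have qJ: "of_nat q \<in> ?J" using stableD(6)[OF J1 _ gen(2)[OF J1], of "of_nat j"] by simp
    have "v * y / of_nat r \<in> \<O>"
      using dv_product[OF v_in_PP y] .
    from stableD(6)[OF J1 this qJ] obtain x where x: "x \<in> I" "v * y / of_nat r * of_nat q = ?c * x" by blast
    have "x = of_nat q * y" using x(2) v_nonzero by (simp add: field_simps)
    with x(1) have 1: "of_nat q * y \<in> I" by simp
    have 2: "of_nat (r ^ k) * y \<in> I"
      using stableD(6)[OF I(1) yO gen(2)[OF I(1)]] by (simp only: I(2) mult.commute)
    have "Rings.coprime (int q) (int (r ^ k))" using cop by (simp add: coprime_commute)
    then obtain a b where ab: "a * int q + b * int (r ^ k) = 1"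
      by (metis bezout_int coprime_imp_gcd_eq_1)
    have "of_int a * (of_nat q * y) + of_int b * (of_nat (r ^ k) * y) \<in> I"
      by (intro stableD(5,6)[OF I(1)] 1 2 O_of_int)
    also have "of_int a * (of_nat q * y) + of_int b * (of_nat (r ^ k) * y) = of_int (a * int q + b * int (r ^ k)) * y"
      by (simp add: algebra_simps)
    finally show "y \<in> I" unfolding ab by simp
  qed
qed

text \<open>All cases but the last divide once or twice by an element with stable ideal and lower
  \<open>gen I\<close>. In the last, no integer above 1 divides \<open>I\<close> and
  \<open>gen I\<close> is a power of \<open>r\<close> alone or of \<open>q\<close> alone.\<close>

lemma stable_good: "stable I \<Longrightarrow> good I"
proof (induction "gen I" arbitrary: I rule: less_induct)
  case less
  note I = less.prems
  have IH: "good J" if "stable J" "gen J < gen I" for J using less.hyps[OF that(2,1)] .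
  note pos = gen(1)[OF I]
  consider (nat) l where "l > 1" "\<forall>x\<in>I. x / of_nat l \<in> \<O>"
    | (unram) l where "prime l" "l dvd gen I" "l \<noteq> 2" "l \<noteq> p" "l \<noteq> q" "l \<noteq> r"
    | (two) "2 dvd gen I" | (p) "p dvd gen I" | (qr) "q * r dvd gen I"
    | (rest) "\<And>l. prime l \<Longrightarrow> l dvd gen I \<Longrightarrow> l = q \<or> l = r" "\<not> (q dvd gen I \<and> r dvd gen I)"
        "\<And>l. l > 1 \<Longrightarrow> \<not> (\<forall>x\<in>I. x / of_nat l \<in> \<O>)"
  proof -
    have "q * r dvd gen I" if "q dvd gen I" "r dvd gen I"
      using that prime_q prime_r distinct by (intro divides_mult) (simp_all add: primes_coprime)
    then show thesis using that by metis
  qed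
  then show ?case
  proof cases
    case nat
    then show ?thesis using good_by_division[OF I IH] by blast
  next
    case (unram l)
    then have "l > 1" using prime_gt_1_nat by blast
    then show ?thesis
      using good_by_division[OF I IH] unramified_divides[OF I unram(2,1,3-6)] by blast
  next
    case two
    obtain \<pi> where \<pi>: "\<pi> \<in> F" "\<pi> \<noteq> 0" "\<pi> ^ 2 / 2 \<in> \<O>" "2 / \<pi> ^ 2 \<in> \<O>" "\<pi> / \<sigma> \<pi> \<in> \<O>" "\<pi> / \<tau> \<pi> \<in> \<O>"
      by (rule prime_above_two)
    show ?thesis
    proof (rule good_by_uniformizer[OF I IH _ two \<pi>(1,2)])
      fix J x assume J: "stable J" "2 dvd gen J" "x \<in> J"
      have "(x / \<pi>) ^ 2 = (x ^ 2 / 2) * (2 / \<pi> ^ 2)" by (simp add: power_divide)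
      also have "\<dots> \<in> \<O>" by (intro O_mult two_divides_square[OF J] \<pi>)
      finally have "(x / \<pi>) ^ 2 \<in> \<O>" .
      moreover have "x / \<pi> \<in> F" by (rule K_divide[OF O_in_K[OF stableD(2)[OF J(1,3)]] \<pi>(1)])
      ultimately show "x / \<pi> \<in> \<O>" using O_square_iff by blast
    qed (use \<pi> in simp_all)
  next
    case p
    show ?thesis
    proof (rule good_by_uniformizer[OF I IH _ p u_v_in_F(1) u_nonzero])
      show "x / u \<in> \<O>" if "stable J" "p dvd gen J" "x \<in> J" for J x by (rule p_divides[OF that])
      show "p > 1" using prime_p by (rule prime_gt_1_nat)
      have "u ^ 2 / of_nat p = 1" by (simp add: power2_eq_square u_square)
      then show "u ^ 2 / of_nat p \<in> \<O>" by simp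
    qed (use u_nonzero O_uminus[OF O_1] in \<open>simp_all add: conj_u_v\<close>)
  next
    case qr
    show ?thesis
    proof (rule good_by_uniformizer[OF I IH _ qr u_v_in_F(2) v_nonzero])
      fix J x assume J: "stable J" "q * r dvd gen J" "x \<in> J"
      have xO: "x \<in> \<O>" by (rule stableD(2)[OF J(1,3)])
      have "q dvd gen J" "r dvd gen J" using J(2) by (auto dest: dvd_mult_left dvd_mult_right)
      then have 1: "x * v / of_nat q \<in> \<O>" "x * v / of_nat r \<in> \<O>"
        using qr_factor_divides[OF J(1) _ prime_q odd_q _ _ J(3), of r]
          qr_factor_divides[OF J(1) _ prime_r odd_r _ _ J(3), of q] distinct by (auto simp: mult.commute)
      show "x / v \<in> \<O>"
      proof (rule O_coprime_multiples)
        have "x / v = x * v / (v * v)" using v_nonzero by simp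
        then have xv: "x / v = x * v / (of_nat q * of_nat r)" by (simp add: v_square)
        show "of_int (int r) * (x / v) \<in> \<O>" "of_int (int q) * (x / v) \<in> \<O>"
          using 1 unfolding xv by simp_all
        show "Rings.coprime (int r) (int q)"
          using primes_coprime_int prime_q prime_r distinct by metis
        show "x / v \<in> F" by (rule K_divide[OF O_in_K[OF xO] u_v_in_F(2)])
      qed
    next
      show "q * r > 1" using qr_gt_1 by (metis of_nat_1 of_nat_less_iff)
      have "v ^ 2 / of_nat (q * r) = 1" by (simp add: power2_eq_square v_square)
      then show "v ^ 2 / of_nat (q * r) \<in> \<O>" by simp
    qed (use v_nonzero O_uminus[OF O_1] in \<open>simp_all add: conj_u_v\<close>)
  next
    case rest
    note not_div = rest(3)
    show ?thesis
    proof (cases "q dvd gen I")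
      case False
      then have "\<And>l. prime l \<Longrightarrow> l dvd gen I \<Longrightarrow> l = r" using rest(1) by blast
      then obtain k where k: "gen I = r ^ k" using prime_power_if_unique_prime[OF pos prime_r] by blast
      show ?thesis
      proof (cases "k = 0")
        case True
        then show ?thesis using gen_eq_1_iff[OF I] k good_O by simp
      next
        case False
        then show ?thesis using stable_eq_PP[OF I k] not_div[of r] r_gt_2 good_PP by simp
      qed
    next
      case True
      then have "\<And>l. prime l \<Longrightarrow> l dvd gen I \<Longrightarrow> l = q" using rest(1,2) by blast
      then obtain k where k: "gen I = q ^ k" using prime_power_if_unique_prime[OF pos prime_q] by blast
      have "k > 0" using True k prime_q by (cases k) auto
      \<comment> \<open>The exchange carries the part of \<open>I\<close> above \<open>q\<close> to
        \<open>r\<close>, where only \<open>\<O>\<close>, \<open>\<PP>\<close> and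
        \<open>r \<O>\<close> remain.\<close>
      let ?J = "scaled (v / of_nat q) I"
      have q1: "q > 1" using prime_q by (rule prime_gt_1_nat)
      have J: "stable ?J" "gen ?J dvd r"
        using exchange_prime[OF I k \<open>k > 0\<close> prime_q odd_q _ _ prime_r _ not_div[OF q1]] distinct by auto
      have c: "v / of_nat q \<in> F" "v / of_nat q \<noteq> 0"
        using u_v_in_F v_nonzero by (auto intro: K_divide)
      have "good ?J"
      proof (cases "gen ?J = 1")
        case True
        then show ?thesis using gen_eq_1_iff[OF J(1)] good_O by simp
      next
        case False
        then have gr: "gen ?J = r" using J(2) prime_r prime_nat_iff by blast
        show ?thesis
        proof (cases "\<forall>x\<in>?J. x / of_nat r \<in> \<O>")
          \<comment> \<open>Although no integer above 1 divides \<open>I\<close>, \<open>r\<close>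
            may divide \<open>?J\<close>; then \<open>gen ?J = r\<close> forces equality with
            \<open>r \<O>\<close>.\<close>
          case True
          have "?J = scaled (of_nat r) \<O>"
          proof
            show "?J \<subseteq> scaled (of_nat r) \<O>"
            proof
              fix x assume "x \<in> ?J"
              with True have "x / of_nat r \<in> \<O>" by blast
              then show "x \<in> scaled (of_nat r) \<O>" by (intro image_eqI[of _ _ "x / of_nat r"]) simp_all
            qed
            have "of_nat r \<in> ?J" using gen(2)[OF J(1)] gr by simp
            then show "scaled (of_nat r) \<O> \<subseteq> ?J"
              using stableD(6)[OF J(1)] by (auto simp: mult.commute[of "of_nat r"])
          qed
          then show ?thesis unfolding good_def by (intro exI[of _ "of_nat r"]) simp
        next
          case False
          then show ?thesis using stable_eq_PP[OF J(1), of 1] gr good_PP by simp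
        qed
      qed
      then show ?thesis by (rule good_scaledD[OF c])
    qed
  qed
qed

section \<open>Conclusion for the characteristic ideals of \<open>F\<close>\<close>

lemma char_ideal_good: "good (char_ideal F n)"
proof -
  note J = fractional_ideal_char_ideal[of n]
  have c: "fact n \<in> F" using K_of_nat[of "fact n"] by simp
  have conj_c: "conj s t (fact n) = fact n" for s t using conj_of_nat[of s t "fact n"] by simp
  have "conj s t (fact n * x) = fact n * conj s t x" if "x \<in> char_ideal F n" "s * s = 1" "t * t = 1" for x s t
    using that c fractional_idealD(1)[OF J] by (simp add: conj_mult conj_c)
  \<comment> \<open>The rational factor \<open>n!\<close> makes the ideal integral without affecting
    stability or its class.\<close>
  then have "stable (scaled (fact n) (char_ideal F n))"
    unfolding stable_def using fractional_ideal_scaled[OF J c] char_ideal_fact conj_char_ideal by auto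
  from stable_good[OF this] show ?thesis by (rule good_scaledD[OF c, rotated]) simp
qed

lemma nonprincipal_char_ideal:
  "\<exists>n\<ge>1. \<forall>x. x \<in> F \<longrightarrow> x \<noteq> 0 \<longrightarrow> char_ideal F n \<noteq> scaled x \<O>"
proof (rule ccontr)
  assume *: "\<not> ?thesis"
  have "r \<ge> 1" "r - 1 \<ge> 1" using r_gt_2 by auto
  with * obtain x y where "x \<in> F" "x \<noteq> 0" "char_ideal F r = scaled x \<O>"
    "y \<in> F" "y \<noteq> 0" "char_ideal F (r - 1) = scaled y \<O>" by meson
  then show False by (rule char_ideals_not_both_principal)
qed

lemma polya_group_F: "polya_group F \<cong> integer_mod_group 2"
proof -
  obtain n where n: "n \<ge> 1" "\<And>x. x \<in> F \<Longrightarrow> x \<noteq> 0 \<Longrightarrow> char_ideal F n \<noteq> scaled x \<O>"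
    using nonprincipal_char_ideal by blast
  show ?thesis
  proof (rule polya_group_iso_Z2[OF fractional_ideal_PP _ _ iprod_PP fractional_ideal_char_ideal _ n])
    show "\<exists>x. x \<in> F \<and> x \<noteq> 0 \<and> (char_ideal F k = scaled x \<O> \<or> char_ideal F k = scaled x \<PP>)" for k
      using char_ideal_good[of k] by (simp add: good_def)
  qed simp_all
qed

lemma not_polya_field_F: "\<not> polya_field F"
proof
  assume "polya_field F"
  then obtain f where "regular_basis F f" by (auto simp: polya_field_def)
  from char_ideal_regular_basis[OF this] nonprincipal_char_ideal show False by blast
qed

end

theorem theorem2:
  fixes p q r :: nat and F :: "complex set"
  assumes "prime p" and "prime q" and "prime r"
    and "p \<noteq> q" and "p \<noteq> r" and "q \<noteq> r"
    and "[p = 3] (mod 4)" and "[q = 3] (mod 4)" and "[r = 1] (mod 8)"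
    and "Legendre (int p) (int r) = 1" and "Legendre (int q) (int r) = -1"
    and "F = rat_adjoin {complex_of_real (sqrt (real p)), complex_of_real (sqrt (real (q * r)))}"
  shows "polya_group F \<cong> integer_mod_group 2 \<and> \<not> polya_field F"
proof -
  interpret B: biquadratic p q r by unfold_locales (fact assms)+
  have "F = B.F" unfolding assms(12) using B.rat_adjoin_eq_F unfolding B.u_def B.v_def .
  then show ?thesis using B.polya_group_F B.not_polya_field_F by simp
qed

end
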